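(* Fix $d\ge 1$, $0<\varepsilon<1$, $B>0$, and a real random variable $\xi$ satisfying the anti-concentration condition (there are constants $0<c_1<c_2$ and $c_3>0$ with $\mathbb{P}(c_1\le|\xi-\xi'|\le c_2)\ge c_3$, where $\xi'$ is an independent copy of $\xi$). Then there exist constants $C,n_0>0$, depending only on $B,\varepsilon,d,c_1,c_2,c_3$, such that the following holds for all $n\ge n_0$ and all $\beta>0$ (which may depend on $n$). Let $A=(a_{ij})_{1\le i,j\le n}$ be an $n\times n$ matrix with entries $a_{ij}\in\mathbb{R}^d$ and $a_{ij}=a_{ji}$ for all $i,j$, and suppose $$\rho:=\rho_{\beta,\xi}(A)\ge n^{-B}.$$ Then there exist a nonzero integer $k$ with $|k|\le n^{C}$, a set of $r\le C$ indices $i_1,\dots,i_r\in\{1,\dots,n\}$, and a set $I\subset\{1,\dots,n\}$ with $|I|\ge n-2n^{\varepsilon}$, such that for each $i\in I$ there exist integers $k_{ii_1},\dots,k_{ii_r}$, all of absolute value at most $n^{C}$, satisfying $$\mathbb{P}_{\mathbf{z}}\Big(\Big\| \sum_{j=1}^n z_j\Big(k\,a_{ij}+\sum_{l=1}^r k_{ii_l}\,a_{i_l j}\Big)\Big\|_2\le \beta n^{C}\Big)\ge n^{-C},$$ where $\mathbf{z}=(z_1,\dots,z_n)$ and the $z_j$ are iid copies of $\eta^{(1/2)}(\xi-\xi')$, with $\xi'$ an independent copy of $\xi$ and $\eta^{(1/2)}$ independent of $\xi,\xi'$.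
   Context: For an $n\times n$ matrix $A=(a_{ij})$ with entries in $\mathbb{R}^d$, the quadratic small ball probability is $$\rho_{\beta,\xi}(A):=\sup_{a,b_1,\dots,b_n\in\mathbb{R}^d}\mathbb{P}\Big(\sum_{i,j}a_{ij}x_ix_j+\sum_i b_ix_i\in B(a,\beta)\Big),$$ where $x_1,\dots,x_n$ are iid copies of $\xi$ and $B(a,\beta)$ is the closed Euclidean ball of radius $\beta$ centered at $a$. For $0<\mu\le 1$, $\eta^{(\mu)}$ denotes the random variable taking values $1$ and $-1$ each with probability $\mu/2$ and $0$ with probability $1-\mu$. The $i$-th row of $A$ is $(a_{i1},\dots,a_{in})$. *)

theory Defs
  imports "HOL-Probability.Probability"
begin

text \<open>
  A real random variable is given by its law, a Borel probability measure on the reals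
  (\<^locale>\<open>real_distribution\<close>); iid copies of it are the coordinates of the product measure.
  Indices range over \<open>{1..n}\<close>; values of \<open>A\<close> and \<open>b\<close> outside this range are irrelevant.
\<close>

definition anti_concentrated :: "real \<Rightarrow> real \<Rightarrow> real \<Rightarrow> real measure \<Rightarrow> bool" where
  "anti_concentrated c1 c2 c3 \<xi> \<longleftrightarrow>
     measure (\<xi> \<Otimes>\<^sub>M \<xi>)
       {(x, x') \<in> space (\<xi> \<Otimes>\<^sub>M \<xi>). c1 \<le> \<bar>x - x'\<bar> \<and> \<bar>x - x'\<bar> \<le> c2} \<ge> c3"

definition iid :: "nat \<Rightarrow> real measure \<Rightarrow> (nat \<Rightarrow> real) measure" where
  "iid n \<xi> = (\<Pi>\<^sub>M i\<in>{1..n}. \<xi>)"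

definition quadratic_small_ball ::
    "nat \<Rightarrow> real \<Rightarrow> real measure \<Rightarrow> (nat \<Rightarrow> nat \<Rightarrow> real ^ 'd) \<Rightarrow> real" where
  "quadratic_small_ball n \<beta> \<xi> A =
     (SUP (a, b) \<in> (UNIV :: ((real ^ 'd) \<times> (nat \<Rightarrow> real ^ 'd)) set).
        measure (iid n \<xi>)
          {x \<in> space (iid n \<xi>).
             (\<Sum>i=1..n. \<Sum>j=1..n. (x i * x j) *\<^sub>R A i j) + (\<Sum>i=1..n. x i *\<^sub>R b i) \<in> cball a \<beta>})"

definition eta :: "real \<Rightarrow> real pmf" where
  "eta \<mu> = do {
     nonzero \<leftarrow> bernoulli_pmf \<mu>;
     if nonzero then pmf_of_set {1, -1} else return_pmf 0
   }"

lemma pmf_eta: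
  assumes "0 \<le> \<mu>" "\<mu> \<le> 1"
  shows "pmf (eta \<mu>) 1 = \<mu> / 2" "pmf (eta \<mu>) (-1) = \<mu> / 2" "pmf (eta \<mu>) 0 = 1 - \<mu>"
  using assms by (simp_all add: eta_def pmf_bind)

definition lazy_difference :: "real measure \<Rightarrow> real measure" where
  "lazy_difference \<xi> =
     distr (measure_pmf (eta (1/2)) \<Otimes>\<^sub>M (\<xi> \<Otimes>\<^sub>M \<xi>)) borel (\<lambda>(h, x, x'). h * (x - x'))"

lemma real_distribution_lazy_difference:
  assumes "real_distribution \<xi>"
  shows "real_distribution (lazy_difference \<xi>)"
proof -
  interpret real_distribution \<xi> by fact
  interpret P: pair_prob_space \<xi> \<xi> ..
  interpret Q: pair_prob_space "measure_pmf (eta (1/2))" "\<xi> \<Otimes>\<^sub>M \<xi>" ..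
  have [measurable]: "(\<lambda>h. h) \<in> borel_measurable (measure_pmf (eta (1/2)))"
    by simp
  have [measurable]: "(\<lambda>h. h) \<in> borel_measurable \<xi>"
    by (simp add: measurable_ident_sets)
  have "(\<lambda>(h, x, x'). h * (x - x')) \<in>
          borel_measurable (measure_pmf (eta (1/2)) \<Otimes>\<^sub>M (\<xi> \<Otimes>\<^sub>M \<xi>))"
    by measurable
  then show ?thesis
    unfolding lazy_difference_def by (rule Q.real_distribution_distr)
qed

end

theory Submission
  imports Defs "HOL-Real_Asymp.Real_Asymp"
begin

text \<open>
  Dominate the indicator of a ball by a Gaussian and expand it into frequencies \<open>t\<close>. For a fixed
  index set \<open>U\<close>, one Cauchy--Schwarz step in the variables outside \<open>U\<close> removes all terms except the
  bilinear ones between \<open>U\<close> and its complement; the variables outside \<open>U\<close> then separate into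
  characteristic functions evaluated at the row forms \<open>L\<^sub>i(z) = \<Sum>\<^sub>j z\<^sub>j a\<^sub>i\<^sub>j\<close> of the masked difference vector
  \<open>z = 1\<^sub>U (x - x')\<close>. So with polynomial probability in \<open>z\<close> the linear forms \<open>L\<^sub>i(z)\<close>, \<open>i \<notin> U\<close>, are
  concentrated.

  The linear inverse problem is solved greedily with a damping function \<open>G\<close> of the frequency. As long
  as many \<open>L\<^sub>i\<close> are not explained, convexity yields one of them, \<open>u\<close>, that may be repeated many times,
  which allows multiplying \<open>G\<close> by \<open>\<Prod>\<^sub>l (3 + cos (2\<^sup>l u \<bullet> t)) / 4\<close>. Every factor lowers the mean of \<open>G\<close>
  unless \<open>2\<^sup>l u\<close> is close to the spectrum of \<open>G\<close>. The mean is at least \<open>n\<close> to a constant negative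
  power, so only boundedly many free generators appear, and the product of all torsion orders, which
  serves as the common multiplier \<open>k\<close>, is polynomially bounded.

  Finally \<open>U\<close> is chosen uniformly at random, which makes \<open>z\<close> an iid vector with the lazy law. The
  pigeonhole principle fixes \<open>k\<close>, the generators, and, for each \<open>i\<close>, the coefficients; almost every
  index \<open>i\<close> lies outside \<open>U\<close> with conditional probability bounded below.
\<close>

section \<open>Gaussian frequencies and dyadic products\<close>

text \<open>Two scales make the count close. A direction repeated about n^(\<epsilon>/2) times pays
  for about (\<epsilon>/4) ln n doublings, so a free generator costs a fixed power of n, whereas a
  torsion order is at most exponential in the doublings that it cost. Each unit of cost may discard
  about n^(\<epsilon>/2) rows and only O(log n) units fit, which stays below n^\<epsilon>.

  The obstacle is uniformity: the structure found depends on \<open>U\<close>, on \<open>z\<close>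
  and on a scaling of the frequencies, while one \<open>k\<close> and one generator set are wanted.
  Hence the linear theorem uses the same multiplier for all rows and draws its generators from the
  rows themselves. Its answer then belongs to a list of polynomially many pairs, fixed before
  \<open>z\<close> is seen, and taking the most popular pair costs only a power of n. As a mask says
  nothing about the rows inside it, almost every row must also be shown to lie outside
  \<open>U\<close> often enough within the popular event.\<close>

locale gaussian_frequency = prob_space \<mu> for \<mu> :: "'a::euclidean_space measure" +
  assumes sets_eq_borel [measurable_cong]: "sets \<mu> = sets borel"
    and integral_iexp: "(CLINT t|\<mu>. iexp (x \<bullet> t)) = complex_of_real (exp (- (norm x)\<^sup>2 / 2))"
begin

lemma integral_cos: "(\<integral>t. cos (x \<bullet> t) \<partial>\<mu>) = exp (- (norm x)\<^sup>2 / 2)"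
proof -
  have "integrable \<mu> (\<lambda>t. iexp (x \<bullet> t))"
    by (rule integrable_const_bound[where B = 1]) auto
  then have "(\<integral>t. Re (iexp (x \<bullet> t)) \<partial>\<mu>) = Re (CLINT t|\<mu>. iexp (x \<bullet> t))"
    by (rule integral_Re)
  then show ?thesis by (simp add: integral_iexp Re_exp)
qed

text \<open>Stands in for the spectrum of \<open>G\<close>. For a product of factors (3 + cos)/4 the
  integral is an average of exp(-|x - y|^2/2) over the frequencies \<open>y\<close> of
  \<open>G\<close>, with nonnegative weights of total mass 1; keeping only this consequence avoids
  writing out the trigonometric expansion.\<close>

definition decays_off :: "real \<Rightarrow> 'a set \<Rightarrow> ('a \<Rightarrow> real) \<Rightarrow> bool" where
  "decays_off R X G \<longleftrightarrow>
     (\<forall>x. (\<forall>y\<in>X. R < norm (x - y)) \<longrightarrow> (\<integral>t. G t * cos (x \<bullet> t) \<partial>\<mu>) \<le> exp (- R\<^sup>2 / 2))"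

text \<open>The characteristic function of a lazy step: \<open>u\<close> or \<open>-u\<close> with
  probability 1/8 each, 0 with probability 3/4. Laziness keeps the factor at least 1/2, hence
  comparable with an exponential of 1 - cos.\<close>

definition lazy_factor :: "'a \<Rightarrow> 'a \<Rightarrow> real" where
  "lazy_factor u t = (3 + cos (u \<bullet> t)) / 4"

lemma lazy_factor_bounds: "0 \<le> lazy_factor u t" "lazy_factor u t \<le> 1"
  using cos_ge_minus_one[of "u \<bullet> t"] cos_le_one[of "u \<bullet> t"] by (simp_all add: lazy_factor_def del: cos_ge_minus_one cos_le_one)

lemma measurable_lazy_factor [measurable]: "lazy_factor u \<in> borel_measurable borel"
  unfolding lazy_factor_def[abs_def] by measurable

lemma integrable_bounded:
  assumes "f \<in> borel_measurable borel" and "\<And>t. \<bar>f t\<bar> \<le> (c::real)"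
  shows "integrable \<mu> f"
  by (rule integrable_const_bound[where B = c]) (use assms in \<open>auto simp: measurable_cong_sets[OF sets_eq_borel]\<close>)

lemma integrable_damped_cos:
  assumes [measurable]: "G \<in> borel_measurable borel" and "\<And>t. 0 \<le> G t" "\<And>t. G t \<le> (1::real)"
  shows "integrable \<mu> (\<lambda>t. G t * cos (x \<bullet> t))"
proof (rule integrable_bounded[where c = 1])
  show "\<bar>G t * cos (x \<bullet> t)\<bar> \<le> 1" for t
    using assms(2,3)[of t] abs_cos_le_one[of "x \<bullet> t"] by (simp add: abs_mult mult_le_one)
qed measurable

lemma decays_off_mono: "decays_off R X G \<Longrightarrow> X \<subseteq> Y \<Longrightarrow> decays_off R Y G"
  unfolding decays_off_def by blast

lemma decays_off_one:
  assumes "0 \<in> X" "0 \<le> R"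
  shows "decays_off R X (\<lambda>_. 1)"
  unfolding decays_off_def
proof (intro allI impI)
  fix x assume "\<forall>y\<in>X. R < norm (x - y)"
  then have "R < norm x" using assms(1) by force
  then have "R\<^sup>2 \<le> (norm x)\<^sup>2" using assms(2) by (simp add: power_mono)
  then show "(\<integral>t. 1 * cos (x \<bullet> t) \<partial>\<mu>) \<le> exp (- R\<^sup>2 / 2)" by (simp add: integral_cos)
qed

lemma integral_lazy_factor_cos:
  assumes [measurable]: "G \<in> borel_measurable borel" and "\<And>t. 0 \<le> G t" "\<And>t. G t \<le> (1::real)"
  shows "(\<integral>t. (G t * lazy_factor u t) * cos (x \<bullet> t) \<partial>\<mu>) =
    3/4 * (\<integral>t. G t * cos (x \<bullet> t) \<partial>\<mu>) + 1/8 * (\<integral>t. G t * cos ((x + u) \<bullet> t) \<partial>\<mu>)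
      + 1/8 * (\<integral>t. G t * cos ((x - u) \<bullet> t) \<partial>\<mu>)"
proof -
  note I = integrable_damped_cos[OF assms]
  have "(G t * lazy_factor u t) * cos (x \<bullet> t) =
      3/4 * (G t * cos (x \<bullet> t)) + 1/8 * (G t * cos ((x + u) \<bullet> t)) + 1/8 * (G t * cos ((x - u) \<bullet> t))" for t
    by (simp add: lazy_factor_def inner_add_left inner_diff_left cos_add cos_diff field_simps)
  then show ?thesis using I by simp
qed

text \<open>By the product formula, the new transform at \<open>x\<close> is the mean of the old
  values at \<open>x\<close>, \<open>x + u\<close>, \<open>x - u\<close> with weights 3/4, 1/8, 1/8,
  so the bound \<open>exp (- R\<^sup>2 / 2)\<close> is inherited without loss and only the set of
  frequencies grows.\<close>

lemma decays_off_lazy_factor: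
  assumes [measurable]: "G \<in> borel_measurable borel" and "\<And>t. 0 \<le> G t" "\<And>t. G t \<le> (1::real)"
    and D: "decays_off R X G"
    and X': "X \<subseteq> X'" "\<And>x. x \<in> X \<Longrightarrow> x + u \<in> X'" "\<And>x. x \<in> X \<Longrightarrow> x - u \<in> X'"
  shows "decays_off R X' (\<lambda>t. G t * lazy_factor u t)"
  unfolding decays_off_def
proof (intro allI impI)
  fix x assume far: "\<forall>y\<in>X'. R < norm (x - y)"
  have 1: "\<forall>y\<in>X. R < norm (x - y)" using far X'(1) by blast
  have 2: "\<forall>y\<in>X. R < norm ((x + u) - y)"
  proof
    fix y assume "y \<in> X"
    from far X'(3)[OF this] have "R < norm (x - (y - u))" by blast
    then show "R < norm ((x + u) - y)" by (simp add: algebra_simps)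
  qed
  have 3: "\<forall>y\<in>X. R < norm ((x - u) - y)"
  proof
    fix y assume "y \<in> X"
    from far X'(2)[OF this] have "R < norm (x - (y + u))" by blast
    then show "R < norm ((x - u) - y)" by (simp add: algebra_simps)
  qed
  show "(\<integral>t. G t * lazy_factor u t * cos (x \<bullet> t) \<partial>\<mu>) \<le> exp (- R\<^sup>2 / 2)"
    using D[unfolded decays_off_def, rule_format, of x] D[unfolded decays_off_def, rule_format, of "x+u"]
      D[unfolded decays_off_def, rule_format, of "x-u"] 1 2 3
    by (simp add: integral_lazy_factor_cos[OF assms(1-3)])
qed

text \<open>A Riesz product at dyadic multiples of \<open>u\<close>: its frequencies are all integer
  multiples \<open>l\<close> of \<open>u\<close> with |l| < 2^j, so heights grow exponentially in
  the number of factors paid for.\<close>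

definition dyadic_product :: "'a \<Rightarrow> nat \<Rightarrow> 'a \<Rightarrow> real" where
  "dyadic_product u j t = (\<Prod>l<j. lazy_factor (2 ^ l *\<^sub>R u) t)"

lemma dyadic_product_bounds: "0 \<le> dyadic_product u j t" "dyadic_product u j t \<le> 1"
  unfolding dyadic_product_def by (auto intro!: prod_nonneg prod_le_1 simp: lazy_factor_bounds)

lemma measurable_dyadic_product [measurable]: "dyadic_product u j \<in> borel_measurable borel"
  unfolding dyadic_product_def[abs_def] by measurable

lemma dyadic_product_Suc:
  "dyadic_product u (Suc j) t = dyadic_product u j t * lazy_factor (2 ^ j *\<^sub>R u) t"
  by (simp add: dyadic_product_def)

end

lemma one_minus_cos_double_le: "1 - cos (2 * x) \<le> 4 * (1 - cos (x::real))"
proof -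
  have "4 * (1 - cos x) - (1 - cos (2 * x)) = 2 * (1 - cos x)\<^sup>2"
    unfolding cos_double_cos by (simp add: power2_eq_square algebra_simps)
  then show ?thesis by (smt (verit) zero_le_power2)
qed

lemma one_minus_cos_power2_le: "1 - cos (2 ^ l * x) \<le> 4 ^ l * (1 - cos (x::real))"
proof (induction l)
  case (Suc l)
  have "1 - cos (2 ^ Suc l * x) \<le> 4 * (1 - cos (2 ^ l * x))"
    using one_minus_cos_double_le[of "2 ^ l * x"] by (simp add: mult.assoc)
  with Suc show ?case by simp
qed simp

text \<open>On [-1, 0] the graph of exp lies below its chord, and exp(-1) \<le> 1/2. With x = 1 -
  cos s the right-hand side is exactly the lazy factor (3 + cos s)/4.\<close>

lemma exp_half_le_affine:
  assumes "0 \<le> x" "x \<le> (2::real)"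
  shows "exp (- x / 2) \<le> 1 - x / 4"
proof -
  have e: "exp (-1::real) \<le> 1/2"
    using exp_ge_add_one_self[of "1::real"] by (simp add: exp_minus field_simps)
  have "exp (((1 - x/2) *\<^sub>R 0 + (x/2) *\<^sub>R (-1))) \<le> (1 - x/2) * exp 0 + (x/2) * exp (-1::real)"
    by (rule convex_onD[OF exp_convex]) (use assms in auto)
  also have "\<dots> \<le> (1 - x/2) * 1 + (x/2) * (1/2)" using e assms by (intro add_mono mult_left_mono) auto
  finally show ?thesis by (simp add: field_simps)
qed

context gaussian_frequency
begin

lemma exp_le_lazy_factor: "exp (- (4 ^ l * (1 - cos (u \<bullet> t)) / 2)) \<le> lazy_factor (2 ^ l *\<^sub>R u) t"
proof -
  have "exp (- (4 ^ l * (1 - cos (u \<bullet> t)) / 2)) \<le> exp (- (1 - cos (2 ^ l * (u \<bullet> t))) / 2)"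
    using one_minus_cos_power2_le[of l "u \<bullet> t"] by simp
  also have "\<dots> \<le> 1 - (1 - cos (2 ^ l * (u \<bullet> t))) / 4"
    by (rule exp_half_le_affine) (auto intro: order_trans[OF _ cos_ge_minus_one])
  also have "\<dots> = lazy_factor (2 ^ l *\<^sub>R u) t" by (simp add: lazy_factor_def field_simps)
  finally show ?thesis .
qed

text \<open>The costs 4^l/2 of the single factors add up to (4^j - 1)/6, which is the origin of the
  6. The direction of the estimate is what matters: a lower bound on a mean survives replacing the
  exponential by the product, whose frequencies are explicit.\<close>

lemma exp_le_dyadic_product:
  assumes "4 ^ j \<le> 6 * (c::real)"
  shows "exp (- c * (1 - cos (u \<bullet> t))) \<le> dyadic_product u j t"
proof -
  have "exp (- (\<Sum>l<j. 4 ^ l * (1 - cos (u \<bullet> t)) / 2)) \<le> dyadic_product u j t"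
    unfolding dyadic_product_def sum_negf[symmetric] exp_sum[OF finite_lessThan]
    by (intro prod_mono conjI exp_ge_zero exp_le_lazy_factor)
  moreover have "(\<Sum>l<j. 4 ^ l * (1 - cos (u \<bullet> t)) / 2) = (4 ^ j - 1) / 6 * (1 - cos (u \<bullet> t))"
    by (induction j) (simp_all add: field_simps)
  moreover have "(4 ^ j - 1) / 6 * (1 - cos (u \<bullet> t)) \<le> c * (1 - cos (u \<bullet> t))"
    using assms by (intro mult_right_mono) auto
  ultimately show ?thesis by (smt (verit) exp_le_cancel_iff mult_minus_left)
qed

end

section \<open>A linear inverse Littlewood--Offord theorem\<close>
text \<open>\<open>K\<close> is a parameter of the set and not of the point, since in the end one
  multiplier has to serve all rows: the points are approximate torsion of common order
  \<open>K\<close> modulo the bounded integer combinations of the generators.\<close>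

definition near_span :: "(nat \<Rightarrow> 'a::real_normed_vector) \<Rightarrow> nat set \<Rightarrow> nat \<Rightarrow> real \<Rightarrow> real \<Rightarrow> 'a set" where
  "near_span b W K M r = {x. \<exists>\<kappa>::nat \<Rightarrow> int. (\<forall>l\<in>W. \<bar>real_of_int (\<kappa> l)\<bar> \<le> M) \<and>
     norm (real K *\<^sub>R x - (\<Sum>l\<in>W. real_of_int (\<kappa> l) *\<^sub>R b l)) \<le> r}"

text \<open>Relations are stated after multiplication by \<open>K\<close>, so \<open>l\<close>
  copies of the new generator enter with coefficient \<open>l * K\<close>; the error does not
  change.\<close>

lemma near_span_extend:
  assumes "finite W" "i \<notin> W" "x \<in> near_span b W K M r"
    and "\<bar>real_of_int l\<bar> * real K \<le> M'" "M \<le> M'" "r \<le> r'"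
  shows "x + real_of_int l *\<^sub>R b i \<in> near_span b (insert i W) K M' r'"
proof -
  from assms(3) obtain \<kappa> :: "nat \<Rightarrow> int" where k: "\<forall>l\<in>W. \<bar>real_of_int (\<kappa> l)\<bar> \<le> M"
    "norm (real K *\<^sub>R x - (\<Sum>l\<in>W. real_of_int (\<kappa> l) *\<^sub>R b l)) \<le> r" unfolding near_span_def by blast
  define \<kappa>' where "\<kappa>' = \<kappa>(i := l * int K)"
  have "(\<Sum>l\<in>W. real_of_int (\<kappa>' l) *\<^sub>R b l) = (\<Sum>l\<in>W. real_of_int (\<kappa> l) *\<^sub>R b l)"
    by (rule sum.cong) (use assms(2) in \<open>auto simp: \<kappa>'_def\<close>)
  then have "real K *\<^sub>R (x + real_of_int l *\<^sub>R b i) - (\<Sum>l\<in>insert i W. real_of_int (\<kappa>' l) *\<^sub>R b l)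
      = real K *\<^sub>R x - (\<Sum>l\<in>W. real_of_int (\<kappa> l) *\<^sub>R b l)"
    using assms(1,2) by (simp add: \<kappa>'_def algebra_simps)
  moreover have "\<forall>l\<in>insert i W. \<bar>real_of_int (\<kappa>' l)\<bar> \<le> M'"
    using k(1) assms(2,4,5) by (auto simp: \<kappa>'_def abs_mult)
  ultimately show ?thesis using k(2) assms(6) unfolding near_span_def by force
qed

text \<open>Multiply the relation for \<open>x\<close> by \<open>q\<close>. The extra term,
  \<open>l * K\<close> times \<open>q u\<close>, is traded through q u \<approx> y for
  \<open>l\<close> times \<open>K y\<close>, which is already close to a combination. This gives the
  coefficients q \<kappa> + l \<nu>, and an error from both relations plus \<open>K\<close> times
  the torsion error.\<close>

lemma near_span_torsion:
  assumes x: "x \<in> near_span b W K M r" and y: "y \<in> near_span b W K M r"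
    and qu: "norm (real q *\<^sub>R u - y) \<le> R"
    and bounds: "real q * M + \<bar>real_of_int l\<bar> * M \<le> M'"
      "real q * r + \<bar>real_of_int l\<bar> * (real K * R + r) \<le> r'"
  shows "x + real_of_int l *\<^sub>R u \<in> near_span b W (K * q) M' r'"
proof -
  from x obtain \<kappa> :: "nat \<Rightarrow> int" where k: "\<And>l. l\<in>W \<Longrightarrow> \<bar>real_of_int (\<kappa> l)\<bar> \<le> M"
    "norm (real K *\<^sub>R x - (\<Sum>l\<in>W. real_of_int (\<kappa> l) *\<^sub>R b l)) \<le> r" unfolding near_span_def by blast
  from y obtain \<nu> :: "nat \<Rightarrow> int" where n: "\<And>l. l\<in>W \<Longrightarrow> \<bar>real_of_int (\<nu> l)\<bar> \<le> M"
    "norm (real K *\<^sub>R y - (\<Sum>l\<in>W. real_of_int (\<nu> l) *\<^sub>R b l)) \<le> r" unfolding near_span_def by blast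
  define \<kappa>' where "\<kappa>' j = int q * \<kappa> j + l * \<nu> j" for j
  define X where "X = real K *\<^sub>R x - (\<Sum>l\<in>W. real_of_int (\<kappa> l) *\<^sub>R b l)"
  define Y where "Y = real K *\<^sub>R y - (\<Sum>l\<in>W. real_of_int (\<nu> l) *\<^sub>R b l)"
  define Z where "Z = real q *\<^sub>R u - y"
  have "(\<Sum>j\<in>W. real_of_int (\<kappa>' j) *\<^sub>R b j) =
      real q *\<^sub>R (\<Sum>l\<in>W. real_of_int (\<kappa> l) *\<^sub>R b l) + real_of_int l *\<^sub>R (\<Sum>l\<in>W. real_of_int (\<nu> l) *\<^sub>R b l)"
    by (simp add: \<kappa>'_def scaleR_add_left sum.distrib scaleR_sum_right)
  then have eq: "real (K * q) *\<^sub>R (x + real_of_int l *\<^sub>R u) - (\<Sum>j\<in>W. real_of_int (\<kappa>' j) *\<^sub>R b j)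
      = real q *\<^sub>R X + real_of_int l *\<^sub>R (real K *\<^sub>R Z + Y)"
    by (simp add: X_def Y_def Z_def algebra_simps)
  have "norm \<dots> \<le> real q * norm X + \<bar>real_of_int l\<bar> * (real K * norm Z + norm Y)"
  proof -
    have "norm (real K *\<^sub>R Z + Y) \<le> real K * norm Z + norm Y"
      using norm_triangle_ineq[of "real K *\<^sub>R Z" Y] by simp
    then have "\<bar>real_of_int l\<bar> * norm (real K *\<^sub>R Z + Y) \<le> \<bar>real_of_int l\<bar> * (real K * norm Z + norm Y)"
      by (rule mult_left_mono) simp
    then show ?thesis
      using norm_triangle_ineq[of "real q *\<^sub>R X" "real_of_int l *\<^sub>R (real K *\<^sub>R Z + Y)"] by simp
  qed
  also have "\<dots> \<le> real q * r + \<bar>real_of_int l\<bar> * (real K * R + r)"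
    using k(2) n(2) qu unfolding X_def[symmetric] Y_def[symmetric] Z_def[symmetric]
    by (intro add_mono mult_left_mono) auto
  finally have 1: "norm (real (K * q) *\<^sub>R (x + real_of_int l *\<^sub>R u) - (\<Sum>j\<in>W. real_of_int (\<kappa>' j) *\<^sub>R b j)) \<le> r'"
    using eq bounds(2) by simp
  have 2: "\<bar>real_of_int (\<kappa>' j)\<bar> \<le> M'" if "j \<in> W" for j
  proof -
    have "\<bar>real_of_int (\<kappa>' j)\<bar> \<le> real q * \<bar>real_of_int (\<kappa> j)\<bar> + \<bar>real_of_int l\<bar> * \<bar>real_of_int (\<nu> j)\<bar>"
      unfolding \<kappa>'_def using abs_triangle_ineq[of "real q * real_of_int (\<kappa> j)" "real_of_int l * real_of_int (\<nu> j)"]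
      by (simp add: abs_mult)
    also have "\<dots> \<le> real q * M + \<bar>real_of_int l\<bar> * M"
      using k(1)[OF that] n(1)[OF that] by (intro add_mono mult_left_mono) auto
    finally show ?thesis using bounds(1) by simp
  qed
  show ?thesis unfolding near_span_def using 1 2 by blast
qed

context gaussian_frequency
begin

text \<open>3/4 + (1/8 + 1/8)/2 = 7/8: in the product formula at 0 the two shifted integrals
  coincide, because cos is even.\<close>

lemma integral_lazy_factor:
  assumes [measurable]: "G \<in> borel_measurable borel" and "\<And>t. 0 \<le> G t" "\<And>t. G t \<le> (1::real)"
    and "(\<integral>t. G t * cos (u \<bullet> t) \<partial>\<mu>) \<le> 1/2 * (\<integral>t. G t \<partial>\<mu>)"
  shows "(\<integral>t. G t * lazy_factor u t \<partial>\<mu>) \<le> 7/8 * (\<integral>t. G t \<partial>\<mu>)"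
  using integral_lazy_factor_cos[OF assms(1-3), of u 0] assms(4) by simp

lemma damped_dyadic_bounds:
  assumes "\<And>t. 0 \<le> G t" "\<And>t. G t \<le> (1::real)"
  shows "0 \<le> G t * dyadic_product u j t" "G t * dyadic_product u j t \<le> 1"
  using assms dyadic_product_bounds[of u j t] by (auto intro: mult_le_one)

lemma integral_dyadic_product:
  assumes [measurable]: "G \<in> borel_measurable borel" and G: "\<And>t. 0 \<le> G t" "\<And>t. G t \<le> (1::real)"
    and "\<And>l. l < j \<Longrightarrow> (\<integral>t. G t * dyadic_product u l t * cos ((2 ^ l *\<^sub>R u) \<bullet> t) \<partial>\<mu>)
            \<le> 1/2 * (\<integral>t. G t * dyadic_product u l t \<partial>\<mu>)"
  shows "(\<integral>t. G t * dyadic_product u j t \<partial>\<mu>) \<le> (7/8) ^ j * (\<integral>t. G t \<partial>\<mu>)"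
  using assms(4)
proof (induction j)
  case 0
  show ?case by (simp add: dyadic_product_def)
next
  case (Suc j)
  have "(\<integral>t. G t * dyadic_product u (Suc j) t \<partial>\<mu>) =
      (\<integral>t. (G t * dyadic_product u j t) * lazy_factor (2 ^ j *\<^sub>R u) t \<partial>\<mu>)"
    by (simp add: dyadic_product_Suc mult.assoc)
  also have "\<dots> \<le> 7/8 * (\<integral>t. G t * dyadic_product u j t \<partial>\<mu>)"
    by (rule integral_lazy_factor) (use damped_dyadic_bounds[OF G] Suc.prems[of j] in auto)
  also have "\<dots> \<le> 7/8 * ((7/8) ^ j * (\<integral>t. G t \<partial>\<mu>))"
    using Suc.IH Suc.prems by simp
  finally show ?case by simp
qed

lemma decays_off_dyadic_product:
  assumes [measurable]: "G \<in> borel_measurable borel" and G: "\<And>t. 0 \<le> G t" "\<And>t. G t \<le> (1::real)"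
    and "decays_off R X G"
  shows "decays_off R {x + real_of_int l *\<^sub>R u | x l. x \<in> X \<and> \<bar>l\<bar> < 2 ^ j} (\<lambda>t. G t * dyadic_product u j t)"
proof (induction j)
  case 0
  have "decays_off R {x + real_of_int l *\<^sub>R u | x l. x \<in> X \<and> \<bar>l\<bar> < 2 ^ 0} G"
    by (rule decays_off_mono[OF assms(4)]) force
  then show ?case by (simp add: dyadic_product_def)
next
  case (Suc j)
  let ?X = "\<lambda>j. {x + real_of_int l *\<^sub>R u | x l. x \<in> X \<and> \<bar>l\<bar> < 2 ^ j}"
  \<comment> \<open>Strictness is preserved: |l| < 2^j together with a shift by at most 2^j gives |l
    + k| < 2^(j+1).\<close>
  have shift: "y + s *\<^sub>R u \<in> ?X (Suc j)" if y: "y \<in> ?X j" and s: "s = real_of_int k" "\<bar>k\<bar> \<le> 2 ^ j" for y s k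
  proof -
    from y obtain x l where "x \<in> X" "\<bar>l\<bar> < 2 ^ j" "y = x + real_of_int l *\<^sub>R u" by blast
    then have "y + s *\<^sub>R u = x + real_of_int (l + k) *\<^sub>R u" "\<bar>l + k\<bar> < 2 ^ Suc j" "x \<in> X"
      using s by (simp_all add: algebra_simps)
    then show ?thesis by blast
  qed
  have "decays_off R (?X (Suc j)) (\<lambda>t. (G t * dyadic_product u j t) * lazy_factor (2 ^ j *\<^sub>R u) t)"
  proof (rule decays_off_lazy_factor[OF _ _ _ Suc.IH])
    show "?X j \<subseteq> ?X (Suc j)"
    proof
      show "y \<in> ?X (Suc j)" if "y \<in> ?X j" for y using shift[OF that, of 0 0] by simp
    qed
    show "y + 2 ^ j *\<^sub>R u \<in> ?X (Suc j)" if "y \<in> ?X j" for y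
      using shift[OF that, of "2 ^ j" "2 ^ j"] by simp
    show "y - 2 ^ j *\<^sub>R u \<in> ?X (Suc j)" if "y \<in> ?X j" for y
      using shift[OF that, of "- (2 ^ j)" "- (2 ^ j)"] by simp
  qed (use damped_dyadic_bounds[OF G] in auto)
  then show ?case by (simp add: dyadic_product_Suc mult.assoc)
qed

text \<open>Up to constants, the sum of the squared distances of \<open>b i \<bullet> t\<close> from
  the integer multiples of 2 pi. Products of characteristic functions will be bounded through
  \<open>exp (- c * energy b S t)\<close>.\<close>

definition energy :: "(nat \<Rightarrow> 'a) \<Rightarrow> nat set \<Rightarrow> 'a \<Rightarrow> real" where
  "energy b S t = (\<Sum>i\<in>S. 1 - cos (b i \<bullet> t))"

lemma energy_nonneg: "0 \<le> energy b S t"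
  unfolding energy_def by (rule sum_nonneg) simp

lemma measurable_energy [measurable]: "energy b S \<in> borel_measurable borel"
  unfolding energy_def[abs_def] by measurable

lemma exp_energy_bounds:
  assumes "0 \<le> c"
  shows "0 \<le> exp (- c * energy b S t)" "exp (- c * energy b S t) \<le> 1"
  using assms energy_nonneg[of b S t] by simp_all

text \<open>Convexity of exp, that is, the inequality of arithmetic and geometric means: a product
  of \<open>m\<close> different factors is at most the average of their \<open>m\<close>-th
  powers.\<close>

lemma exp_energy_le_average:
  assumes "finite T" "card T = m" "0 < m"
  shows "exp (- c * energy b T t) \<le> (\<Sum>i\<in>T. exp (- (c * real m) * (1 - cos (b i \<bullet> t)))) / real m"
proof -
  have "exp (\<Sum>i\<in>T. (1 / real m) *\<^sub>R (- (c * real m) * (1 - cos (b i \<bullet> t))))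
     \<le> (\<Sum>i\<in>T. (1 / real m) * exp (- (c * real m) * (1 - cos (b i \<bullet> t))))"
    by (rule convex_on_sum[OF _ _ exp_convex]) (use assms in auto)
  moreover have "(\<Sum>i\<in>T. (1 / real m) *\<^sub>R (- (c * real m) * (1 - cos (b i \<bullet> t)))) = - c * energy b T t"
    using assms(3) by (simp add: energy_def sum_distrib_left sum_negf)
  ultimately show ?thesis by (simp add: sum_divide_distrib)
qed

text \<open>Once the product over \<open>T\<close> is replaced by a mean of \<open>m\<close>-th
  powers, some single direction must carry the whole lower bound. It then has weight
  \<open>c * m\<close>, as if it occurred \<open>m\<close> times.\<close>

lemma exists_repeated_direction:
  assumes [measurable]: "H \<in> borel_measurable borel" and H: "\<And>t. 0 \<le> H t" "\<And>t. H t \<le> 1"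
    and T: "finite T" "card T = m" "0 < m" and "0 \<le> c"
    and rho: "\<rho> \<le> (\<integral>t. H t * exp (- c * energy b T t) \<partial>\<mu>)"
  shows "\<exists>i\<in>T. \<rho> \<le> (\<integral>t. H t * exp (- (c * real m) * (1 - cos (b i \<bullet> t))) \<partial>\<mu>)"
proof (rule ccontr)
  assume "\<not> ?thesis"
  then have less: "(\<integral>t. H t * exp (- (c * real m) * (1 - cos (b i \<bullet> t))) \<partial>\<mu>) < \<rho>" if "i \<in> T" for i
    using that by force
  have int: "integrable \<mu> (\<lambda>t. H t * exp (- (c * real m) * (1 - cos (b i \<bullet> t))))" for i
  proof (rule integrable_bounded[where c = 1])
    fix t
    have "exp (- (c * real m) * (1 - cos (b i \<bullet> t))) \<le> 1" using \<open>0 \<le> c\<close> by simp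
    then show "\<bar>H t * exp (- (c * real m) * (1 - cos (b i \<bullet> t)))\<bar> \<le> 1"
      using H[of t] by (simp add: abs_mult mult_le_one)
  qed measurable
  have int2: "integrable \<mu> (\<lambda>t. H t * exp (- c * energy b T t))"
    by (rule integrable_bounded[where c = 1])
      (use H exp_energy_bounds[OF \<open>0 \<le> c\<close>] in \<open>auto simp: abs_mult intro!: mult_le_one\<close>)
  have "\<rho> \<le> (\<integral>t. (\<Sum>i\<in>T. H t * exp (- (c * real m) * (1 - cos (b i \<bullet> t)))) / real m \<partial>\<mu>)"
  proof (rule order_trans[OF rho integral_mono])
    fix t
    show "H t * exp (- c * energy b T t) \<le> (\<Sum>i\<in>T. H t * exp (- (c * real m) * (1 - cos (b i \<bullet> t)))) / real m"
      using mult_left_mono[OF exp_energy_le_average[OF T, of c b t] H(1)[of t]]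
      by (simp add: sum_distrib_left)
  qed (use int int2 in auto)
  also have "\<dots> = (\<Sum>i\<in>T. (\<integral>t. H t * exp (- (c * real m) * (1 - cos (b i \<bullet> t))) \<partial>\<mu>)) / real m"
    using int by simp
  also have "\<dots> < (\<Sum>i\<in>T. \<rho>) / real m"
    using T less by (intro divide_strict_right_mono sum_strict_mono) (auto simp: card_gt_0_iff)
  also have "\<dots> = \<rho>" using T by simp
  finally show False by simp
qed

end

lemma abs_real_of_int_le_power2:
  assumes "\<bar>l\<bar> < 2 ^ j"
  shows "\<bar>real_of_int l\<bar> \<le> 2 ^ j"
proof -
  have "real_of_int \<bar>l\<bar> < real_of_int (2 ^ j)" using assms by (simp only: of_int_less_iff)
  then show ?thesis by simp
qed

context gaussian_frequency
begin

text \<open>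
  The natural number \<open>a\<close> is the energy already spent: the current damping \<open>G\<close> has mean at most
  \<open>(7/8)\<^sup>a\<close>, while all integers and errors collected so far are controlled by \<open>8\<^sup>a\<close>. Both a new
  free generator and a new torsion relation cost energy in proportion to the logarithm of their
  height, so the lower bound \<open>\<rho>\<close> on the mean bounds everything polynomially.
\<close>

definition reachable ::
    "(nat \<Rightarrow> 'a) \<Rightarrow> nat set \<Rightarrow> real \<Rightarrow> real \<Rightarrow> nat \<Rightarrow> nat \<Rightarrow> real \<Rightarrow> nat \<Rightarrow> nat \<Rightarrow> nat set \<Rightarrow> nat set \<Rightarrow> bool" where
  "reachable b V c \<rho> m J R a K W S \<longleftrightarrow>
     S \<subseteq> V \<and> W \<subseteq> V - S \<and> card (V - S) \<le> a * m \<and> J * card W \<le> a \<and> 1 \<le> K \<and> real K \<le> 8 ^ a \<and>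
     (\<exists>G. G \<in> borel_measurable borel \<and> (\<forall>t. 0 \<le> G t \<and> G t \<le> 1) \<and> (\<integral>t. G t \<partial>\<mu>) \<le> (7/8) ^ a \<and>
       decays_off R (near_span b W K (8 ^ a) (8 ^ a * R)) G \<and>
       \<rho> \<le> (\<integral>t. G t * exp (- c * energy b S t) \<partial>\<mu>))"

lemma reachable_start:
  assumes "\<rho> \<le> (\<integral>t. exp (- c * energy b V t) \<partial>\<mu>)" "0 \<le> R"
  shows "reachable b V c \<rho> m J R 0 1 {} V"
proof -
  have "0 \<in> near_span b {} 1 1 R" using assms(2) by (simp add: near_span_def)
  then have "decays_off R (near_span b {} 1 (8 ^ 0) (8 ^ 0 * R)) (\<lambda>_. 1)"
    using assms(2) by (intro decays_off_one) simp_all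
  then show ?thesis using assms(1) prob_space unfolding reachable_def
    by (intro conjI exI[of _ "\<lambda>_. 1"]) simp_all
qed

text \<open>The remaining exponential is at most 1, so \<rho> limits the energy that can be spent;
  this forces the greedy procedure to stop.\<close>

lemma reachable_bound:
  assumes "reachable b V c \<rho> m J R a K W S" "0 \<le> c"
  shows "\<rho> \<le> (7/8) ^ a"
proof -
  from assms obtain G where [measurable]: "G \<in> borel_measurable borel"
    and G: "\<And>t. 0 \<le> G t" "\<And>t. G t \<le> 1"
    and a: "(\<integral>t. G t \<partial>\<mu>) \<le> (7/8) ^ a" and r: "\<rho> \<le> (\<integral>t. G t * exp (- c * energy b S t) \<partial>\<mu>)"
    unfolding reachable_def by auto
  have "(\<integral>t. G t * exp (- c * energy b S t) \<partial>\<mu>) \<le> (\<integral>t. G t \<partial>\<mu>)"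
  proof (rule integral_mono)
    show "integrable \<mu> (\<lambda>t. G t * exp (- c * energy b S t))"
      by (rule integrable_bounded[where c = 1])
        (use G exp_energy_bounds[OF assms(2)] in \<open>auto simp: abs_mult intro!: mult_le_one\<close>)
    show "integrable \<mu> G" by (rule integrable_bounded[where c = 1]) (use G in auto)
    show "G t * exp (- c * energy b S t) \<le> G t" for t
      using G(1)[of t] exp_energy_bounds[OF assms(2), of b S t] by (simp add: mult_left_le)
  qed
  with a r show ?thesis by linarith
qed

text \<open>
  Multiply \<open>G\<close> by the factors at \<open>u, 2u, 4u, \<dots>\<close>, each of which costs a factor \<open>7/8\<close> unless \<open>2\<^sup>j u\<close> is
  already close to the spectrum. Stopping at \<open>j\<close> makes \<open>q u\<close>, for some \<open>0 < q < 2\<^sup>j\<^sup>+\<^sup>1\<close>, close to the old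
  spectrum, a torsion relation absorbed into \<open>K\<close>; never stopping makes \<open>u\<close> a new generator.
\<close>

lemma reachable_step:
  assumes reach: "reachable b V c \<rho> m J R a K W S"
    and fin: "finite V" and c: "0 < c" and m: "0 < m" and J: "0 < J" "4 ^ J \<le> 6 * (c * real m)"
    and R: "0 < R" "exp (- R\<^sup>2 / 2) < \<rho> / 2"
    and T: "T \<subseteq> S" "card T = m" "\<And>i. i \<in> T \<Longrightarrow> b i \<notin> near_span b W K (8 ^ a) (2 * 8 ^ a * R)"
  shows "\<exists>a' K' W' S'. a < a' \<and> reachable b V c \<rho> m J R a' K' W' S'"
proof -
  let ?M = "8 ^ a :: real"
  let ?X = "near_span b W K ?M (?M * R)"
  from reach obtain G where Gm[measurable]: "G \<in> borel_measurable borel"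
    and G: "\<And>t. 0 \<le> G t" "\<And>t. G t \<le> 1"
    and a: "(\<integral>t. G t \<partial>\<mu>) \<le> (7/8) ^ a" and r: "\<rho> \<le> (\<integral>t. G t * exp (- c * energy b S t) \<partial>\<mu>)"
    and D: "decays_off R ?X G"
    and sets: "S \<subseteq> V" "W \<subseteq> V - S" "card (V - S) \<le> a * m" "J * card W \<le> a" "1 \<le> K" "real K \<le> ?M"
    unfolding reachable_def by auto
  have finS: "finite S" "finite T" "finite W" using sets T fin by (auto intro: finite_subset)
  \<comment> \<open>All of \<open>T\<close> is sacrificed to obtain \<open>m\<close> copies of a
    single \<open>u\<close>; only the energy over the remaining indices is kept for later
    steps.\<close>
  define S' where "S' = S - T"
  have energy_split: "energy b S t = energy b S' t + energy b T t" for t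
    unfolding energy_def S'_def using finS T(1) by (simp add: sum.subset_diff)
  define H where "H t = G t * exp (- c * energy b S' t)" for t
  have Hm[measurable]: "H \<in> borel_measurable borel" unfolding H_def[abs_def] by measurable
  have H: "0 \<le> H t" "H t \<le> 1" for t
    using G[of t] exp_energy_bounds[of c b S' t] c by (auto simp: H_def intro!: mult_le_one)
  have "\<rho> \<le> (\<integral>t. H t * exp (- c * energy b T t) \<partial>\<mu>)"
    using r by (simp add: H_def energy_split exp_add ring_distribs mult.assoc exp_diff exp_minus divide_simps)
  then obtain i where i: "i \<in> T" and
    ri: "\<rho> \<le> (\<integral>t. H t * exp (- (c * real m) * (1 - cos (b i \<bullet> t))) \<partial>\<mu>)"
    using exists_repeated_direction[OF Hm H finS(2) T(2) m less_imp_le[OF c]] by blast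
  define u where "u = b i"
  define Gj where "Gj j t = G t * dyadic_product u j t" for j t
  have Gjm[measurable]: "Gj j \<in> borel_measurable borel" for j unfolding Gj_def[abs_def] by measurable
  have Gj: "0 \<le> Gj j t" "Gj j t \<le> 1" for j t
    using damped_dyadic_bounds[OF G] by (auto simp: Gj_def)
  have rj: "\<rho> \<le> (\<integral>t. Gj j t * exp (- c * energy b S' t) \<partial>\<mu>)" if "j \<le> J" for j
  proof -
    have "(4::real) ^ j \<le> 4 ^ J" using that by simp
    then have j: "4 ^ j \<le> 6 * (c * real m)" using J(2) by linarith
    have "(\<integral>t. H t * exp (- (c * real m) * (1 - cos (b i \<bullet> t))) \<partial>\<mu>) \<le> (\<integral>t. Gj j t * exp (- c * energy b S' t) \<partial>\<mu>)"
    proof (rule integral_mono)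
      show "integrable \<mu> (\<lambda>t. H t * exp (- (c * real m) * (1 - cos (b i \<bullet> t))))"
      proof (rule integrable_bounded[where c = 1])
        fix t
        have "exp (- (c * real m) * (1 - cos (b i \<bullet> t))) \<le> 1" using c by simp
        then show "\<bar>H t * exp (- (c * real m) * (1 - cos (b i \<bullet> t)))\<bar> \<le> 1"
          using H[of t] by (simp add: abs_mult mult_le_one)
      qed measurable
      show "integrable \<mu> (\<lambda>t. Gj j t * exp (- c * energy b S' t))"
        by (rule integrable_bounded[where c = 1])
          (use Gj exp_energy_bounds[of c] c in \<open>auto simp: abs_mult intro!: mult_le_one\<close>)
      fix t
      have "H t * exp (- (c * real m) * (1 - cos (b i \<bullet> t))) \<le> H t * dyadic_product u j t"
        using exp_le_dyadic_product[OF j, of u t] H(1)[of t] unfolding u_def by (rule mult_left_mono)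
      then show "H t * exp (- (c * real m) * (1 - cos (b i \<bullet> t))) \<le> Gj j t * exp (- c * energy b S' t)"
        by (simp add: H_def Gj_def mult_ac)
    qed
    with ri show ?thesis by linarith
  qed
  have rG: "\<rho> \<le> (\<integral>t. Gj j t \<partial>\<mu>)" if "j \<le> J" for j
  proof -
    have "(\<integral>t. Gj j t * exp (- c * energy b S' t) \<partial>\<mu>) \<le> (\<integral>t. Gj j t \<partial>\<mu>)"
    proof (rule integral_mono)
      show "integrable \<mu> (\<lambda>t. Gj j t * exp (- c * energy b S' t))"
        by (rule integrable_bounded[where c = 1])
          (use Gj exp_energy_bounds[of c] c in \<open>auto simp: abs_mult intro!: mult_le_one\<close>)
      show "integrable \<mu> (Gj j)" by (rule integrable_bounded[where c = 1]) (use Gj in auto)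
      show "Gj j t * exp (- c * energy b S' t) \<le> Gj j t" for t
        using Gj(1)[of j t] exp_energy_bounds[of c b S' t] c by (simp add: mult_left_le)
    qed
    with rj[OF that] show ?thesis by linarith
  qed
  define Xj where "Xj j = {x + real_of_int l *\<^sub>R u | x l. x \<in> ?X \<and> \<bar>l\<bar> < 2 ^ j}" for j :: nat
  have DX: "decays_off R (Xj j) (Gj j)" for j
    unfolding Xj_def Gj_def[abs_def] by (rule decays_off_dyadic_product[OF Gm G D])
  \<comment> \<open>Half the mean is the threshold: up to it the factor at 2^j u costs 7/8, above it
    the transform of \<open>Gj j\<close> is too large for 2^j u to be far from the spectrum.\<close>
  define stops where "stops j \<longleftrightarrow> j < J \<and>
    1/2 * (\<integral>t. Gj j t \<partial>\<mu>) < (\<integral>t. Gj j t * cos ((2 ^ j *\<^sub>R u) \<bullet> t) \<partial>\<mu>)" for j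
  have gain: "(\<integral>t. Gj j t \<partial>\<mu>) \<le> (7/8) ^ (a + j)" if "\<And>l. l < j \<Longrightarrow> \<not> stops l" "j \<le> J" for j
  proof -
    have "(\<integral>t. Gj j t \<partial>\<mu>) \<le> (7/8) ^ j * (\<integral>t. G t \<partial>\<mu>)"
      unfolding Gj_def
      by (rule integral_dyadic_product[OF Gm G]) (use that in \<open>force simp: stops_def Gj_def\<close>)
    also have "\<dots> \<le> (7/8) ^ j * (7/8) ^ a" using a by (intro mult_left_mono) auto
    finally show ?thesis by (simp add: power_add mult.commute)
  qed
  have S'V: "S' \<subseteq> V" "W \<subseteq> V - S'" using sets by (auto simp: S'_def)
  have iS: "i \<in> V - S'" "i \<notin> W" using i T(1) sets by (auto simp: S'_def)
  have card': "card (V - S') \<le> (a + 1) * m"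
  proof -
    have "V - S' = (V - S) \<union> T" using sets T by (auto simp: S'_def)
    then have "card (V - S') \<le> card (V - S) + card T" by (simp add: card_Un_le)
    then show ?thesis using sets(3) T(2) by simp
  qed
  have cardj: "card (V - S') \<le> (a + j) * m" if "1 \<le> j" for j
  proof -
    have "(a + 1) * m \<le> (a + j) * m" using that by (intro mult_le_mono1) simp
    with card' show ?thesis by linarith
  qed
  show ?thesis
  proof (cases "\<exists>j. stops j")
    case False
    \<comment> \<open>No stop occurred, so all \<open>J\<close> factors are paid for and
      \<open>u\<close> becomes a free generator; \<open>K\<close> stays as it is.\<close>
    have sub: "Xj J \<subseteq> near_span b (insert i W) K (8 ^ (a + J)) (8 ^ (a + J) * R)"
    proof
      fix y assume "y \<in> Xj J"
      then obtain x l where x: "x \<in> ?X" "\<bar>l\<bar> < 2 ^ J" "y = x + real_of_int l *\<^sub>R b i"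
        unfolding Xj_def u_def by blast
      have "\<bar>real_of_int l\<bar> \<le> 2 ^ J" by (rule abs_real_of_int_le_power2[OF x(2)])
      then have "\<bar>real_of_int l\<bar> * real K \<le> 2 ^ J * 8 ^ a" using sets(6) by (intro mult_mono) auto
      also have "\<dots> \<le> 8 ^ J * (8::real) ^ a" by (intro mult_right_mono power_mono) auto
      finally have 1: "\<bar>real_of_int l\<bar> * real K \<le> 8 ^ (a + J)" by (simp add: power_add mult.commute)
      have 2: "(8::real) ^ a \<le> 8 ^ (a + J)" by (rule power_increasing) auto
      then have 3: "8 ^ a * R \<le> 8 ^ (a + J) * R" using R(1) by (simp add: mult_right_mono)
      show "y \<in> near_span b (insert i W) K (8 ^ (a + J)) (8 ^ (a + J) * R)"
        unfolding x(3) by (rule near_span_extend[OF finS(3) iS(2) x(1) 1 2 3])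
    qed
    have K: "real K \<le> 8 ^ (a + J)"
      by (rule order_trans[OF sets(6) power_increasing]) auto
    have "reachable b V c \<rho> m J R (a + J) K (insert i W) S'"
      unfolding reachable_def
    proof (intro conjI exI[of _ "Gj J"])
      show "J * card (insert i W) \<le> a + J" using sets(4) finS(3) iS(2) by simp
      show "card (V - S') \<le> (a + J) * m" using cardj[of J] J(1) by simp
      show "\<forall>t. 0 \<le> Gj J t \<and> Gj J t \<le> 1" using Gj by blast
      show "(\<integral>t. Gj J t \<partial>\<mu>) \<le> (7/8) ^ (a + J)" using gain[of J] False by blast
      show "decays_off R (near_span b (insert i W) K (8 ^ (a + J)) (8 ^ (a + J) * R)) (Gj J)"
        by (rule decays_off_mono[OF DX sub])
      show "\<rho> \<le> (\<integral>t. Gj J t * exp (- c * energy b S' t) \<partial>\<mu>)" by (rule rj) simp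
    qed (use S'V iS K sets in auto)
    moreover have "a < a + J" using J(1) by simp
    ultimately show ?thesis by blast
  next
    case True
    define j where "j = (LEAST j. stops j)"
    have sj: "stops j" unfolding j_def using True by (rule LeastI_ex)
    have nj: "\<not> stops l" if "l < j" for l using that unfolding j_def by (rule not_less_Least)
    have jJ: "j < J" using sj by (simp add: stops_def)
    \<comment> \<open>The mean of \<open>Gj j\<close> is at least \<rho>, so at a stop the transform
      exceeds \<rho>/2 and with it the decay bound; hence 2^j u is within \<open>R\<close> of some x
      + l u.\<close>
    have "exp (- R\<^sup>2 / 2) < (\<integral>t. Gj j t * cos ((2 ^ j *\<^sub>R u) \<bullet> t) \<partial>\<mu>)"
      using sj R(2) rG[of j] jJ by (auto simp: stops_def)
    then have "\<not> (\<forall>y\<in>Xj j. R < norm (2 ^ j *\<^sub>R u - y))"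
      using DX[of j] unfolding decays_off_def by (meson not_le)
    then obtain x l where x: "x \<in> ?X" "\<bar>l\<bar> < 2 ^ j" "norm (2 ^ j *\<^sub>R u - (x + real_of_int l *\<^sub>R u)) \<le> R"
      unfolding Xj_def by (auto simp: not_less)
    \<comment> \<open>Collecting the multiples of \<open>u\<close> on one side. Since |l| < 2^j, the
      order \<open>q\<close> lies strictly between 0 and 2^(j+1).\<close>
    define q where "q = nat (2 ^ j - l)"
    have q: "int q = 2 ^ j - l" "1 \<le> q" using x(2) by (auto simp: q_def)
    have qr: "real q = 2 ^ j - real_of_int l"
      using q(1) by (metis of_int_diff of_int_numeral of_int_of_nat_eq of_int_power)
    have q2: "real q \<le> 2 * 2 ^ j"
      using abs_real_of_int_le_power2[OF x(2)] qr by linarith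
    have qu: "norm (real q *\<^sub>R u - x) \<le> R"
    proof -
      have "real q *\<^sub>R u - x = 2 ^ j *\<^sub>R u - (x + real_of_int l *\<^sub>R u)" by (simp add: qr algebra_simps)
      then show ?thesis using x(3) by (simp only:)
    qed
    \<comment> \<open>A stop at j = 0 would mean q = 1: \<open>u\<close> is within \<open>R\<close>
      of the old set, so \<open>K u\<close> is within K R + 8^a R \<le> 2 * 8^a R of a combination.
      Indices of \<open>T\<close> violate exactly this, which explains the factor 2 in their
      defining radius; hence every step makes progress.\<close>
    have j1: "1 \<le> j"
    proof (rule ccontr)
      assume "\<not> 1 \<le> j"
      then have "j = 0" by simp
      then have "q = 1" using q(1) x(2) by simp
      have "u + real_of_int 0 *\<^sub>R u \<in> near_span b W (K * 1) ?M (2 * ?M * R)"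
      proof -
        from x(1) obtain \<kappa> :: "nat \<Rightarrow> int" where k: "\<forall>l\<in>W. \<bar>real_of_int (\<kappa> l)\<bar> \<le> ?M"
          "norm (real K *\<^sub>R x - (\<Sum>l\<in>W. real_of_int (\<kappa> l) *\<^sub>R b l)) \<le> ?M * R"
          unfolding near_span_def by blast
        have "real K *\<^sub>R u - (\<Sum>l\<in>W. real_of_int (\<kappa> l) *\<^sub>R b l) =
           real K *\<^sub>R (u - x) + (real K *\<^sub>R x - (\<Sum>l\<in>W. real_of_int (\<kappa> l) *\<^sub>R b l))"
          by (simp add: algebra_simps)
        also have "norm \<dots> \<le> real K * norm (u - x) + ?M * R"
          using k(2) norm_triangle_ineq[of "real K *\<^sub>R (u - x)"
            "real K *\<^sub>R x - (\<Sum>l\<in>W. real_of_int (\<kappa> l) *\<^sub>R b l)"] by simp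
        also have "\<dots> \<le> ?M * R + ?M * R"
          using qu \<open>q = 1\<close> sets(6) by (intro add_right_mono mult_mono) auto
        finally show ?thesis using k(1) unfolding near_span_def by (auto simp: mult_ac)
      qed
      then show False using T(3)[OF i] by (simp add: u_def)
    qed
    \<comment> \<open>The reason for the base 8: a torsion step multiplies the order by at most 2 *
      2^j, the coefficients by 3 * 2^j and the errors by 4 * 2^j, and for j \<ge> 1 the factor 8^j
      absorbs all three.\<close>
    have 48: "4 * 2 ^ j \<le> (8::real) ^ j"
    proof -
      have "(4::real) ^ 1 \<le> 4 ^ j" using j1 by (rule power_increasing) simp
      then have "4 * 2 ^ j \<le> 4 ^ j * (2::real) ^ j" by (intro mult_right_mono) auto
      then show ?thesis by (simp flip: power_mult_distrib)
    qed
    have sub: "Xj j \<subseteq> near_span b W (K * q) (8 ^ (a + j)) (8 ^ (a + j) * R)"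
    proof
      fix y assume "y \<in> Xj j"
      then obtain x' l' where x': "x' \<in> ?X" "\<bar>l'\<bar> < 2 ^ j" "y = x' + real_of_int l' *\<^sub>R u"
        unfolding Xj_def by blast
      have l': "\<bar>real_of_int l'\<bar> \<le> 2 ^ j" by (rule abs_real_of_int_le_power2[OF x'(2)])
      have "real q * ?M + \<bar>real_of_int l'\<bar> * ?M \<le> (2 * 2 ^ j) * ?M + 2 ^ j * ?M"
        using q2 l' by (intro add_mono mult_right_mono) auto
      also have "\<dots> \<le> (4 * 2 ^ j) * ?M" by simp
      also have "\<dots> \<le> 8 ^ j * ?M" using 48 by (intro mult_right_mono) auto
      finally have 1: "real q * ?M + \<bar>real_of_int l'\<bar> * ?M \<le> 8 ^ (a + j)" by (simp add: power_add mult.commute)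
      have KR: "real K * R + ?M * R \<le> 2 * (?M * R)" using sets(6) R(1) by simp
      have "real q * (?M * R) + \<bar>real_of_int l'\<bar> * (real K * R + ?M * R)
          \<le> (2 * 2 ^ j) * (?M * R) + 2 ^ j * (2 * (?M * R))"
        using q2 l' R(1) KR by (intro add_mono mult_mono) auto
      also have "\<dots> = (4 * 2 ^ j) * (?M * R)" by simp
      also have "\<dots> \<le> 8 ^ j * (?M * R)" using 48 R(1) by (intro mult_right_mono) auto
      finally have 2: "real q * (?M * R) + \<bar>real_of_int l'\<bar> * (real K * R + ?M * R) \<le> 8 ^ (a + j) * R"
        by (simp add: power_add mult_ac)
      show "y \<in> near_span b W (K * q) (8 ^ (a + j)) (8 ^ (a + j) * R)"
        unfolding x'(3) by (rule near_span_torsion[OF x'(1) x(1) qu 1 2])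
    qed
    have K: "real (K * q) \<le> 8 ^ (a + j)"
    proof -
      have "real K * real q \<le> ?M * (4 * 2 ^ j)" using sets(6) q2 by (intro mult_mono) auto
      also have "\<dots> \<le> ?M * 8 ^ j" using 48 by (intro mult_left_mono) auto
      finally show ?thesis by (simp add: power_add)
    qed
    have "reachable b V c \<rho> m J R (a + j) (K * q) W S'"
      unfolding reachable_def
    proof (intro conjI exI[of _ "Gj j"])
      show "card (V - S') \<le> (a + j) * m" using cardj[OF j1] .
      show "\<forall>t. 0 \<le> Gj j t \<and> Gj j t \<le> 1" using Gj by blast
      show "(\<integral>t. Gj j t \<partial>\<mu>) \<le> (7/8) ^ (a + j)" using gain[of j] nj jJ by simp
      show "decays_off R (near_span b W (K * q) (8 ^ (a + j)) (8 ^ (a + j) * R)) (Gj j)"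
        by (rule decays_off_mono[OF DX sub])
      show "\<rho> \<le> (\<integral>t. Gj j t * exp (- c * energy b S' t) \<partial>\<mu>)" using jJ by (intro rj) simp
      show "1 \<le> K * q" using sets(5) q(2) by simp
    qed (use S'V K sets in auto)
    moreover have "a < a + j" using j1 by simp
    ultimately show ?thesis by blast
  qed
qed

text \<open>Take a reachable state with maximal \<open>a\<close>, which exists as \<rho> > 0 bounds
  \<open>a\<close>. Fewer than \<open>m\<close> unexplained indices are left in \<open>S\<close>,
  since \<open>m\<close> of them would allow another step, and at most \<open>a * m\<close> indices
  were discarded on the way.\<close>

lemma linear_inverse_littlewood_offord:
  assumes fin: "finite V" and c: "0 < c" and m: "0 < m" and J: "0 < J" "4 ^ J \<le> 6 * (c * real m)"
    and R: "0 < R" "exp (- R\<^sup>2 / 2) < \<rho> / 2"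
    and rho: "\<rho> \<le> (\<integral>t. exp (- c * energy b V t) \<partial>\<mu>)"
  shows "\<exists>a K W. \<rho> \<le> (7/8) ^ a \<and> 1 \<le> K \<and> real K \<le> 8 ^ a \<and> W \<subseteq> V \<and> J * card W \<le> a \<and>
    card {i \<in> V. b i \<notin> near_span b W K (8 ^ a) (2 * 8 ^ a * R)} \<le> (a + 1) * m"
proof -
  have pos: "0 < \<rho>" using R(2) exp_gt_zero[of "- R\<^sup>2 / 2"] by linarith
  define Q where "Q a \<longleftrightarrow> (\<exists>K W S. reachable b V c \<rho> m J R a K W S)" for a
  have Q0: "Q 0" using reachable_start[OF rho, of R m J] R(1) unfolding Q_def by auto
  obtain N where N: "(7/8::real) ^ N < \<rho>" using real_arch_pow_inv[OF pos, of "7/8"] by auto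
  have Qb: "a \<le> N" if "Q a" for a
  proof (rule ccontr)
    assume "\<not> a \<le> N"
    then have "(7/8::real) ^ a \<le> (7/8) ^ N" by (intro power_decreasing) auto
    with that N c show False unfolding Q_def by (meson reachable_bound less_imp_le not_le order_trans)
  qed
  define a where "a = (GREATEST a. Q a)"
  have Qa: "Q a" unfolding a_def by (rule GreatestI_nat[of Q 0 N]) (use Q0 Qb in auto)
  have amax: "\<not> Q a'" if "a < a'" for a'
    using Greatest_le_nat[of Q a' N] Qb that unfolding a_def by (meson not_le)
  from Qa obtain K W S where r: "reachable b V c \<rho> m J R a K W S" unfolding Q_def by blast
  define bad where "bad = {i \<in> V. b i \<notin> near_span b W K (8 ^ a) (2 * 8 ^ a * R)}"
  have S: "S \<subseteq> V" "W \<subseteq> V" "card (V - S) \<le> a * m" "J * card W \<le> a" "1 \<le> K" "real K \<le> 8 ^ a"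
    using r unfolding reachable_def by auto
  have "card (bad \<inter> S) < m"
  proof (rule ccontr)
    assume "\<not> ?thesis"
    then obtain T where "T \<subseteq> bad \<inter> S" "card T = m"
      by (meson not_less obtain_subset_with_card_n)
    then have "\<exists>a' K' W' S'. a < a' \<and> reachable b V c \<rho> m J R a' K' W' S'"
      by (intro reachable_step[OF r fin c m J R]) (auto simp: bad_def)
    then show False using amax unfolding Q_def by blast
  qed
  moreover have "card bad \<le> card (V - S) + card (bad \<inter> S)"
  proof -
    have "bad \<subseteq> (V - S) \<union> (bad \<inter> S)" by (auto simp: bad_def)
    then have "card bad \<le> card ((V - S) \<union> (bad \<inter> S))"
      using fin S(1) by (intro card_mono) (auto intro: finite_subset)
    then show ?thesis using card_Un_le order_trans by blast
  qed
  ultimately have "card bad \<le> (a + 1) * m" using S(3) by simp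
  moreover have "\<rho> \<le> (7/8) ^ a" using reachable_bound[OF r] c by simp
  ultimately show ?thesis using S unfolding bad_def by blast
qed

end

section \<open>Fourier analysis of the quadratic form\<close>
lemma gaussian_frequency_exists: "\<exists>\<mu> :: 'a::euclidean_space measure. gaussian_frequency \<mu>"
proof -
  interpret S: prob_space std_normal_distribution by (rule real_distribution.axioms(1)) (rule real_dist_normal_dist)
  interpret P: product_prob_space "\<lambda>_::'a. std_normal_distribution" ..
  let ?T = "Pi\<^sub>M (Basis::'a set) (\<lambda>_. std_normal_distribution)"
  let ?f = "\<lambda>\<tau>. \<Sum>b\<in>(Basis::'a set). \<tau> b *\<^sub>R b"
  have T: "prob_space ?T" by (rule prob_space_PiM) (rule S.prob_space_axioms)
  have f[measurable]: "?f \<in> borel_measurable ?T" by measurable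
  have "(CLINT t|distr ?T borel ?f. iexp (x \<bullet> t)) = complex_of_real (exp (- (norm x)\<^sup>2 / 2))" for x
  proof -
    have "(CLINT t|distr ?T borel ?f. iexp (x \<bullet> t)) = (CLINT \<tau>|?T. iexp (x \<bullet> ?f \<tau>))"
      by (subst integral_distr) auto
    also have "\<dots> = (CLINT \<tau>|?T. (\<Prod>b\<in>Basis. iexp ((x \<bullet> b) * \<tau> b)))"
      by (simp add: inner_sum_right sum_distrib_left exp_sum mult_ac)
    also have "\<dots> = (\<Prod>b\<in>Basis. CLINT s|std_normal_distribution. iexp ((x \<bullet> b) * s))"
      by (rule P.product_integral_prod) (auto intro!: S.integrable_const_bound[where B = 1])
    also have "\<dots> = (\<Prod>b\<in>Basis. complex_of_real (exp (- (x \<bullet> b)\<^sup>2 / 2)))"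
      using char_std_normal_distribution by (simp add: char_def fun_eq_iff)
    also have "\<dots> = complex_of_real (exp (\<Sum>b\<in>Basis. - (x \<bullet> b)\<^sup>2 / 2))"
      by (simp add: exp_sum)
    also have "(\<Sum>b\<in>Basis. - (x \<bullet> b)\<^sup>2 / 2) = - (norm x)\<^sup>2 / 2"
      unfolding power2_norm_eq_inner euclidean_inner[of x x]
      by (simp add: power2_eq_square sum_negf sum_divide_distrib)
    finally show ?thesis .
  qed
  then have "gaussian_frequency (distr ?T borel ?f)"
    using prob_space.prob_space_distr[OF T f]
    by (intro gaussian_frequency.intro gaussian_frequency_axioms.intro) auto
  then show ?thesis by blast
qed

section \<open>Symmetrization and decoupling of the quadratic phase\<close>

definition difference_law :: "real measure \<Rightarrow> real measure" where
  "difference_law \<xi> = distr (\<xi> \<Otimes>\<^sub>M \<xi>) borel (\<lambda>(x, x'). x - x')"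

lemma (in prob_space) power2_expectation_le:
  fixes X :: "'a \<Rightarrow> real"
  assumes [measurable]: "X \<in> borel_measurable M" and "\<And>x. \<bar>X x\<bar> \<le> B"
  shows "(expectation X)\<^sup>2 \<le> expectation (\<lambda>x. (X x)\<^sup>2)"
proof -
  have i: "integrable M X" by (rule integrable_const_bound[where B = B]) (use assms in auto)
  have "\<bar>(X x)\<^sup>2\<bar> \<le> B\<^sup>2" for x using assms(2)[of x] by (simp add: abs_le_square_iff power2_le_iff_abs_le)
  then have i2: "integrable M (\<lambda>x. (X x)\<^sup>2)" by (intro integrable_const_bound[where B = "B\<^sup>2"]) auto
  have "0 \<le> variance X" by (rule variance_positive)
  then show ?thesis by (simp add: variance_eq[OF i i2])
qed

text \<open>Cauchy--Schwarz in \<open>q\<close>, after which the square of the inner mean over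
  \<open>p\<close> is opened with an independent copy \<open>p'\<close>. The norm stays outside the
  integral over \<open>q\<close>, where the cancellation is still to be used.\<close>

lemma norm_integral_pair_power2_le:
  fixes f :: "'a \<times> 'b \<Rightarrow> complex"
  assumes "prob_space P" "prob_space Q"
    and f[measurable]: "f \<in> borel_measurable (P \<Otimes>\<^sub>M Q)" and bound: "\<And>z. norm (f z) \<le> 1"
  shows "(norm (\<integral>z. f z \<partial>(P \<Otimes>\<^sub>M Q)))\<^sup>2 \<le>
    (\<integral>(p, p'). norm (\<integral>q. f (p, q) * cnj (f (p', q)) \<partial>Q) \<partial>(P \<Otimes>\<^sub>M P))"
proof -
  interpret P: prob_space P by fact
  interpret Q: prob_space Q by fact
  interpret PQ: pair_prob_space P Q ..
  interpret PP: pair_prob_space P P ..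
  interpret PPQ: pair_prob_space "P \<Otimes>\<^sub>M P" Q ..
  have [measurable]: "cnj \<in> borel_measurable borel"
    by (intro borel_measurable_continuous_onI continuous_intros)
  define F where "F q = (\<integral>p. f (p, q) \<partial>P)" for q
  have Fm[measurable]: "F \<in> borel_measurable Q" unfolding F_def[abs_def] by measurable
  have intf: "integrable P (\<lambda>p. f (p, q))" if "q \<in> space Q" for q
    by (rule P.integrable_const_bound[where B = 1]) (use bound that in auto)
  have F1: "norm (F q) \<le> 1" if "q \<in> space Q" for q
  proof -
    have "norm (F q) \<le> (\<integral>p. norm (f (p, q)) \<partial>P)" unfolding F_def by (rule integral_norm_bound)
    also have "\<dots> \<le> (\<integral>p. 1 \<partial>P)"
      by (rule integral_mono) (use intf[OF that] bound in auto)
    finally show ?thesis by (simp add: P.prob_space)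
  qed
  \<comment> \<open>Cut off outside \<open>space Q\<close>, because the inequality for squares asks
    for a bound at every point.\<close>
  define X where "X q = norm (F q) * indicator (space Q) q" for q
  have Xm: "X \<in> borel_measurable Q" unfolding X_def[abs_def] by measurable
  have X1: "\<bar>X q\<bar> \<le> 1" for q using F1[of q] by (auto simp: X_def indicator_def)
  have intpf: "integrable (P \<Otimes>\<^sub>M Q) f"
    by (rule PQ.P.integrable_const_bound[where B = 1]) (use bound in auto)
  have "(\<integral>z. f z \<partial>(P \<Otimes>\<^sub>M Q)) = (\<integral>q. F q \<partial>Q)"
    unfolding F_def using PQ.integral_snd[of "\<lambda>p q. f (p, q)"] intpf by (simp add: split_beta')
  then have "norm (\<integral>z. f z \<partial>(P \<Otimes>\<^sub>M Q)) \<le> (\<integral>q. norm (F q) \<partial>Q)"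
    using integral_norm_bound by simp
  also have "\<dots> = (\<integral>q. X q \<partial>Q)" by (rule Bochner_Integration.integral_cong) (auto simp: X_def)
  finally have "(norm (\<integral>z. f z \<partial>(P \<Otimes>\<^sub>M Q)))\<^sup>2 \<le> (\<integral>q. X q \<partial>Q)\<^sup>2"
    by (rule power_mono) simp
  also have "\<dots> \<le> (\<integral>q. (X q)\<^sup>2 \<partial>Q)" by (rule Q.power2_expectation_le[OF Xm X1])
  finally have 1: "(norm (\<integral>z. f z \<partial>(P \<Otimes>\<^sub>M Q)))\<^sup>2 \<le> (\<integral>q. (X q)\<^sup>2 \<partial>Q)" .
  define h where "h z = f (fst (fst z), snd z) * cnj (f (snd (fst z), snd z))" for z
  have hm[measurable]: "h \<in> borel_measurable ((P \<Otimes>\<^sub>M P) \<Otimes>\<^sub>M Q)" unfolding h_def[abs_def] by measurable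
  have h1: "norm (h z) \<le> 1" for z
    using bound by (auto simp: h_def norm_mult split: prod.split intro!: mult_le_one)
  have inth: "integrable ((P \<Otimes>\<^sub>M P) \<Otimes>\<^sub>M Q) h"
    by (rule PPQ.P.integrable_const_bound[where B = 1]) (use h1 in auto)
  have Fh: "complex_of_real ((X q)\<^sup>2) = (\<integral>z. h (z, q) \<partial>(P \<Otimes>\<^sub>M P))" if q: "q \<in> space Q" for q
  proof -
    have "integrable (P \<Otimes>\<^sub>M P) (\<lambda>z. h (z, q))"
      by (rule PP.P.integrable_const_bound[where B = 1]) (use h1 q in auto)
    then have "(\<integral>z. h (z, q) \<partial>(P \<Otimes>\<^sub>M P)) = (\<integral>p. (\<integral>p'. f (p, q) * cnj (f (p', q)) \<partial>P) \<partial>P)"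
      using PP.integral_fst'[of "\<lambda>z. h (z, q)"] by (simp add: h_def)
    also have "\<dots> = F q * cnj (F q)"
      using intf[OF q] by (simp add: F_def integral_cnj)
    also have "\<dots> = complex_of_real ((X q)\<^sup>2)"
      using q by (simp add: X_def flip: complex_norm_square)
    finally show ?thesis by simp
  qed
  have "complex_of_real (\<integral>q. (X q)\<^sup>2 \<partial>Q) = (\<integral>q. complex_of_real ((X q)\<^sup>2) \<partial>Q)"
    by (rule integral_complex_of_real[symmetric])
  also have "\<dots> = (\<integral>q. (\<integral>z. h (z, q) \<partial>(P \<Otimes>\<^sub>M P)) \<partial>Q)"
    by (rule Bochner_Integration.integral_cong[OF refl Fh])
  also have "\<dots> = (\<integral>z. (\<integral>q. h (z, q) \<partial>Q) \<partial>(P \<Otimes>\<^sub>M P))"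
    using PPQ.Fubini_integral[of "\<lambda>z q. h (z, q)"] inth by (simp add: split_beta')
  finally have "(\<integral>q. (X q)\<^sup>2 \<partial>Q) = norm (\<integral>z. (\<integral>q. h (z, q) \<partial>Q) \<partial>(P \<Otimes>\<^sub>M P))"
    using norm_of_real[of "\<integral>q. (X q)\<^sup>2 \<partial>Q", where 'a = complex] by (simp del: norm_of_real)
  also have "\<dots> \<le> (\<integral>z. norm (\<integral>q. h (z, q) \<partial>Q) \<partial>(P \<Otimes>\<^sub>M P))" by (rule integral_norm_bound)
  finally show ?thesis using 1 by (simp add: h_def split_beta')
qed

context real_distribution
begin

lemma measurable_difference [measurable]: "(\<lambda>(x, x'). x - x') \<in> borel_measurable (M \<Otimes>\<^sub>M M)"
  by measurable

lemma prob_space_difference_law: "prob_space (difference_law M)"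
proof -
  interpret MM: pair_prob_space M M ..
  show ?thesis unfolding difference_law_def by (rule MM.P.prob_space_distr) measurable
qed

lemma sets_difference_law [simp, measurable_cong]: "sets (difference_law M) = sets borel"
  by (simp add: difference_law_def)

lemma space_difference_law [simp]: "space (difference_law M) = UNIV"
  by (simp add: difference_law_def)

lemma emeasure_difference_law:
  assumes [measurable]: "A \<in> sets borel"
  shows "emeasure (difference_law M) A = (\<integral>\<^sup>+x. (\<integral>\<^sup>+x'. indicator A (x - x') \<partial>M) \<partial>M)"
proof -
  have "emeasure (difference_law M) A = (\<integral>\<^sup>+z. indicator A z \<partial>difference_law M)"
    by simp
  also have "\<dots> = (\<integral>\<^sup>+z. indicator A (fst z - snd z) \<partial>(M \<Otimes>\<^sub>M M))"
    unfolding difference_law_def by (subst nn_integral_distr) (auto simp: split_beta')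
  also have "\<dots> = (\<integral>\<^sup>+x. (\<integral>\<^sup>+x'. indicator A (x - x') \<partial>M) \<partial>M)"
    using nn_integral_fst[of "\<lambda>z. indicator A (fst z - snd z)" M] by simp
  finally show ?thesis .
qed

lemma distr_PiM_difference:
  fixes I :: "'i set"
  assumes "finite I"
  shows "distr (Pi\<^sub>M I (\<lambda>_. M) \<Otimes>\<^sub>M Pi\<^sub>M I (\<lambda>_. M)) (Pi\<^sub>M I (\<lambda>_. difference_law M))
      (\<lambda>(p, p'). \<lambda>i\<in>I. p i - p' i) = Pi\<^sub>M I (\<lambda>_. difference_law M)"
proof -
  interpret D: prob_space "difference_law M" by (rule prob_space_difference_law)
  interpret PD: product_prob_space "\<lambda>_::'i. difference_law M" ..
  interpret PM: product_prob_space "\<lambda>_::'i. M" ..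
  have sf: "sigma_finite_measure (Pi\<^sub>M I (\<lambda>_. M))"
    by (rule product_sigma_finite.sigma_finite[OF PM.product_sigma_finite_axioms assms])
  note nn_integral_fst = sigma_finite_measure.nn_integral_fst[OF sf]
  let ?P = "Pi\<^sub>M I (\<lambda>_. M)"
  have [measurable]: "(\<lambda>(p, p'). \<lambda>i\<in>I. p i - p' i) \<in> ?P \<Otimes>\<^sub>M ?P \<rightarrow>\<^sub>M Pi\<^sub>M I (\<lambda>_. difference_law M)"
    by measurable
  show ?thesis
  proof (rule PD.PiM_eqI[OF assms])
    fix A assume "\<And>i. i \<in> I \<Longrightarrow> A i \<in> sets (difference_law M)"
    then have A[measurable]: "\<And>i. i \<in> I \<Longrightarrow> A i \<in> sets borel" by simp
    have A': "Pi\<^sub>E I A \<in> sets (Pi\<^sub>M I (\<lambda>_. difference_law M))"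
      using A assms by (intro sets_PiM_I_finite) auto
    have ind: "indicator (Pi\<^sub>E I A) (\<lambda>i\<in>I. p i - p' i) = (\<Prod>i\<in>I. indicator (A i) (p i - p' i) :: ennreal)" for p p'
      using assms by (auto simp: indicator_def PiE_iff)
    have "emeasure (distr (?P \<Otimes>\<^sub>M ?P) (Pi\<^sub>M I (\<lambda>_. difference_law M)) (\<lambda>(p, p'). \<lambda>i\<in>I. p i - p' i)) (Pi\<^sub>E I A)
      = (\<integral>\<^sup>+z. indicator (Pi\<^sub>E I A) z \<partial>distr (?P \<Otimes>\<^sub>M ?P) (Pi\<^sub>M I (\<lambda>_. difference_law M)) (\<lambda>(p, p'). \<lambda>i\<in>I. p i - p' i))"
      using A' by simp
    also have "\<dots> = (\<integral>\<^sup>+z. (\<Prod>i\<in>I. indicator (A i) (fst z i - snd z i)) \<partial>(?P \<Otimes>\<^sub>M ?P))"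
      using A' by (subst nn_integral_distr) (auto simp: split_beta' ind)
    also have "\<dots> = (\<integral>\<^sup>+p. (\<integral>\<^sup>+p'. (\<Prod>i\<in>I. indicator (A i) (p i - p' i)) \<partial>?P) \<partial>?P)"
      using nn_integral_fst[of "\<lambda>z. (\<Prod>i\<in>I. indicator (A i) (fst z i - snd z i))" ?P] by simp
    also have "\<dots> = (\<integral>\<^sup>+p. (\<Prod>i\<in>I. \<integral>\<^sup>+x'. indicator (A i) (p i - x') \<partial>M) \<partial>?P)"
      by (intro nn_integral_cong PM.product_nn_integral_prod[OF assms]) auto
    also have "\<dots> = (\<Prod>i\<in>I. \<integral>\<^sup>+x. \<integral>\<^sup>+x'. indicator (A i) (x - x') \<partial>M \<partial>M)"
      by (rule PM.product_nn_integral_prod[OF assms, of "\<lambda>i x. \<integral>\<^sup>+x'. indicator (A i) (x - x') \<partial>M"]) measurable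
    also have "\<dots> = (\<Prod>i\<in>I. emeasure (difference_law M) (A i))"
      by (intro prod.cong refl emeasure_difference_law[symmetric] A)
    finally show "emeasure (distr (?P \<Otimes>\<^sub>M ?P) (Pi\<^sub>M I (\<lambda>_. difference_law M)) (\<lambda>(p, p'). \<lambda>i\<in>I. p i - p' i)) (Pi\<^sub>E I A)
      = (\<Prod>i\<in>I. emeasure (difference_law M) (A i))" .
  qed simp
qed

end

context real_distribution
begin

text \<open>In \<open>f (p, q) * cnj (f (p', q))\<close> all terms in \<open>q\<close> alone cancel,
  and the terms in \<open>p\<close> or \<open>p'\<close> alone form a unimodular constant. What is
  left is linear in \<open>q\<close>, whose coordinates are independent; the 2 counts the two cross
  blocks, equal by symmetry. That \<beta> and \<gamma> disappear makes the supremum over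
  \<open>a\<close> and \<open>b\<close> harmless.\<close>

lemma quadratic_phase_decoupling:
  fixes \<alpha> :: "'i \<Rightarrow> 'i \<Rightarrow> real" and \<beta> :: "'i \<Rightarrow> real"
  assumes fin: "finite I" and U: "U \<subseteq> I" and sym: "\<And>i j. i \<in> I \<Longrightarrow> j \<in> I \<Longrightarrow> \<alpha> i j = \<alpha> j i"
  shows "(norm (CLINT x|Pi\<^sub>M I (\<lambda>_. M).
            iexp ((\<Sum>i\<in>I. \<Sum>j\<in>I. \<alpha> i j * x i * x j) + (\<Sum>i\<in>I. \<beta> i * x i) + \<gamma>)))\<^sup>2
     \<le> (\<integral>v. (\<Prod>j\<in>I - U. norm (char M (2 * (\<Sum>i\<in>U. v i * \<alpha> i j)))) \<partial>Pi\<^sub>M U (\<lambda>_. difference_law M))"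
proof -
  interpret PM: product_prob_space "\<lambda>_::'i. M" ..
  define V where "V = I - U"
  let ?P = "Pi\<^sub>M U (\<lambda>_. M)" and ?Q = "Pi\<^sub>M V (\<lambda>_. M)"
  have finUV: "finite U" "finite V" and I: "I = U \<union> V" and disj: "U \<inter> V = {}"
    using fin U by (auto simp: V_def intro: finite_subset)
  have P: "prob_space ?P" and Q: "prob_space ?Q" by (auto intro!: prob_space_PiM prob_space_axioms)
  interpret P: prob_space ?P by fact
  interpret Q: prob_space ?Q by fact
  define \<phi> where "\<phi> x = (\<Sum>i\<in>I. \<Sum>j\<in>I. \<alpha> i j * x i * x j) + (\<Sum>i\<in>I. \<beta> i * x i) + \<gamma>" for x :: "'i \<Rightarrow> real"
  have \<phi>m[measurable]: "\<phi> \<in> borel_measurable (Pi\<^sub>M (U \<union> V) (\<lambda>_. M))"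
    unfolding \<phi>_def[abs_def] I by measurable
  have [measurable]: "merge U V \<in> ?P \<Otimes>\<^sub>M ?Q \<rightarrow>\<^sub>M Pi\<^sub>M (U \<union> V) (\<lambda>_. M)" by (rule measurable_merge)
  define f where "f z = iexp (\<phi> (merge U V z))" for z
  have fm: "f \<in> borel_measurable (?P \<Otimes>\<^sub>M ?Q)" unfolding f_def[abs_def] by measurable
  have f1: "norm (f z) \<le> 1" for z by (simp add: f_def)
  have 1: "(CLINT x|Pi\<^sub>M I (\<lambda>_. M). iexp (\<phi> x)) = (\<integral>z. f z \<partial>(?P \<Otimes>\<^sub>M ?Q))"
  proof -
    have "(\<integral>z. f z \<partial>(?P \<Otimes>\<^sub>M ?Q)) = (CLINT x|distr (?P \<Otimes>\<^sub>M ?Q) (Pi\<^sub>M (U \<union> V) (\<lambda>_. M)) (merge U V). iexp (\<phi> x))"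
      unfolding f_def by (subst integral_distr) auto
    then show ?thesis using PM.distr_merge[OF disj finUV] by (simp add: I)
  qed
  define s where "s v j = 2 * (\<Sum>i\<in>U. v i * \<alpha> i j)" for v :: "'i \<Rightarrow> real" and j
  have inner: "norm (\<integral>q. f (p, q) * cnj (f (p', q)) \<partial>?Q) = (\<Prod>j\<in>V. norm (char M (s (\<lambda>i\<in>U. p i - p' i) j)))" for p p'
  proof -
    define C where "C p = (\<Sum>i\<in>U. \<Sum>j\<in>U. \<alpha> i j * p i * p j) + (\<Sum>i\<in>U. \<beta> i * p i)" for p :: "'i \<Rightarrow> real"
    define E where "E q = (\<Sum>i\<in>V. \<Sum>j\<in>V. \<alpha> i j * q i * q j) + (\<Sum>i\<in>V. \<beta> i * q i) + \<gamma>" for q :: "'i \<Rightarrow> real"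
    have \<phi>_merge: "\<phi> (merge U V (p, q)) = C p + E q + (\<Sum>j\<in>V. (2 * (\<Sum>i\<in>U. p i * \<alpha> i j)) * q j)" for p q
    proof -
      let ?m = "merge U V (p, q)"
      have mU: "?m i = p i" if "i \<in> U" for i using that by (simp add: merge_def)
      have mV: "?m i = q i" if "i \<in> V" for i using that disj by (auto simp: merge_def)
      have lin: "(\<Sum>i\<in>I. \<beta> i * ?m i) = (\<Sum>i\<in>U. \<beta> i * p i) + (\<Sum>i\<in>V. \<beta> i * q i)"
        unfolding I by (subst sum.union_disjoint[OF finUV disj]) (simp add: mU mV)
      have "(\<Sum>i\<in>I. \<Sum>j\<in>I. \<alpha> i j * ?m i * ?m j) =
          (\<Sum>i\<in>U. \<Sum>j\<in>U. \<alpha> i j * p i * p j) + (\<Sum>i\<in>U. \<Sum>j\<in>V. \<alpha> i j * p i * q j)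
        + ((\<Sum>i\<in>V. \<Sum>j\<in>U. \<alpha> i j * q i * p j) + (\<Sum>i\<in>V. \<Sum>j\<in>V. \<alpha> i j * q i * q j))"
        unfolding I by (simp add: sum.union_disjoint[OF finUV disj] mU mV sum.distrib)
      moreover have "(\<Sum>i\<in>V. \<Sum>j\<in>U. \<alpha> i j * q i * p j) = (\<Sum>j\<in>V. (\<Sum>i\<in>U. p i * \<alpha> i j) * q j)"
        unfolding sum_distrib_right by (intro sum.cong refl) (simp add: sym I mult_ac)
      moreover have "(\<Sum>i\<in>U. \<Sum>j\<in>V. \<alpha> i j * p i * q j) = (\<Sum>j\<in>V. (\<Sum>i\<in>U. p i * \<alpha> i j) * q j)"
        unfolding sum_distrib_right by (subst sum.swap) (intro sum.cong refl, simp add: mult_ac)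
      moreover have "(\<Sum>j\<in>V. (2 * (\<Sum>i\<in>U. p i * \<alpha> i j)) * q j) = 2 * (\<Sum>j\<in>V. (\<Sum>i\<in>U. p i * \<alpha> i j) * q j)"
        by (simp only: sum_distrib_left[where A = V] mult.assoc)
      ultimately show ?thesis
        unfolding \<phi>_def lin C_def E_def by linarith
    qed
    have "f (p, q) * cnj (f (p', q)) = iexp (C p - C p') * (\<Prod>j\<in>V. iexp (s (\<lambda>i\<in>U. p i - p' i) j * q j))" for q
    proof -
      have "f (p, q) * cnj (f (p', q)) = iexp (\<phi> (merge U V (p, q)) - \<phi> (merge U V (p', q)))"
        by (simp add: f_def exp_cnj exp_add[symmetric] algebra_simps)
      also have "\<phi> (merge U V (p, q)) - \<phi> (merge U V (p', q)) = (C p - C p') + (\<Sum>j\<in>V. s (\<lambda>i\<in>U. p i - p' i) j * q j)"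
        unfolding \<phi>_merge
        by (simp add: s_def left_diff_distrib sum_subtractf right_diff_distrib)
      finally show ?thesis using finUV by (simp add: ring_distribs exp_add exp_sum sum_distrib_left)
    qed
    then have "(\<integral>q. f (p, q) * cnj (f (p', q)) \<partial>?Q) =
        iexp (C p - C p') * (\<integral>q. (\<Prod>j\<in>V. iexp (s (\<lambda>i\<in>U. p i - p' i) j * q j)) \<partial>?Q)"
      by (simp only: integral_mult_right_zero)
    also have "(\<integral>q. (\<Prod>j\<in>V. iexp (s (\<lambda>i\<in>U. p i - p' i) j * q j)) \<partial>?Q) = (\<Prod>j\<in>V. char M (s (\<lambda>i\<in>U. p i - p' i) j))"
      unfolding char_def
      by (rule PM.product_integral_prod[OF finUV(2)]) (auto intro!: integrable_const_bound[where B = 1])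
    finally show ?thesis by (simp add: norm_mult prod_norm)
  qed
  have charm[measurable]: "char M \<in> borel_measurable borel"
    by (intro borel_measurable_continuous_onI) (simp add: continuous_at_imp_continuous_on isCont_char)
  have "(norm (\<integral>z. f z \<partial>(?P \<Otimes>\<^sub>M ?Q)))\<^sup>2 \<le> (\<integral>(p, p'). norm (\<integral>q. f (p, q) * cnj (f (p', q)) \<partial>?Q) \<partial>(?P \<Otimes>\<^sub>M ?P))"
    by (rule norm_integral_pair_power2_le[OF P Q fm f1])
  also have "\<dots> = (\<integral>z. (\<Prod>j\<in>V. norm (char M (s (\<lambda>i\<in>U. fst z i - snd z i) j))) \<partial>(?P \<Otimes>\<^sub>M ?P))"
    by (simp add: inner split_beta')
  also have "\<dots> = (\<integral>v. (\<Prod>j\<in>V. norm (char M (s v j)))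
      \<partial>distr (?P \<Otimes>\<^sub>M ?P) (Pi\<^sub>M U (\<lambda>_. difference_law M)) (\<lambda>(p, p'). \<lambda>i\<in>U. p i - p' i))"
    unfolding s_def by (subst integral_distr) (auto simp: split_beta')
  also have "\<dots> = (\<integral>v. (\<Prod>j\<in>V. norm (char M (s v j))) \<partial>Pi\<^sub>M U (\<lambda>_. difference_law M))"
    by (simp only: distr_PiM_difference[OF finUV(1)])
  finally show ?thesis unfolding 1[unfolded \<phi>_def] s_def V_def .
qed

text \<open>The squared modulus is the characteristic function of x - x', which is real by symmetry.
  Through this identity the anti-concentration hypothesis, a statement about x - x', becomes
  usable.\<close>

lemma norm_char_power2: "(norm (char M s))\<^sup>2 = (\<integral>v. cos (s * v) \<partial>difference_law M)"
proof -
  interpret MM: pair_prob_space M M ..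
  have int: "integrable M (\<lambda>x. iexp (s * x))" "integrable M (\<lambda>x. cnj (iexp (s * x)))"
    by (auto intro!: integrable_const_bound[where B = 1] simp: exp_cnj)
  have "complex_of_real ((norm (char M s))\<^sup>2) = char M s * cnj (char M s)"
    by (rule complex_norm_square)
  also have "\<dots> = (CLINT x|M. (CLINT y|M. iexp (s * x) * cnj (iexp (s * y))))"
    using int by (simp add: char_def integral_cnj)
  also have "\<dots> = (CLINT x|M. (CLINT y|M. iexp (s * (x - y))))"
    by (simp add: exp_cnj exp_add[symmetric] algebra_simps)
  also have "\<dots> = (CLINT z|M \<Otimes>\<^sub>M M. iexp (s * (fst z - snd z)))"
    using MM.integral_fst'[of "\<lambda>z. iexp (s * (fst z - snd z))"]
    by (simp add: MM.P.integrable_const_bound[where B = 1])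
  also have "\<dots> = (CLINT v|difference_law M. iexp (s * v))"
    unfolding difference_law_def by (subst integral_distr) (auto simp: split_beta')
  finally have "(norm (char M s))\<^sup>2 = Re (CLINT v|difference_law M. iexp (s * v))"
    by (metis Re_complex_of_real)
  also have "\<dots> = (\<integral>v. Re (iexp (s * v)) \<partial>difference_law M)"
  proof -
    interpret D: prob_space "difference_law M" by (rule prob_space_difference_law)
    have "integrable (difference_law M) (\<lambda>v. iexp (s * v))"
      by (rule D.integrable_const_bound[where B = 1]) auto
    then show ?thesis by (rule integral_Re[symmetric])
  qed
  finally show ?thesis by (simp add: Re_exp)
qed

end

section \<open>From characteristic functions to the energy of the row forms\<close>

lemma (in prob_space) exp_neg_expectation_le:
  fixes Y :: "'a \<Rightarrow> real"
  assumes [measurable]: "Y \<in> borel_measurable M" and Y: "\<And>x. 0 \<le> Y x" "\<And>x. Y x \<le> B"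
  shows "exp (- expectation Y) \<le> expectation (\<lambda>x. exp (- Y x))"
proof -
  let ?y = "expectation Y"
  have i: "integrable M Y" by (rule integrable_const_bound[where B = B]) (use Y in auto)
  have i2: "integrable M (\<lambda>x. exp (- Y x))" by (rule integrable_const_bound[where B = 1]) (use Y in auto)
  \<comment> \<open>Jensen's inequality, by integrating the tangent line of exp at the mean.\<close>
  have "exp (- ?y) = expectation (\<lambda>x. exp (- ?y) * (1 + (?y - Y x)))"
    using i by (simp add: prob_space)
  also have "\<dots> \<le> expectation (\<lambda>x. exp (- Y x))"
  proof (rule integral_mono[OF _ i2])
    fix x
    have "exp (- ?y) * (1 + (?y - Y x)) \<le> exp (- ?y) * exp (?y - Y x)"
      by (intro mult_left_mono exp_ge_add_one_self) auto
    then show "exp (- ?y) * (1 + (?y - Y x)) \<le> exp (- Y x)" by (simp flip: exp_add)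
  qed (use i in auto)
  finally show ?thesis .
qed

context gaussian_frequency
begin

text \<open>The indicator of the unit ball is at most exp(1/2) times a Gaussian, which is the mean
  over \<open>t\<close> of the oscillating exponentials. The square is moved inside that mean
  because decoupling bounds the squared norm for each \<open>t\<close> separately.\<close>

lemma small_ball_fourier:
  fixes y :: "'b \<Rightarrow> 'a"
  assumes "prob_space N" and [measurable]: "y \<in> borel_measurable N"
  shows "(measure N {x \<in> space N. norm (y x) \<le> 1})\<^sup>2 \<le> exp 1 * (\<integral>t. (norm (CLINT x|N. iexp (y x \<bullet> t)))\<^sup>2 \<partial>\<mu>)"
proof -
  interpret N: prob_space N by fact
  interpret NM: pair_prob_space N \<mu> ..
  define p where "p = measure N {x \<in> space N. norm (y x) \<le> 1}"
  define F where "F t = norm (CLINT x|N. iexp (y x \<bullet> t))" for t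
  have Fm[measurable]: "F \<in> borel_measurable borel"
  proof -
    have "F \<in> borel_measurable \<mu>" unfolding F_def[abs_def] by measurable
    then show ?thesis by simp
  qed
  have F1: "\<bar>F t\<bar> \<le> 1" for t
  proof -
    have "F t \<le> (\<integral>x. norm (iexp (y x \<bullet> t)) \<partial>N)" unfolding F_def by (rule integral_norm_bound)
    also have "\<dots> = 1" by (simp add: N.prob_space)
    finally show ?thesis by (simp add: F_def)
  qed
  have int: "integrable N (\<lambda>x. exp (1/2) * exp (- (norm (y x))\<^sup>2 / 2))"
    by (rule N.integrable_const_bound[where B = "exp (1/2)"]) auto
  have "p = (\<integral>x. indicator {x \<in> space N. norm (y x) \<le> 1} x \<partial>N)"
    unfolding p_def by simp
  also have "\<dots> \<le> (\<integral>x. exp (1/2) * exp (- (norm (y x))\<^sup>2 / 2) \<partial>N)"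
  proof (rule integral_mono[OF _ int])
    fix x assume "x \<in> space N"
    show "indicator {x \<in> space N. norm (y x) \<le> 1} x \<le> exp (1/2) * exp (- (norm (y x))\<^sup>2 / 2)"
    proof (cases "norm (y x) \<le> 1")
      case True
      then have "(norm (y x))\<^sup>2 \<le> 1" by (simp add: power_le_one)
      then have "exp 0 \<le> exp (1/2 + - (norm (y x))\<^sup>2 / 2)" by (subst exp_le_cancel_iff) simp
      then have "1 \<le> exp (1/2) * exp (- (norm (y x))\<^sup>2 / 2)" unfolding exp_add by simp
      then show ?thesis by (simp add: indicator_def)
    qed simp
  qed (auto intro!: N.integrable_const_bound[where B = 1])
  also have "\<dots> = exp (1/2) * (\<integral>x. exp (- (norm (y x))\<^sup>2 / 2) \<partial>N)" by simp
  also have "(\<integral>x. exp (- (norm (y x))\<^sup>2 / 2) \<partial>N) \<le> (\<integral>t. F t \<partial>\<mu>)"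
  proof -
    have pint: "integrable (N \<Otimes>\<^sub>M \<mu>) (\<lambda>z. iexp (y (fst z) \<bullet> snd z))"
      by (rule NM.P.integrable_const_bound[where B = 1]) auto
    have "complex_of_real (\<integral>x. exp (- (norm (y x))\<^sup>2 / 2) \<partial>N) = (CLINT x|N. (CLINT t|\<mu>. iexp (y x \<bullet> t)))"
      unfolding integral_iexp by (rule integral_complex_of_real[symmetric])
    also have "\<dots> = (CLINT t|\<mu>. (CLINT x|N. iexp (y x \<bullet> t)))"
      using NM.Fubini_integral[of "\<lambda>x t. iexp (y x \<bullet> t)"] pint by (simp add: split_beta')
    finally have "norm (complex_of_real (\<integral>x. exp (- (norm (y x))\<^sup>2 / 2) \<partial>N)) \<le> (\<integral>t. F t \<partial>\<mu>)"
      unfolding F_def by (simp only: integral_norm_bound)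
    then show ?thesis by simp
  qed
  finally have "p \<le> exp (1/2) * (\<integral>t. F t \<partial>\<mu>)" by simp
  then have "p\<^sup>2 \<le> (exp (1/2) * (\<integral>t. F t \<partial>\<mu>))\<^sup>2"
    by (rule power_mono) (simp add: p_def)
  also have "\<dots> = exp 1 * (\<integral>t. F t \<partial>\<mu>)\<^sup>2"
    by (simp add: power_mult_distrib exp_double[symmetric])
  also have "\<dots> \<le> exp 1 * (\<integral>t. (F t)\<^sup>2 \<partial>\<mu>)"
    by (intro mult_left_mono power2_expectation_le[OF _ F1]) auto
  finally show ?thesis unfolding p_def F_def .
qed

text \<open>With \<nu> the difference law conditioned on the band, the squared modulus is at most
  exp(-c3 times the \<nu>-mean of 1 - cos), and its root leaves c3/2. Jensen takes the mean over
  \<open>w\<close> out of the exponential of the whole sum, so that one common \<open>w\<close>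
  scales all \<open>b j\<close> and each \<open>w\<close> of the band can be treated alone.\<close>

lemma integral_prod_char_le:
  fixes b :: "nat \<Rightarrow> 'a"
  assumes "real_distribution \<xi>" and fin: "finite V" and c3: "0 < c3"
    and band: "c3 \<le> measure (difference_law \<xi>) {w. c1 \<le> \<bar>w\<bar> \<and> \<bar>w\<bar> \<le> c2}"
    and bound: "\<And>w. c1 \<le> \<bar>w\<bar> \<Longrightarrow> \<bar>w\<bar> \<le> c2 \<Longrightarrow> (\<integral>t. exp (- (c3/2) * energy (\<lambda>j. w *\<^sub>R b j) V t) \<partial>\<mu>) \<le> r"
  shows "(\<integral>t. (\<Prod>j\<in>V. norm (char \<xi> (b j \<bullet> t))) \<partial>\<mu>) \<le> r"
proof -
  interpret X: real_distribution \<xi> by fact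
  interpret D: prob_space "difference_law \<xi>" by (rule X.prob_space_difference_law)
  let ?D = "difference_law \<xi>"
  define S where "S = {w::real. c1 \<le> \<bar>w\<bar> \<and> \<bar>w\<bar> \<le> c2}"
  have Sm[measurable]: "S \<in> sets borel"
  proof -
    have "closed S" unfolding S_def by (intro closed_Collect_conj closed_Collect_le continuous_intros)
    then show ?thesis by (rule borel_closed)
  qed
  define p where "p = measure ?D S"
  have p: "0 < p" "c3 \<le> p" using band c3 by (auto simp: p_def S_def)
  define \<nu> where "\<nu> = density ?D (\<lambda>w. ennreal (indicator S w / p))"
  have \<nu>sets[measurable_cong]: "sets \<nu> = sets borel" by (simp add: \<nu>_def)
  have int\<nu>: "integral\<^sup>L \<nu> g = (\<integral>w. indicator S w / p * g w \<partial>?D)" if "g \<in> borel_measurable borel" for g :: "real \<Rightarrow> real"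
    unfolding \<nu>_def using p(1) that by (subst integral_density) auto
  have "emeasure \<nu> (space \<nu>) = 1"
  proof -
    have "emeasure \<nu> (space \<nu>) = (\<integral>\<^sup>+w. ennreal (indicator S w / p) \<partial>?D)"
      unfolding \<nu>_def by (simp add: emeasure_density)
    also have "\<dots> = ennreal (\<integral>w. indicator S w / p \<partial>?D)"
      using p(1) by (intro nn_integral_eq_integral) (auto intro!: D.integrable_const_bound[where B = "1/p"] simp: indicator_def)
    also have "(\<integral>w. indicator S w / p \<partial>?D) = 1" using p(1) by (simp add: p_def)
    finally show ?thesis by simp
  qed
  then interpret \<nu>: prob_space \<nu> by (rule prob_spaceI)
  interpret TN: pair_prob_space \<mu> \<nu> ..
  have char_le: "norm (char \<xi> s) \<le> exp (- (c3/2) * (\<integral>w. 1 - cos (s * w) \<partial>\<nu>))" for s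
  proof -
    have i1: "integrable ?D (\<lambda>w. cos (s * w))" by (rule D.integrable_const_bound[where B = 1]) auto
    have i2: "integrable ?D (\<lambda>w. indicator S w * (1 - cos (s * w)))"
    proof (rule D.integrable_const_bound[where B = 2])
      show "AE w in ?D. norm (indicator S w * (1 - cos (s * w))) \<le> 2"
      proof (rule AE_I2)
        fix w show "norm (indicator S w * (1 - cos (s * w))) \<le> 2"
          using cos_ge_minus_one[of "s * w"] by (auto simp: indicator_def simp del: cos_ge_minus_one)
      qed
    qed measurable
    have nn: "0 \<le> (\<integral>w. 1 - cos (s * w) \<partial>\<nu>)" by (rule Bochner_Integration.integral_nonneg) simp
    have "c3 * (\<integral>w. 1 - cos (s * w) \<partial>\<nu>) \<le> p * (\<integral>w. 1 - cos (s * w) \<partial>\<nu>)"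
      by (rule mult_right_mono[OF p(2) nn])
    also have "\<dots> = (\<integral>w. indicator S w * (1 - cos (s * w)) \<partial>?D)"
    proof -
      have "(\<integral>w. 1 - cos (s * w) \<partial>\<nu>) = (\<integral>w. indicator S w * (1 - cos (s * w)) / p \<partial>?D)"
        by (subst int\<nu>) auto
      then show ?thesis using p(1) by simp
    qed
    also have "\<dots> \<le> (\<integral>w. 1 - cos (s * w) \<partial>?D)"
      by (rule integral_mono) (use i1 i2 in \<open>auto simp: indicator_def\<close>)
    also have "\<dots> = 1 - (norm (char \<xi> s))\<^sup>2"
      using i1 D.prob_space by (simp add: X.norm_char_power2)
    finally have "(norm (char \<xi> s))\<^sup>2 \<le> 1 + - (c3 * (\<integral>w. 1 - cos (s * w) \<partial>\<nu>))" by simp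
    also have "\<dots> \<le> exp (- (c3 * (\<integral>w. 1 - cos (s * w) \<partial>\<nu>)))" by (rule exp_ge_add_one_self)
    also have "\<dots> = (exp (- (c3/2) * (\<integral>w. 1 - cos (s * w) \<partial>\<nu>)))\<^sup>2"
      by (simp flip: exp_double)
    finally show ?thesis by (rule power2_le_imp_le) simp
  qed
  have e_eq: "energy (\<lambda>j. w *\<^sub>R b j) V t = (\<Sum>j\<in>V. 1 - cos ((b j \<bullet> t) * w))" for w t
    by (simp add: energy_def mult.commute)
  have [measurable]: "(\<lambda>z. energy (\<lambda>j. snd z *\<^sub>R b j) V (fst z)) \<in> borel_measurable (\<mu> \<Otimes>\<^sub>M \<nu>)"
    unfolding e_eq by measurable
  have [measurable]: "(\<lambda>w. energy (\<lambda>j. w *\<^sub>R b j) V t) \<in> borel_measurable borel" for t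
    unfolding e_eq by measurable
  have e_le: "energy (\<lambda>j. w *\<^sub>R b j) V t \<le> 2 * real (card V)" for w t
  proof -
    have "1 - cos ((w *\<^sub>R b j) \<bullet> t) \<le> 2" for j using cos_ge_minus_one[of "(w *\<^sub>R b j) \<bullet> t"] by linarith
    then have "energy (\<lambda>j. w *\<^sub>R b j) V t \<le> (\<Sum>j\<in>V. 2)" unfolding energy_def by (intro sum_mono)
    then show ?thesis by simp
  qed
  have pt: "(\<Prod>j\<in>V. norm (char \<xi> (b j \<bullet> t))) \<le> (\<integral>w. exp (- (c3/2 * energy (\<lambda>j. w *\<^sub>R b j) V t)) \<partial>\<nu>)" for t
  proof -
    have i: "integrable \<nu> (\<lambda>w. 1 - cos ((b j \<bullet> t) * w))" for j
      by (rule Bochner_Integration.integrable_diff) (auto intro!: \<nu>.integrable_const_bound[where B = 1])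
    have "(\<Prod>j\<in>V. norm (char \<xi> (b j \<bullet> t))) \<le> (\<Prod>j\<in>V. exp (- (c3/2) * (\<integral>w. 1 - cos ((b j \<bullet> t) * w) \<partial>\<nu>)))"
      by (intro prod_mono conjI char_le) auto
    also have "\<dots> = exp (- (\<integral>w. c3/2 * energy (\<lambda>j. w *\<^sub>R b j) V t \<partial>\<nu>))"
      unfolding e_eq using i fin by (simp add: exp_sum[symmetric] sum_negf sum_distrib_left del: Bochner_Integration.integral_diff)
    also have "\<dots> \<le> (\<integral>w. exp (- (c3/2 * energy (\<lambda>j. w *\<^sub>R b j) V t)) \<partial>\<nu>)"
    proof (rule \<nu>.exp_neg_expectation_le)
      show "c3/2 * energy (\<lambda>j. w *\<^sub>R b j) V t \<le> c3/2 * (2 * real (card V))" for w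
        using e_le c3 by (intro mult_left_mono) auto
      show "0 \<le> c3/2 * energy (\<lambda>j. w *\<^sub>R b j) V t" for w using energy_nonneg c3 by simp
    qed measurable
    finally show ?thesis .
  qed
  have exp1: "norm (exp (- (c3/2 * energy b' V t))) \<le> 1" for b' t
    using c3 energy_nonneg[of b' V t] by simp
  have ipair: "integrable (\<mu> \<Otimes>\<^sub>M \<nu>) (\<lambda>z. exp (- (c3/2 * energy (\<lambda>j. snd z *\<^sub>R b j) V (fst z))))"
    by (rule TN.P.integrable_const_bound[where B = 1]) (use exp1 in auto)
  have charm[measurable]: "char \<xi> \<in> borel_measurable borel"
    by (intro borel_measurable_continuous_onI) (simp add: continuous_at_imp_continuous_on X.isCont_char)
  have "(\<integral>t. (\<Prod>j\<in>V. norm (char \<xi> (b j \<bullet> t))) \<partial>\<mu>) \<le> (\<integral>t. (\<integral>w. exp (- (c3/2 * energy (\<lambda>j. w *\<^sub>R b j) V t)) \<partial>\<nu>) \<partial>\<mu>)"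
  proof (rule integral_mono[OF _ _ pt])
    show "integrable \<mu> (\<lambda>t. \<Prod>j\<in>V. norm (char \<xi> (b j \<bullet> t)))"
      by (rule integrable_bounded[where c = 1])
        (auto simp: abs_prod intro!: prod_le_1 X.cmod_char_le_1)
    show "integrable \<mu> (\<lambda>t. \<integral>w. exp (- (c3/2 * energy (\<lambda>j. w *\<^sub>R b j) V t)) \<partial>\<nu>)"
      using TN.integrable_fst'[OF ipair] by simp
  qed
  also have "\<dots> = (\<integral>w. (\<integral>t. exp (- (c3/2 * energy (\<lambda>j. w *\<^sub>R b j) V t)) \<partial>\<mu>) \<partial>\<nu>)"
    using TN.Fubini_integral[of "\<lambda>t w. exp (- (c3/2 * energy (\<lambda>j. w *\<^sub>R b j) V t))"] ipair
    by (simp add: split_beta')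
  also have "\<dots> \<le> (\<integral>w. r \<partial>\<nu>)"
  proof (rule integral_mono_AE)
    show "integrable \<nu> (\<lambda>w. \<integral>t. exp (- (c3/2 * energy (\<lambda>j. w *\<^sub>R b j) V t)) \<partial>\<mu>)"
      using TN.integrable_snd[of "\<lambda>t w. exp (- (c3/2 * energy (\<lambda>j. w *\<^sub>R b j) V t))"] ipair by (simp add: split_beta')
    have "AE w in \<nu>. w \<in> S" unfolding \<nu>_def by (subst AE_density) (auto simp: indicator_def)
    then show "AE w in \<nu>. (\<integral>t. exp (- (c3/2 * energy (\<lambda>j. w *\<^sub>R b j) V t)) \<partial>\<mu>) \<le> r"
      by (rule AE_mp) (use bound in \<open>auto simp: S_def\<close>)
  qed simp
  also have "\<dots> = r" by (simp add: \<nu>.prob_space)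
  finally show ?thesis .
qed

end

section \<open>Row forms, scaling and masking\<close>

lemma near_span_mono:
  assumes "M \<le> M'" "r \<le> r'"
  shows "near_span b W K M r \<subseteq> near_span b W K M' r'"
  using assms unfolding near_span_def by (blast intro: order_trans)

lemma near_span_scaleR:
  assumes "s \<noteq> 0" "s *\<^sub>R x \<in> near_span (\<lambda>i. s *\<^sub>R b i) W K M r"
  shows "x \<in> near_span b W K M (r / \<bar>s\<bar>)"
proof -
  from assms(2) obtain \<kappa> :: "nat \<Rightarrow> int" where k: "\<forall>l\<in>W. \<bar>real_of_int (\<kappa> l)\<bar> \<le> M"
    "norm (real K *\<^sub>R s *\<^sub>R x - (\<Sum>l\<in>W. real_of_int (\<kappa> l) *\<^sub>R s *\<^sub>R b l)) \<le> r"
    unfolding near_span_def by blast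
  have "real K *\<^sub>R s *\<^sub>R x - (\<Sum>l\<in>W. real_of_int (\<kappa> l) *\<^sub>R s *\<^sub>R b l)
      = s *\<^sub>R (real K *\<^sub>R x - (\<Sum>l\<in>W. real_of_int (\<kappa> l) *\<^sub>R b l))"
    by (simp add: scaleR_diff_right scaleR_sum_right mult.commute)
  with k(2) have "\<bar>s\<bar> * norm (real K *\<^sub>R x - (\<Sum>l\<in>W. real_of_int (\<kappa> l) *\<^sub>R b l)) \<le> r" by simp
  then have "norm (real K *\<^sub>R x - (\<Sum>l\<in>W. real_of_int (\<kappa> l) *\<^sub>R b l)) \<le> r / \<bar>s\<bar>"
    using assms(1) by (simp add: pos_le_divide_eq mult.commute)
  with k(1) show ?thesis unfolding near_span_def by blast
qed

definition row_form :: "nat \<Rightarrow> (nat \<Rightarrow> nat \<Rightarrow> 'a::real_vector) \<Rightarrow> (nat \<Rightarrow> real) \<Rightarrow> nat \<Rightarrow> 'a" where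
  "row_form n A z i = (\<Sum>j=1..n. z j *\<^sub>R A i j)"

text \<open>Restricted to \<open>{1..n}\<close> so that the vector is extensional, hence a point of
  the product space in which its law will be computed.\<close>

definition masked :: "nat \<Rightarrow> nat set \<Rightarrow> (nat \<Rightarrow> real) \<Rightarrow> nat \<Rightarrow> real" where
  "masked n U v = (\<lambda>j\<in>{1..n}. if j \<in> U then v j else 0)"

lemma row_form_masked:
  assumes "U \<subseteq> {1..n}"
  shows "row_form n A (masked n U v) i = (\<Sum>j\<in>U. v j *\<^sub>R A i j)"
proof -
  have "row_form n A (masked n U v) i = (\<Sum>j=1..n. if j \<in> U then v j *\<^sub>R A i j else 0)"
    unfolding row_form_def masked_def by (intro sum.cong) auto
  also have "\<dots> = (\<Sum>j\<in>{1..n} \<inter> U. v j *\<^sub>R A i j)" by (simp add: sum.If_cases Int_def)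
  also have "{1..n} \<inter> U = U" using assms by blast
  finally show ?thesis .
qed

context gaussian_frequency
begin

text \<open>The decoupled integral is at most \<open>r\<close> off \<open>Ev\<close> and at most 1
  on it. Read backwards: a small ball probability that is large compared with \<open>r\<close> makes
  \<open>Ev\<close> likely.\<close>

lemma quadratic_small_ball_power2_le:
  fixes A :: "nat \<Rightarrow> nat \<Rightarrow> 'a" and b :: "nat \<Rightarrow> 'a"
  assumes xi: "real_distribution \<xi>" and U: "U \<subseteq> {1..n}" and beta: "0 < \<beta>"
    and sym: "\<And>i j. i \<in> {1..n} \<Longrightarrow> j \<in> {1..n} \<Longrightarrow> A i j = A j i"
    and Ev: "Ev \<in> sets (Pi\<^sub>M {1..n} (\<lambda>_. difference_law \<xi>))"
    and small: "\<And>v. v \<in> space (Pi\<^sub>M {1..n} (\<lambda>_. difference_law \<xi>)) \<Longrightarrow> v \<notin> Ev \<Longrightarrow>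
      (\<integral>t. (\<Prod>j\<in>{1..n} - U. norm (char \<xi> (((2 / \<beta>) *\<^sub>R row_form n A (masked n U v) j) \<bullet> t))) \<partial>\<mu>) \<le> r"
    and r: "0 \<le> r"
  shows "(measure (iid n \<xi>) {x \<in> space (iid n \<xi>).
      (\<Sum>i=1..n. \<Sum>j=1..n. (x i * x j) *\<^sub>R A i j) + (\<Sum>i=1..n. x i *\<^sub>R b i) \<in> cball a \<beta>})\<^sup>2
    \<le> exp 1 * (r + measure (Pi\<^sub>M {1..n} (\<lambda>_. difference_law \<xi>)) Ev)"
proof -
  interpret X: real_distribution \<xi> by fact
  let ?I = "{1..n}"
  let ?D = "Pi\<^sub>M ?I (\<lambda>_. difference_law \<xi>)"
  interpret D1: prob_space "difference_law \<xi>" by (rule X.prob_space_difference_law)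
  interpret PD: product_prob_space "\<lambda>_::nat. difference_law \<xi>" ..
  interpret D: prob_space ?D by (rule prob_space_PiM) (rule D1.prob_space_axioms)
  interpret MD: pair_prob_space \<mu> ?D ..
  have N: "prob_space (iid n \<xi>)" unfolding iid_def by (rule prob_space_PiM) (rule X.prob_space_axioms)
  define y where "y x = (1/\<beta>) *\<^sub>R ((\<Sum>i=1..n. \<Sum>j=1..n. (x i * x j) *\<^sub>R A i j) + (\<Sum>i=1..n. x i *\<^sub>R b i) - a)" for x
  have ym[measurable]: "y \<in> borel_measurable (iid n \<xi>)" unfolding y_def[abs_def] iid_def by measurable
  have ball: "(q \<in> cball a \<beta>) = (norm ((1/\<beta>) *\<^sub>R (q - a)) \<le> 1)" for q
  proof -
    have "norm ((1/\<beta>) *\<^sub>R (q - a)) = norm (q - a) / \<beta>" using beta by (simp only: norm_scaleR) simp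
    then show ?thesis using beta by (simp add: dist_norm norm_minus_commute)
  qed
  let ?p = "measure (iid n \<xi>) {x \<in> space (iid n \<xi>).
      (\<Sum>i=1..n. \<Sum>j=1..n. (x i * x j) *\<^sub>R A i j) + (\<Sum>i=1..n. x i *\<^sub>R b i) \<in> cball a \<beta>}"
  have p: "?p = measure (iid n \<xi>) {x \<in> space (iid n \<xi>). norm (y x) \<le> 1}"
    unfolding ball y_def ..
  define H where "H t v = (\<Prod>j\<in>?I - U. norm (char \<xi> (((2 / \<beta>) *\<^sub>R row_form n A (masked n U v) j) \<bullet> t)))" for t v
  have charm[measurable]: "char \<xi> \<in> borel_measurable borel"
    by (intro borel_measurable_continuous_onI) (simp add: continuous_at_imp_continuous_on X.isCont_char)
  have H01: "0 \<le> H t v" "H t v \<le> 1" for t v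
    unfolding H_def by (auto intro!: prod_nonneg prod_le_1 X.cmod_char_le_1)
  have Hm: "(\<lambda>z. H (fst z) (snd z)) \<in> borel_measurable (\<mu> \<Otimes>\<^sub>M ?D)"
  proof -
    have [measurable]: "(\<lambda>z. snd z i) \<in> borel_measurable (\<mu> \<Otimes>\<^sub>M ?D)" if "i \<in> U" for i
    proof -
      have "i \<in> ?I" using that U by auto
      then have "(\<lambda>v. v i) \<in> ?D \<rightarrow>\<^sub>M difference_law \<xi>" by (rule measurable_component_singleton)
      then have "(\<lambda>v. v i) \<in> borel_measurable ?D"
        unfolding measurable_cong_sets[OF refl X.sets_difference_law] .
      then show ?thesis by (rule measurable_compose[OF measurable_snd])
    qed
    show ?thesis unfolding H_def row_form_masked[OF U] by measurable
  qed
  have phase: "(norm (CLINT x|iid n \<xi>. iexp (y x \<bullet> t)))\<^sup>2 \<le> (\<integral>v. H t v \<partial>?D)" for t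
  proof -
    define \<alpha> where "\<alpha> i j = (A i j \<bullet> t) / \<beta>" for i j
    have eq: "(CLINT x|iid n \<xi>. iexp (y x \<bullet> t)) = (CLINT x|Pi\<^sub>M ?I (\<lambda>_. \<xi>).
        iexp ((\<Sum>i\<in>?I. \<Sum>j\<in>?I. \<alpha> i j * x i * x j) + (\<Sum>i\<in>?I. (b i \<bullet> t / \<beta>) * x i) + (- (a \<bullet> t) / \<beta>)))"
    proof -
      have "y x \<bullet> t = (\<Sum>i\<in>?I. \<Sum>j\<in>?I. \<alpha> i j * x i * x j) + (\<Sum>i\<in>?I. (b i \<bullet> t / \<beta>) * x i) + (- (a \<bullet> t) / \<beta>)" for x
        unfolding y_def \<alpha>_def
        by (simp add: inner_add_left inner_diff_left inner_sum_left sum_divide_distrib add_divide_distrib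
            diff_divide_distrib mult_ac)
      then show ?thesis unfolding iid_def by simp
    qed
    have "(norm (CLINT x|iid n \<xi>. iexp (y x \<bullet> t)))\<^sup>2 \<le>
       (\<integral>v. (\<Prod>j\<in>?I - U. norm (char \<xi> (2 * (\<Sum>i\<in>U. v i * \<alpha> i j)))) \<partial>Pi\<^sub>M U (\<lambda>_. difference_law \<xi>))"
      unfolding eq by (rule X.quadratic_phase_decoupling) (use U sym in \<open>auto simp: \<alpha>_def\<close>)
    \<comment> \<open>From the coordinates in \<open>U\<close> to all coordinates: the sample space
      no longer depends on \<open>U\<close>, which can then be randomized.\<close>
    also have "\<dots> = (\<integral>v. (\<Prod>j\<in>?I - U. norm (char \<xi> (2 * (\<Sum>i\<in>U. v i * \<alpha> i j))))
        \<partial>distr ?D (Pi\<^sub>M U (\<lambda>_. difference_law \<xi>)) (\<lambda>v. restrict v U))"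
      using PD.distr_restrict[OF U] by simp
    also have "\<dots> = (\<integral>v. (\<Prod>j\<in>?I - U. norm (char \<xi> (2 * (\<Sum>i\<in>U. restrict v U i * \<alpha> i j)))) \<partial>?D)"
      by (rule integral_distr[OF measurable_restrict_subset[OF U]]) measurable
    also have "\<dots> = (\<integral>v. H t v \<partial>?D)"
    proof (rule Bochner_Integration.integral_cong[OF refl])
      fix v
      show "(\<Prod>j\<in>?I - U. norm (char \<xi> (2 * (\<Sum>i\<in>U. restrict v U i * \<alpha> i j)))) = H t v"
        unfolding H_def row_form_masked[OF U]
      proof (intro prod.cong refl arg_cong[where f = norm] arg_cong[where f = "char \<xi>"])
        fix j assume j: "j \<in> ?I - U"
        have "(\<Sum>i\<in>U. restrict v U i * \<alpha> i j) = (\<Sum>i\<in>U. v i * (A j i \<bullet> t) / \<beta>)"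
          using j U by (intro sum.cong refl) (auto simp: \<alpha>_def sym[of _ j])
        then show "2 * (\<Sum>i\<in>U. restrict v U i * \<alpha> i j) = ((2 / \<beta>) *\<^sub>R (\<Sum>i\<in>U. v i *\<^sub>R A j i)) \<bullet> t"
          by (simp add: inner_sum_left sum_divide_distrib[symmetric])
      qed
    qed
    finally show ?thesis .
  qed
  have ipair: "integrable (\<mu> \<Otimes>\<^sub>M ?D) (\<lambda>z. H (fst z) (snd z))"
    by (rule MD.P.integrable_const_bound[where B = 1]) (use H01 Hm in auto)
  have iE: "integrable ?D (indicator Ev :: _ \<Rightarrow> real)"
    by (rule D.integrable_const_bound[where B = 1, OF AE_I2 borel_measurable_indicator[OF Ev]])
      (simp add: indicator_def)
  note ir = D.integrable_const[of r]
  have "(\<integral>t. (norm (CLINT x|iid n \<xi>. iexp (y x \<bullet> t)))\<^sup>2 \<partial>\<mu>) \<le> (\<integral>t. (\<integral>v. H t v \<partial>?D) \<partial>\<mu>)"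
  proof (rule integral_mono_AE')
    show "integrable \<mu> (\<lambda>t. \<integral>v. H t v \<partial>?D)" using MD.integrable_fst'[OF ipair] by simp
    show "AE t in \<mu>. 0 \<le> (\<integral>v. H t v \<partial>?D)"
      by (intro AE_I2 Bochner_Integration.integral_nonneg H01)
  qed (use phase in auto)
  also have "\<dots> = (\<integral>v. (\<integral>t. H t v \<partial>\<mu>) \<partial>?D)"
    using MD.Fubini_integral[of H] ipair by (simp add: split_beta')
  also have "\<dots> \<le> (\<integral>v. r + indicator Ev v \<partial>?D)"
  proof (rule integral_mono)
    show "integrable ?D (\<lambda>v. \<integral>t. H t v \<partial>\<mu>)"
      using MD.integrable_snd[of H] ipair by (simp add: split_beta')
    show "integrable ?D (\<lambda>v. r + indicator Ev v)"
      by (rule Bochner_Integration.integrable_add[OF ir iE])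
    fix v assume v: "v \<in> space ?D"
    show "(\<integral>t. H t v \<partial>\<mu>) \<le> r + indicator Ev v"
    proof (cases "v \<in> Ev")
      case True
      have "(\<integral>t. H t v \<partial>\<mu>) \<le> (\<integral>t. 1 \<partial>\<mu>)"
        by (rule integral_mono_AE') (use H01 in auto)
      then show ?thesis using True r by (simp add: prob_space)
    qed (use small[OF v] in \<open>simp add: H_def\<close>)
  qed
  also have "\<dots> = r + measure ?D Ev"
    unfolding Bochner_Integration.integral_add[OF ir iE] integral_indicator lebesgue_integral_const
      D.prob_space using sets.Int_space_eq2[OF Ev] by simp
  finally have "(\<integral>t. (norm (CLINT x|iid n \<xi>. iexp (y x \<bullet> t)))\<^sup>2 \<partial>\<mu>) \<le> r + measure ?D Ev" .
  then have "exp 1 * (\<integral>t. (norm (CLINT x|iid n \<xi>. iexp (y x \<bullet> t)))\<^sup>2 \<partial>\<mu>) \<le> exp 1 * (r + measure ?D Ev)"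
    by (rule mult_left_mono) simp
  then show ?thesis unfolding p by (rule order_trans[OF small_ball_fourier[OF N ym]])
qed

end

section \<open>Structure events and their measurability\<close>

lemma near_span_iff_bounded_coefficients:
  "x \<in> near_span b W K M r \<longleftrightarrow> (\<exists>\<kappa>\<in>Pi\<^sub>E W (\<lambda>_. {l::int. \<bar>real_of_int l\<bar> \<le> M}).
     norm (real K *\<^sub>R x - (\<Sum>l\<in>W. real_of_int (\<kappa> l) *\<^sub>R b l)) \<le> r)" (is "_ = ?R")
proof
  assume "x \<in> near_span b W K M r"
  then obtain \<kappa> :: "nat \<Rightarrow> int" where k: "\<forall>l\<in>W. \<bar>real_of_int (\<kappa> l)\<bar> \<le> M"
    "norm (real K *\<^sub>R x - (\<Sum>l\<in>W. real_of_int (\<kappa> l) *\<^sub>R b l)) \<le> r" unfolding near_span_def by blast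
  have "(\<Sum>l\<in>W. real_of_int (restrict \<kappa> W l) *\<^sub>R b l) = (\<Sum>l\<in>W. real_of_int (\<kappa> l) *\<^sub>R b l)"
    by (rule sum.cong) auto
  with k show ?R by (intro bexI[of _ "restrict \<kappa> W"]) auto
qed (auto simp: near_span_def)

lemma finite_bounded_int: "finite {l::int. \<bar>real_of_int l\<bar> \<le> M}"
proof (rule finite_subset)
  show "{l::int. \<bar>real_of_int l\<bar> \<le> M} \<subseteq> {- \<lceil>M\<rceil>..\<lceil>M\<rceil>}"
    by (auto simp: abs_le_iff) linarith+
qed simp

lemma pred_near_span [measurable (raw)]:
  fixes f :: "'b \<Rightarrow> nat \<Rightarrow> 'a::euclidean_space"
  assumes "finite W" "\<And>i. (\<lambda>\<omega>. f \<omega> i) \<in> borel_measurable N"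
  shows "Measurable.pred N (\<lambda>\<omega>. f \<omega> i \<in> near_span (f \<omega>) W K M r)"
proof -
  note assms(2)[measurable]
  have "finite (Pi\<^sub>E W (\<lambda>_. {l::int. \<bar>real_of_int l\<bar> \<le> M}))"
    using assms(1) finite_bounded_int by (intro finite_PiE) auto
  then show ?thesis unfolding near_span_iff_bounded_coefficients by measurable
qed

lemma pred_card_le:
  assumes "finite I" and [measurable]: "\<And>i. i \<in> I \<Longrightarrow> Measurable.pred N (P i)"
  shows "Measurable.pred N (\<lambda>\<omega>. card {i \<in> I. P i \<omega>} \<le> m)"
proof -
  have "real (card {i \<in> I. P i \<omega>}) = (\<Sum>i\<in>I. if P i \<omega> then 1 else 0)" for \<omega>
    using assms(1) by (simp add: sum.If_cases Int_def)
  then have "(\<lambda>\<omega>. card {i \<in> I. P i \<omega>} \<le> m) = (\<lambda>\<omega>. (\<Sum>i\<in>I. if P i \<omega> then 1 else 0) \<le> real m)"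
    by (metis of_nat_le_iff)
  then show ?thesis by simp
qed

text \<open>The pair \<theta> packs the multiplier (first component) and the generator set (second
  component), so that both can be chosen at once.\<close>

definition structured :: "nat \<Rightarrow> (nat \<Rightarrow> nat \<Rightarrow> 'a::euclidean_space) \<Rightarrow> real \<Rightarrow> real \<Rightarrow> nat \<times> nat set \<Rightarrow> nat \<Rightarrow> (nat \<Rightarrow> real) \<Rightarrow> bool" where
  "structured n A M r \<theta> i z \<longleftrightarrow> row_form n A z i \<in> near_span (row_form n A z) (snd \<theta>) (fst \<theta>) M r"

text \<open>Rows with index in \<open>U\<close> are not counted, because the decoupled integral
  involves only the rows outside \<open>U\<close>.\<close>

definition exceptional_le ::
    "nat \<Rightarrow> (nat \<Rightarrow> nat \<Rightarrow> 'a::euclidean_space) \<Rightarrow> real \<Rightarrow> real \<Rightarrow> nat \<Rightarrow> nat \<times> nat set \<Rightarrow> nat set \<Rightarrow> (nat \<Rightarrow> real) \<Rightarrow> bool" where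
  "exceptional_le n A M r m \<theta> U v \<longleftrightarrow> card {i \<in> {1..n}. i \<notin> U \<and> \<not> structured n A M r \<theta> i (masked n U v)} \<le> m"

text \<open>Covers everything the linear theorem can return at energy at most \<open>a\<close>. It
  depends neither on \<open>z\<close> nor on \<open>U\<close> and will have polynomial size, as
  needed for a pigeonhole argument.\<close>

definition candidates :: "nat \<Rightarrow> nat \<Rightarrow> nat \<Rightarrow> (nat \<times> nat set) set" where
  "candidates n a J = {1..8 ^ a} \<times> {W. W \<subseteq> {1..n} \<and> J * card W \<le> a}"

lemma finite_candidates: "finite (candidates n a J)"
  unfolding candidates_def by simp

context gaussian_frequency
begin

text \<open>If no candidate explains the rows for \<open>v\<close>, the linear theorem forbids a
  mean above \<rho> for every \<open>w\<close> in the band. Its rows are scaled by 2 w/\<beta>;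
  undoing this turns the radius 2 * 8^a R into at most \<beta> * 8^a0 R/c1.\<close>

lemma structure_of_decoupled_form:
  fixes A :: "nat \<Rightarrow> nat \<Rightarrow> 'a" and b :: "nat \<Rightarrow> 'a"
  assumes xi: "real_distribution \<xi>" and U: "U \<subseteq> {1..n}" and beta: "0 < \<beta>"
    and sym: "\<And>i j. i \<in> {1..n} \<Longrightarrow> j \<in> {1..n} \<Longrightarrow> A i j = A j i"
    and c: "0 < c1" "0 < c3" and band: "c3 \<le> measure (difference_law \<xi>) {w. c1 \<le> \<bar>w\<bar> \<and> \<bar>w\<bar> \<le> c2}"
    and m: "0 < m" and J: "0 < J" "4 ^ J \<le> 6 * (c3/2 * real m)"
    and R: "0 < R" "exp (- R\<^sup>2 / 2) < \<rho> / 2"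
    and a0: "\<And>a. \<rho> \<le> (7/8) ^ a \<Longrightarrow> a \<le> a0"
  shows "(measure (iid n \<xi>) {x \<in> space (iid n \<xi>).
      (\<Sum>i=1..n. \<Sum>j=1..n. (x i * x j) *\<^sub>R A i j) + (\<Sum>i=1..n. x i *\<^sub>R b i) \<in> cball a \<beta>})\<^sup>2
    \<le> exp 1 * (\<rho> + measure (Pi\<^sub>M {1..n} (\<lambda>_. difference_law \<xi>)) {v \<in> space (Pi\<^sub>M {1..n} (\<lambda>_. difference_law \<xi>)).
        \<exists>\<theta>\<in>candidates n a0 J. exceptional_le n A (8 ^ a0) (\<beta> * 8 ^ a0 * R / c1) ((a0 + 1) * m) \<theta> U v})"
proof (rule quadratic_small_ball_power2_le[OF xi U beta sym])
  interpret X: real_distribution \<xi> by fact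
  let ?D = "Pi\<^sub>M {1..n} (\<lambda>_. difference_law \<xi>)"
  let ?r = "\<beta> * 8 ^ a0 * R / c1"
  show "{v \<in> space ?D. \<exists>\<theta>\<in>candidates n a0 J. exceptional_le n A (8 ^ a0) ?r ((a0 + 1) * m) \<theta> U v} \<in> sets ?D"
  proof -
    have row: "(\<lambda>v. row_form n A (masked n U v) i) \<in> borel_measurable ?D" for i
    proof -
      have [measurable]: "(\<lambda>v. v j) \<in> borel_measurable ?D" if "j \<in> U" for j
      proof -
        have "j \<in> {1..n}" using that U by auto
        then have "(\<lambda>v. v j) \<in> ?D \<rightarrow>\<^sub>M difference_law \<xi>" by (rule measurable_component_singleton)
        then show ?thesis unfolding measurable_cong_sets[OF refl X.sets_difference_law] .
      qed
      show ?thesis unfolding row_form_masked[OF U] by measurable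
    qed
    have "Measurable.pred ?D (\<lambda>v. exceptional_le n A (8 ^ a0) ?r ((a0 + 1) * m) \<theta> U v)" if "\<theta> \<in> candidates n a0 J" for \<theta>
    proof -
      have "snd \<theta> \<subseteq> {1..n}" using that by (auto simp: candidates_def)
      then have "finite (snd \<theta>)" by (rule finite_subset) simp
      then have [measurable]: "Measurable.pred ?D (\<lambda>v. structured n A (8 ^ a0) ?r \<theta> i (masked n U v))" for i
        unfolding structured_def by (rule pred_near_span[OF _ row])
      show ?thesis unfolding exceptional_le_def by (rule pred_card_le) measurable
    qed
    then have "Measurable.pred ?D (\<lambda>v. \<exists>\<theta>\<in>candidates n a0 J. exceptional_le n A (8 ^ a0) ?r ((a0 + 1) * m) \<theta> U v)"
      using finite_candidates by (intro pred_intros_finite) auto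
    then show ?thesis by (simp add: pred_def)
  qed
  show "0 \<le> \<rho>" using R(2) exp_gt_zero[of "- R\<^sup>2 / 2"] by linarith
  fix v assume v: "v \<in> space ?D" "v \<notin> {v \<in> space ?D.
    \<exists>\<theta>\<in>candidates n a0 J. exceptional_le n A (8 ^ a0) ?r ((a0 + 1) * m) \<theta> U v}"
  let ?L = "row_form n A (masked n U v)"
  show "(\<integral>t. (\<Prod>j\<in>{1..n} - U. norm (char \<xi> (((2 / \<beta>) *\<^sub>R ?L j) \<bullet> t))) \<partial>\<mu>) \<le> \<rho>"
  proof (rule integral_prod_char_le[OF xi _ c(2) band])
    fix w assume w: "c1 \<le> \<bar>w\<bar>" "\<bar>w\<bar> \<le> c2"
    define s where "s = w * (2 / \<beta>)"
    have s: "s \<noteq> 0" using w c beta by (auto simp: s_def)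
    show "(\<integral>t. exp (- (c3/2) * energy (\<lambda>j. w *\<^sub>R (2 / \<beta>) *\<^sub>R ?L j) ({1..n} - U) t) \<partial>\<mu>) \<le> \<rho>"
    proof (rule ccontr)
      assume "\<not> ?thesis"
      then have "\<rho> \<le> (\<integral>t. exp (- (c3/2) * energy (\<lambda>j. s *\<^sub>R ?L j) ({1..n} - U) t) \<partial>\<mu>)"
        by (simp add: s_def)
      from linear_inverse_littlewood_offord[OF _ _ m J R this] c
      obtain a K W where a: "\<rho> \<le> (7/8) ^ a" and K: "1 \<le> K" "real K \<le> 8 ^ a" and W: "W \<subseteq> {1..n} - U" "J * card W \<le> a"
        and bad: "card {i \<in> {1..n} - U. s *\<^sub>R ?L i \<notin> near_span (\<lambda>j. s *\<^sub>R ?L j) W K (8 ^ a) (2 * 8 ^ a * R)} \<le> (a + 1) * m"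
        by auto
      have aa: "a \<le> a0" using a0[OF a] .
      have pw: "(8::real) ^ a \<le> 8 ^ a0" using aa by (intro power_increasing) auto
      have "K \<le> 8 ^ a"
      proof -
        have "real K \<le> real (8 ^ a)" using K(2) by simp
        then show ?thesis by (simp only: of_nat_le_iff)
      qed
      also have "\<dots> \<le> 8 ^ a0" using aa by (intro power_increasing) auto
      finally have cand: "(K, W) \<in> candidates n a0 J" using K W aa unfolding candidates_def by auto
      have sub: "?L i \<in> near_span ?L W K (8 ^ a0) ?r" if "s *\<^sub>R ?L i \<in> near_span (\<lambda>j. s *\<^sub>R ?L j) W K (8 ^ a) (2 * 8 ^ a * R)" for i
      proof -
        have "2 * 8 ^ a * R / \<bar>s\<bar> = \<beta> * 8 ^ a * R / \<bar>w\<bar>" using beta by (simp add: s_def abs_mult)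
        also have "\<dots> \<le> \<beta> * 8 ^ a0 * R / c1"
          using w c beta R(1) pw by (intro frac_le mult_mono) auto
        finally have "2 * 8 ^ a * R / \<bar>s\<bar> \<le> ?r" .
        with near_span_scaleR[OF s that] near_span_mono[OF pw this] show ?thesis by blast
      qed
      have "exceptional_le n A (8 ^ a0) ?r ((a0 + 1) * m) (K, W) U v"
      proof -
        have "{i \<in> {1..n}. i \<notin> U \<and> \<not> structured n A (8 ^ a0) ?r (K, W) i (masked n U v)}
          \<subseteq> {i \<in> {1..n} - U. s *\<^sub>R ?L i \<notin> near_span (\<lambda>j. s *\<^sub>R ?L j) W K (8 ^ a) (2 * 8 ^ a * R)}"
          using sub by (auto simp: structured_def)
        then have "card {i \<in> {1..n}. i \<notin> U \<and> \<not> structured n A (8 ^ a0) ?r (K, W) i (masked n U v)} \<le> (a + 1) * m"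
          by (rule order_trans[OF card_mono bad, rotated]) simp
        also have "\<dots> \<le> (a0 + 1) * m" using aa by (intro mult_le_mono1) simp
        finally show ?thesis unfolding exceptional_le_def .
      qed
      then show False using v cand by blast
    qed
  qed simp
qed

end

section \<open>Popular structure over a random mask\<close>
lemma (in prob_space) pigeonhole:
  assumes fin: "finite \<Theta>" and [measurable]: "\<And>\<theta>. \<theta> \<in> \<Theta> \<Longrightarrow> Measurable.pred M (P \<theta>)"
    and p: "0 < p" "p \<le> prob {\<omega> \<in> space M. \<exists>\<theta>\<in>\<Theta>. P \<theta> \<omega>}"
  shows "\<exists>\<theta>\<in>\<Theta>. p / real (card \<Theta>) \<le> prob {\<omega> \<in> space M. P \<theta> \<omega>}"
proof (rule ccontr)
  assume *: "\<not> ?thesis"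
  have ne: "\<Theta> \<noteq> {}" using p by auto
  have "p \<le> prob (\<Union>\<theta>\<in>\<Theta>. {\<omega> \<in> space M. P \<theta> \<omega>})"
  proof -
    have "(\<Union>\<theta>\<in>\<Theta>. {\<omega> \<in> space M. P \<theta> \<omega>}) = {\<omega> \<in> space M. \<exists>\<theta>\<in>\<Theta>. P \<theta> \<omega>}" by blast
    then show ?thesis using p(2) by simp
  qed
  also have "\<dots> \<le> (\<Sum>\<theta>\<in>\<Theta>. prob {\<omega> \<in> space M. P \<theta> \<omega>})"
    using fin by (intro finite_measure_subadditive_finite) auto
  also have "\<dots> < (\<Sum>\<theta>\<in>\<Theta>. p / real (card \<Theta>))"
    using * fin ne by (intro sum_strict_mono) auto
  also have "\<dots> = p" using fin ne by simp
  finally show False by simp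
qed

lemma (in prob_space) expectation_prob:
  assumes [measurable]: "Measurable.pred M P"
  shows "expectation (\<lambda>\<omega>. if P \<omega> then 1 else 0 :: real) = prob {\<omega> \<in> space M. P \<omega>}"
    and "integrable M (\<lambda>\<omega>. if P \<omega> then 1 else 0 :: real)"
proof -
  have "expectation (\<lambda>\<omega>. if P \<omega> then 1 else 0 :: real) = expectation (indicator {\<omega> \<in> space M. P \<omega>})"
    by (rule Bochner_Integration.integral_cong) (auto simp: indicator_def)
  then show "expectation (\<lambda>\<omega>. if P \<omega> then 1 else 0 :: real) = prob {\<omega> \<in> space M. P \<omega>}"
    by simp
  show "integrable M (\<lambda>\<omega>. if P \<omega> then 1 else 0 :: real)"
    by (rule integrable_const_bound[where B = 1]) auto
qed

text \<open>
  An event of polynomial probability cannot force many indices into a uniformly random set: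
  compare the exponential moment of the number of omitted indices with its conditional mean.
\<close>

lemma (in prob_space) few_rarely_omitted:
  fixes U :: "'a \<Rightarrow> 'i set"
  assumes fin: "finite T"
    and U[measurable]: "\<And>i. i \<in> T \<Longrightarrow> Measurable.pred M (\<lambda>\<omega>. i \<in> U \<omega>)"
    and E[measurable]: "Measurable.pred M E"
    and moment: "expectation (\<lambda>\<omega>. \<Prod>i\<in>T. if i \<in> U \<omega> then 1 else 1/4 :: real) \<le> (5/8) ^ card T"
    and rare: "\<And>i. i \<in> T \<Longrightarrow> prob {\<omega> \<in> space M. E \<omega> \<and> i \<notin> U \<omega>} \<le> prob {\<omega> \<in> space M. E \<omega>} / 4"
  shows "prob {\<omega> \<in> space M. E \<omega>} \<le> (9/10) ^ card T"
proof -
  define q where "q = prob {\<omega> \<in> space M. E \<omega>}"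
  define e where "e \<omega> = (if E \<omega> then 1 else 0 :: real)" for \<omega>
  define X where "X \<omega> = (\<Sum>i\<in>T. if i \<in> U \<omega> then 0 else 1 :: real)" for \<omega>
  \<comment> \<open>By the rarity hypothesis, an upper bound for the mean of \<open>X\<close>
    conditioned on \<open>E\<close>.\<close>
  define x where "x = real (card T) / 4"
  have prod_eq: "(\<Prod>i\<in>T. if i \<in> U \<omega> then 1 else 1/4 :: real) = exp (- ln 4 * X \<omega>)" for \<omega>
  proof -
    have "exp (- ln 4 * X \<omega>) = (\<Prod>i\<in>T. exp (- ln 4 * (if i \<in> U \<omega> then 0 else 1)))"
      unfolding X_def sum_distrib_left by (rule exp_sum[OF fin])
    also have "\<dots> = (\<Prod>i\<in>T. if i \<in> U \<omega> then 1 else 1/4 :: real)"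
      by (intro prod.cong) (auto simp: exp_minus)
    finally show ?thesis by simp
  qed
  have eX: "e \<omega> * X \<omega> = (\<Sum>i\<in>T. if E \<omega> \<and> i \<notin> U \<omega> then 1 else 0)" for \<omega>
    unfolding e_def X_def by (auto simp: sum_distrib_left intro!: sum.cong)
  have ie: "integrable M e" "expectation e = q"
    using expectation_prob[OF E] unfolding e_def[abs_def] q_def by auto
  have P: "Measurable.pred M (\<lambda>\<omega>. E \<omega> \<and> i \<notin> U \<omega>)" if "i \<in> T" for i using that by measurable
  have ieX: "integrable M (\<lambda>\<omega>. e \<omega> * X \<omega>)"
    unfolding eX using expectation_prob(2)[OF P] by (intro Bochner_Integration.integrable_sum) auto
  have "expectation (\<lambda>\<omega>. e \<omega> * X \<omega>) = (\<Sum>i\<in>T. prob {\<omega> \<in> space M. E \<omega> \<and> i \<notin> U \<omega>})"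
    unfolding eX using expectation_prob[OF P] by (simp add: Bochner_Integration.integral_sum)
  also have "\<dots> \<le> (\<Sum>i\<in>T. q / 4)" using rare unfolding q_def by (intro sum_mono)
  also have "\<dots> = q * x" by (simp add: x_def)
  finally have EX: "expectation (\<lambda>\<omega>. e \<omega> * X \<omega>) \<le> q * x" .
  have X0: "0 \<le> X \<omega>" for \<omega> unfolding X_def by (rule sum_nonneg) simp
  have Xm: "X \<in> borel_measurable M" unfolding X_def[abs_def] by measurable
  have iexp: "integrable M (\<lambda>\<omega>. exp (- ln 4 * X \<omega>))"
    by (rule integrable_const_bound[where B = 1]) (use X0 Xm in auto)
  have "exp (- ln 4 * x) * q \<le> exp (- ln 4 * x) * (q + ln 4 * (q * x - expectation (\<lambda>\<omega>. e \<omega> * X \<omega>)))"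
    using EX by (intro mult_left_mono) auto
  also have "\<dots> = expectation (\<lambda>\<omega>. exp (- ln 4 * x) * (e \<omega> + ln 4 * (e \<omega> * x - e \<omega> * X \<omega>)))"
    using ie ieX by simp
  also have "\<dots> \<le> expectation (\<lambda>\<omega>. exp (- ln 4 * X \<omega>))"
  proof (rule integral_mono[OF _ iexp])
    show "integrable M (\<lambda>\<omega>. exp (- ln 4 * x) * (e \<omega> + ln 4 * (e \<omega> * x - e \<omega> * X \<omega>)))"
      using ie ieX by simp
    fix \<omega>
    \<comment> \<open>The tangent line of the exponential at \<open>x\<close>: Jensen for the law
      conditioned on \<open>E\<close>, without forming the conditional measure.\<close>
    have "exp (- ln 4 * x) * (1 + ln 4 * (x - X \<omega>)) \<le> exp (- ln 4 * x) * exp (ln 4 * (x - X \<omega>))"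
      by (intro mult_left_mono exp_ge_add_one_self) auto
    also have "\<dots> = exp (- ln 4 * X \<omega>)" by (simp add: algebra_simps flip: exp_add)
    finally have "exp (- ln 4 * x) * (1 + ln 4 * (x - X \<omega>)) \<le> exp (- ln 4 * X \<omega>)" .
    then show "exp (- ln 4 * x) * (e \<omega> + ln 4 * (e \<omega> * x - e \<omega> * X \<omega>)) \<le> exp (- ln 4 * X \<omega>)"
      by (simp add: e_def)
  qed
  also have "\<dots> \<le> (5/8) ^ card T" using moment unfolding prod_eq .
  finally have "q \<le> (5/8) ^ card T * exp (ln 4 * x)" by (simp add: exp_minus field_simps)
  also have "exp (ln 4 * x) = exp (ln 4 / 4) ^ card T"
    unfolding x_def by (simp flip: exp_of_nat_mult)
  also have "(5/8) ^ card T * exp (ln 4 / 4) ^ card T = (5/8 * exp (ln 4 / 4) :: real) ^ card T"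
    by (rule power_mult_distrib[symmetric])
  also have "\<dots> \<le> (9/10) ^ card T"
  proof (rule power_mono)
    \<comment> \<open>exp(ln 4 / 4) is the square root of 2, which is at most 36/25, and 5/8 times
      36/25 is 9/10.\<close>
    have "exp (ln 4 / 4) ^ 4 = (4::real)" by (simp flip: exp_of_nat_mult)
    also have "\<dots> \<le> (36/25) ^ 4" by (simp add: power_divide)
    finally have "exp (ln 4 / 4) \<le> (36/25 :: real)" by (rule power_mono_iff[THEN iffD1, rotated 3]) auto
    then show "5/8 * exp (ln 4 / 4) \<le> (9/10 :: real)" by simp
  qed simp
  finally show ?thesis unfolding q_def .
qed

text \<open>Markov's inequality: on \<open>E\<close> at most \<open>m\<close> indices fail at a
  time, so the failure probabilities sum to at most \<open>m\<close> times the probability of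
  \<open>E\<close>.\<close>

lemma (in prob_space) few_often_failing:
  assumes fin: "finite I" and P[measurable]: "\<And>i. i \<in> I \<Longrightarrow> Measurable.pred M (P i)"
    and E[measurable]: "Measurable.pred M E" and few: "\<And>\<omega>. E \<omega> \<Longrightarrow> card {i \<in> I. P i \<omega>} \<le> m"
    and pos: "0 < prob {\<omega> \<in> space M. E \<omega>}"
  shows "card {i \<in> I. prob {\<omega> \<in> space M. E \<omega>} / 8 < prob {\<omega> \<in> space M. E \<omega> \<and> P i \<omega>}} \<le> 8 * m"
proof -
  let ?q = "prob {\<omega> \<in> space M. E \<omega>}"
  let ?T = "{i \<in> I. ?q / 8 < prob {\<omega> \<in> space M. E \<omega> \<and> P i \<omega>}}"
  have EP: "Measurable.pred M (\<lambda>\<omega>. E \<omega> \<and> P i \<omega>)" if "i \<in> I" for i using that by measurable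
  have "real (card ?T) * (?q / 8) = (\<Sum>i\<in>?T. ?q / 8)" by simp
  also have "\<dots> \<le> (\<Sum>i\<in>?T. prob {\<omega> \<in> space M. E \<omega> \<and> P i \<omega>})" by (intro sum_mono) auto
  also have "\<dots> \<le> (\<Sum>i\<in>I. prob {\<omega> \<in> space M. E \<omega> \<and> P i \<omega>})" using fin by (intro sum_mono2) auto
  also have "\<dots> = expectation (\<lambda>\<omega>. \<Sum>i\<in>I. if E \<omega> \<and> P i \<omega> then 1 else 0)"
    using expectation_prob[OF EP] by (simp add: Bochner_Integration.integral_sum)
  also have "\<dots> \<le> expectation (\<lambda>\<omega>. real m * (if E \<omega> then 1 else 0))"
  proof (rule integral_mono)
    show "integrable M (\<lambda>\<omega>. \<Sum>i\<in>I. if E \<omega> \<and> P i \<omega> then 1 else 0 :: real)"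
      using expectation_prob(2)[OF EP] by (intro Bochner_Integration.integrable_sum) auto
    show "integrable M (\<lambda>\<omega>. real m * (if E \<omega> then 1 else 0))"
      using expectation_prob(2)[OF E] by (intro integrable_mult_right)
    fix \<omega>
    show "(\<Sum>i\<in>I. if E \<omega> \<and> P i \<omega> then 1 else 0) \<le> real m * (if E \<omega> then 1 else 0)"
      using few[of \<omega>] fin by (auto simp: sum.If_cases Int_def)
  qed
  also have "\<dots> = real m * ?q" using expectation_prob[OF E] by simp
  finally have "real (card ?T) * (?q / 8) \<le> real m * ?q" .
  then have "real (card ?T) \<le> 8 * real m" using pos by (simp add: field_simps)
  then show ?thesis by linarith
qed

text \<open>Let q be the probability of the popular event. Within it, an index off T0 is outside
  \<open>U\<close> with probability at least q/4; off T1 it is outside \<open>U\<close> and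
  unexplained with probability at most q/8. So q/8 is left. The bound on T0 is logarithmic in the
  inverse probability, that on T1 comes from Markov.\<close>

lemma (in prob_space) popular_structure:
  fixes U :: "'a \<Rightarrow> 'i set" and A :: "'t \<Rightarrow> 'i \<Rightarrow> 'a \<Rightarrow> bool" and E :: "'t \<Rightarrow> 'a \<Rightarrow> bool"
  assumes fin: "finite I" "finite \<Theta>"
    and U[measurable]: "\<And>i. i \<in> I \<Longrightarrow> Measurable.pred M (\<lambda>\<omega>. i \<in> U \<omega>)"
    and A[measurable]: "\<And>\<theta> i. \<theta> \<in> \<Theta> \<Longrightarrow> i \<in> I \<Longrightarrow> Measurable.pred M (A \<theta> i)"
    and E[measurable]: "\<And>\<theta>. \<theta> \<in> \<Theta> \<Longrightarrow> Measurable.pred M (E \<theta>)"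
    and moment: "\<And>T. T \<subseteq> I \<Longrightarrow> expectation (\<lambda>\<omega>. \<Prod>i\<in>T. if i \<in> U \<omega> then 1 else 1/4 :: real) \<le> (5/8) ^ card T"
    and few: "\<And>\<theta> \<omega>. \<theta> \<in> \<Theta> \<Longrightarrow> E \<theta> \<omega> \<Longrightarrow> card {i \<in> I. i \<notin> U \<omega> \<and> \<not> A \<theta> i \<omega>} \<le> m"
    and p: "0 < p" "p \<le> prob {\<omega> \<in> space M. \<exists>\<theta>\<in>\<Theta>. E \<theta> \<omega>}"
  shows "\<exists>\<theta>\<in>\<Theta>. \<exists>T0 T1. T0 \<subseteq> I \<and> T1 \<subseteq> I \<and> p / real (card \<Theta>) \<le> (9/10) ^ card T0 \<and> card T1 \<le> 8 * m \<and>
    (\<forall>i\<in>I - T0 - T1. p / real (card \<Theta>) / 8 \<le> prob {\<omega> \<in> space M. A \<theta> i \<omega>})"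
proof -
  from pigeonhole[OF fin(2) E p] obtain \<theta> where \<theta>: "\<theta> \<in> \<Theta>"
    and q: "p / real (card \<Theta>) \<le> prob {\<omega> \<in> space M. E \<theta> \<omega>}" by blast
  let ?q = "prob {\<omega> \<in> space M. E \<theta> \<omega>}"
  have "0 < real (card \<Theta>)" using \<theta> fin(2) by (simp add: card_gt_0_iff) blast
  then have pos: "0 < ?q" using q p(1) by (smt (verit) divide_pos_pos)
  define T0 where "T0 = {i \<in> I. prob {\<omega> \<in> space M. E \<theta> \<omega> \<and> i \<notin> U \<omega>} \<le> ?q / 4}"
  define T1 where "T1 = {i \<in> I. ?q / 8 < prob {\<omega> \<in> space M. E \<theta> \<omega> \<and> i \<notin> U \<omega> \<and> \<not> A \<theta> i \<omega>}}"
  have "?q \<le> (9/10) ^ card T0"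
    using fin(1) by (intro few_rarely_omitted[where U = U] E[OF \<theta>] moment U) (auto simp: T0_def)
  moreover have "card T1 \<le> 8 * m"
    unfolding T1_def using \<theta> few[OF \<theta>] pos by (intro few_often_failing fin(1)) measurable
  moreover have "p / real (card \<Theta>) / 8 \<le> prob {\<omega> \<in> space M. A \<theta> i \<omega>}" if i: "i \<in> I - T0 - T1" for i
  proof -
    have [measurable]: "Measurable.pred M (\<lambda>\<omega>. i \<in> U \<omega>)" "Measurable.pred M (A \<theta> i)" "Measurable.pred M (E \<theta>)"
      using i \<theta> by auto
    have "?q / 4 \<le> prob {\<omega> \<in> space M. E \<theta> \<omega> \<and> i \<notin> U \<omega>}" using i by (auto simp: T0_def)
    also have "\<dots> \<le> prob ({\<omega> \<in> space M. E \<theta> \<omega> \<and> i \<notin> U \<omega> \<and> \<not> A \<theta> i \<omega>} \<union> {\<omega> \<in> space M. A \<theta> i \<omega>})"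
      by (intro finite_measure_mono) auto
    also have "\<dots> \<le> prob {\<omega> \<in> space M. E \<theta> \<omega> \<and> i \<notin> U \<omega> \<and> \<not> A \<theta> i \<omega>} + prob {\<omega> \<in> space M. A \<theta> i \<omega>}"
      by (rule measure_Un_le) auto
    also have "\<dots> \<le> ?q / 8 + prob {\<omega> \<in> space M. A \<theta> i \<omega>}" using i by (auto simp: T1_def)
    finally have "?q / 8 \<le> prob {\<omega> \<in> space M. A \<theta> i \<omega>}" by simp
    then show ?thesis by (rule order_trans[OF divide_right_mono[OF q], rotated]) simp
  qed
  moreover have "T0 \<subseteq> I" "T1 \<subseteq> I" by (auto simp: T0_def T1_def)
  ultimately show ?thesis using \<theta> q by (meson order_trans)
qed

section \<open>Random masks and the lazy law\<close>

context real_distribution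
begin

lemma emeasure_difference_law_uminus:
  assumes [measurable]: "A \<in> sets borel"
  shows "(\<integral>\<^sup>+x. (\<integral>\<^sup>+x'. indicator A (- (x - x')) \<partial>M) \<partial>M) = emeasure (difference_law M) A"
proof -
  interpret MM: pair_prob_space M M ..
  have "(\<integral>\<^sup>+x. (\<integral>\<^sup>+x'. indicator A (- (x - x')) \<partial>M) \<partial>M) = (\<integral>\<^sup>+x. (\<integral>\<^sup>+x'. indicator A (x' - x) \<partial>M) \<partial>M)"
    by simp
  also have "\<dots> = (\<integral>\<^sup>+x'. (\<integral>\<^sup>+x. indicator A (x' - x) \<partial>M) \<partial>M)"
    by (rule MM.Fubini'[symmetric]) measurable
  finally show ?thesis by (simp add: emeasure_difference_law)
qed

text \<open>The signs 1 and -1 contribute the same law since x - x' is symmetric, so the lazy law is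
  the even mixture of the difference law and a point mass at 0: a difference kept or erased by a
  fair coin.\<close>

lemma emeasure_lazy_difference:
  assumes [measurable]: "A \<in> sets borel"
  shows "emeasure (lazy_difference M) A = (emeasure (difference_law M) A + indicator A 0) * ennreal (1/2)"
proof -
  interpret MM: pair_prob_space M M ..
  let ?e = "measure_pmf (eta (1/2))"
  interpret Q: pair_prob_space ?e "M \<Otimes>\<^sub>M M" ..
  have [measurable]: "(\<lambda>h. h) \<in> borel_measurable ?e" by simp
  have [measurable]: "(\<lambda>(h, x, x'). h * (x - x')) \<in> borel_measurable (?e \<Otimes>\<^sub>M (M \<Otimes>\<^sub>M M))" by measurable
  define f where "f h = (\<integral>\<^sup>+x. (\<integral>\<^sup>+x'. indicator A (h * (x - x')) \<partial>M) \<partial>M)" for h :: real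
  have "emeasure (lazy_difference M) A = (\<integral>\<^sup>+z. indicator A z \<partial>lazy_difference M)"
    by (simp add: lazy_difference_def)
  also have "\<dots> = (\<integral>\<^sup>+z. indicator A (fst z * (fst (snd z) - snd (snd z))) \<partial>(?e \<Otimes>\<^sub>M (M \<Otimes>\<^sub>M M)))"
    unfolding lazy_difference_def by (subst nn_integral_distr) (auto simp: split_beta')
  also have "\<dots> = (\<integral>\<^sup>+h. (\<integral>\<^sup>+z. indicator A (h * (fst z - snd z)) \<partial>(M \<Otimes>\<^sub>M M)) \<partial>?e)"
    using MM.P.nn_integral_fst[of "\<lambda>z. indicator A (fst z * (fst (snd z) - snd (snd z)))" ?e] by simp
  also have "\<dots> = (\<integral>\<^sup>+h. f h \<partial>?e)"
    unfolding f_def using nn_integral_fst[of "\<lambda>z. indicator A (_ * (fst z - snd z))" M, symmetric] by simp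
  also have "\<dots> = (\<Sum>h\<in>{0, 1, -1}. f h * ennreal (pmf (eta (1/2)) h))"
    by (rule nn_integral_measure_pmf_support) (auto simp: eta_def split: if_splits)
  also have "\<dots> = f 0 * ennreal (1/2) + f 1 * ennreal (1/4) + f (-1) * ennreal (1/4)"
    by (simp add: pmf_eta add.assoc)
  also have "f 0 = indicator A 0" using emeasure_space_1 by (simp add: f_def)
  also have "f 1 = emeasure (difference_law M) A" by (simp add: f_def emeasure_difference_law)
  also have "f (-1) = emeasure (difference_law M) A" unfolding f_def by (simp add: emeasure_difference_law_uminus[simplified])
  also have "indicator A 0 * ennreal (1/2) + emeasure (difference_law M) A * ennreal (1/4) + emeasure (difference_law M) A * ennreal (1/4)
     = (emeasure (difference_law M) A + indicator A 0) * ennreal (1/2)"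
  proof -
    have "ennreal (1/2) = ennreal (1/4) + ennreal (1/4)" by (subst ennreal_plus[symmetric]) auto
    then show ?thesis by (simp add: distrib_left distrib_right ac_simps)
  qed
  finally show ?thesis .
qed

definition masked_space :: "nat \<Rightarrow> (nat set \<times> (nat \<Rightarrow> real)) measure" where
  "masked_space n = measure_pmf (pmf_of_set (Pow {1..n})) \<Otimes>\<^sub>M Pi\<^sub>M {1..n} (\<lambda>_. difference_law M)"

lemma prob_space_PiM_difference_law: "prob_space (Pi\<^sub>M I (\<lambda>_. difference_law M))"
  by (rule prob_space_PiM) (rule prob_space_difference_law)

lemma prob_space_masked_space: "prob_space (masked_space n)"
proof -
  interpret D: prob_space "Pi\<^sub>M {1..n} (\<lambda>_. difference_law M)" by (rule prob_space_PiM_difference_law)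
  interpret pair_prob_space "measure_pmf (pmf_of_set (Pow {1..n}))" "Pi\<^sub>M {1..n} (\<lambda>_. difference_law M)" ..
  show ?thesis unfolding masked_space_def by (rule P.prob_space_axioms)
qed

lemma pred_mem_fst_masked_space [measurable]: "Measurable.pred (masked_space n) (\<lambda>\<omega>. i \<in> fst \<omega>)"
  unfolding masked_space_def by (rule measurable_compose[OF measurable_fst]) simp

lemma measurable_snd_masked_space:
  assumes "i \<in> {1..n}"
  shows "(\<lambda>\<omega>. snd \<omega> i) \<in> borel_measurable (masked_space n)"
proof -
  have "(\<lambda>v. v i) \<in> Pi\<^sub>M {1..n} (\<lambda>_. difference_law M) \<rightarrow>\<^sub>M difference_law M"
    using assms by (rule measurable_component_singleton)
  then have "(\<lambda>v. v i) \<in> borel_measurable (Pi\<^sub>M {1..n} (\<lambda>_. difference_law M))"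
    unfolding measurable_cong_sets[OF refl sets_difference_law] .
  then show ?thesis unfolding masked_space_def by (rule measurable_compose[OF measurable_snd])
qed

lemma sets_lazy_difference [simp, measurable_cong]: "sets (lazy_difference M) = sets borel"
  by (simp add: lazy_difference_def)

lemma measurable_masked [measurable]:
  "(\<lambda>\<omega>. masked n (fst \<omega>) (snd \<omega>)) \<in> masked_space n \<rightarrow>\<^sub>M iid n (lazy_difference M)"
proof -
  have "(\<lambda>\<omega>. if i \<in> fst \<omega> then snd \<omega> i else 0) \<in> borel_measurable (masked_space n)" if "i \<in> {1..n}" for i
    using measurable_snd_masked_space[OF that] by measurable
  then show ?thesis unfolding masked_def iid_def
    by (intro measurable_restrict) (simp add: measurable_cong_sets[OF refl sets_lazy_difference])
qed

text \<open>A uniformly random subset keeps each coordinate by an independent fair coin. On boxes,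
  the sum over subsets of products of kept and erased factors is the expansion of a product of sums,
  and the weight 1/2^n distributes over its \<open>n\<close> factors.\<close>

lemma distr_masked:
  "distr (masked_space n) (iid n (lazy_difference M)) (\<lambda>\<omega>. masked n (fst \<omega>) (snd \<omega>)) = iid n (lazy_difference M)"
proof -
  interpret D: prob_space "difference_law M" by (rule prob_space_difference_law)
  interpret PD: product_prob_space "\<lambda>_::nat. difference_law M" ..
  interpret L: prob_space "lazy_difference M"
    by (rule real_distribution.axioms(1)[OF real_distribution_lazy_difference]) (rule real_distribution_axioms)
  interpret PL: product_prob_space "\<lambda>_::nat. lazy_difference M" ..
  let ?I = "{1..n}"
  let ?D = "Pi\<^sub>M ?I (\<lambda>_. difference_law M)" and ?u = "measure_pmf (pmf_of_set (Pow ?I))"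
  let ?L = "Pi\<^sub>M ?I (\<lambda>_. lazy_difference M)"
  have sf: "sigma_finite_measure ?D" 
    by (rule product_sigma_finite.sigma_finite[OF PD.product_sigma_finite_axioms]) simp
  have mm: "(\<lambda>\<omega>. masked n (fst \<omega>) (snd \<omega>)) \<in> masked_space n \<rightarrow>\<^sub>M ?L"
    using measurable_masked[of n] unfolding iid_def .
  have "distr (masked_space n) ?L (\<lambda>\<omega>. masked n (fst \<omega>) (snd \<omega>)) = ?L"
  proof (rule PL.PiM_eqI)
    fix A assume "\<And>i. i \<in> ?I \<Longrightarrow> A i \<in> sets (lazy_difference M)"
    then have A[measurable]: "\<And>i. i \<in> ?I \<Longrightarrow> A i \<in> sets borel" by simp
    have A': "Pi\<^sub>E ?I A \<in> sets ?L" using A by (intro sets_PiM_I_finite) auto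
    have ind: "indicator (Pi\<^sub>E ?I A) (masked n U v) = (\<Prod>i\<in>?I. indicator (A i) (if i \<in> U then v i else 0) :: ennreal)" for U v
    proof (cases "\<forall>i\<in>?I. (if i \<in> U then v i else 0) \<in> A i")
      case True
      then have "masked n U v \<in> Pi\<^sub>E ?I A" by (auto simp: PiE_iff masked_def)
      moreover have "(\<Prod>i\<in>?I. indicator (A i) (if i \<in> U then v i else 0) :: ennreal) = 1"
        using True by (intro prod.neutral) simp
      ultimately show ?thesis by simp
    next
      case False
      then obtain i where i: "i \<in> ?I" "(if i \<in> U then v i else 0) \<notin> A i" by blast
      then have "masked n U v i \<notin> A i" by (simp add: masked_def)
      then have "masked n U v \<notin> Pi\<^sub>E ?I A" using i(1) by (meson PiE_mem)
      moreover have "(\<Prod>i\<in>?I. indicator (A i) (if i \<in> U then v i else 0) :: ennreal) = 0"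
        by (rule prod_zero) (use i in \<open>auto simp del: if_split intro!: bexI[of _ i]\<close>)
      ultimately show ?thesis by simp
    qed
    have gm: "(\<lambda>\<omega>. indicator (Pi\<^sub>E ?I A) (masked n (fst \<omega>) (snd \<omega>)) :: ennreal) \<in> borel_measurable (masked_space n)"
      by (rule measurable_compose[OF mm borel_measurable_indicator[OF A']])
    have "emeasure (distr (masked_space n) ?L (\<lambda>\<omega>. masked n (fst \<omega>) (snd \<omega>))) (Pi\<^sub>E ?I A)
       = (\<integral>\<^sup>+z. indicator (Pi\<^sub>E ?I A) z \<partial>distr (masked_space n) ?L (\<lambda>\<omega>. masked n (fst \<omega>) (snd \<omega>)))"
      using A' by simp
    also have "\<dots> = (\<integral>\<^sup>+\<omega>. indicator (Pi\<^sub>E ?I A) (masked n (fst \<omega>) (snd \<omega>)) \<partial>masked_space n)"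
      by (rule nn_integral_distr[OF mm]) (simp add: borel_measurable_indicator[OF A'])
    also have "\<dots> = (\<integral>\<^sup>+U. (\<integral>\<^sup>+v. indicator (Pi\<^sub>E ?I A) (masked n U v) \<partial>?D) \<partial>?u)"
      using sigma_finite_measure.nn_integral_fst[OF sf, of "\<lambda>\<omega>. indicator (Pi\<^sub>E ?I A) (masked n (fst \<omega>) (snd \<omega>))" ?u]
        gm by (simp add: masked_space_def)
    also have "\<dots> = (\<integral>\<^sup>+U. (\<Prod>i\<in>?I. if i \<in> U then emeasure (difference_law M) (A i) else indicator (A i) 0) \<partial>?u)"
    proof (rule nn_integral_cong)
      fix U
      have "(\<integral>\<^sup>+v. indicator (Pi\<^sub>E ?I A) (masked n U v) \<partial>?D)
          = (\<Prod>i\<in>?I. \<integral>\<^sup>+x. indicator (A i) (if i \<in> U then x else 0) \<partial>difference_law M)"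
        unfolding ind by (rule PD.product_nn_integral_prod) measurable
      also have "\<dots> = (\<Prod>i\<in>?I. if i \<in> U then emeasure (difference_law M) (A i) else indicator (A i) 0)"
      proof (rule prod.cong[OF refl])
        fix i assume "i \<in> ?I"
        then have "A i \<in> sets (difference_law M)" using A by simp
        moreover have "emeasure (difference_law M) UNIV = 1" using D.emeasure_space_1 by simp
        ultimately show "(\<integral>\<^sup>+x. indicator (A i) (if i \<in> U then x else 0) \<partial>difference_law M)
          = (if i \<in> U then emeasure (difference_law M) (A i) else indicator (A i) 0)" by simp
      qed
      finally show "(\<integral>\<^sup>+v. indicator (Pi\<^sub>E ?I A) (masked n U v) \<partial>?D)
        = (\<Prod>i\<in>?I. if i \<in> U then emeasure (difference_law M) (A i) else indicator (A i) 0)" .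
    qed
    also have "\<dots> = (\<Sum>U\<in>Pow ?I. \<Prod>i\<in>?I. if i \<in> U then emeasure (difference_law M) (A i) else indicator (A i) 0) / of_nat (card (Pow ?I))"
      by (subst nn_integral_pmf_of_set) auto
    also have "(\<Sum>U\<in>Pow ?I. \<Prod>i\<in>?I. if i \<in> U then emeasure (difference_law M) (A i) else indicator (A i) 0)
       = (\<Sum>U\<in>Pow ?I. (\<Prod>i\<in>U. emeasure (difference_law M) (A i)) * (\<Prod>i\<in>?I - U. indicator (A i) 0))"
    proof (rule sum.cong[OF refl])
      fix U assume U: "U \<in> Pow ?I"
      then have "?I \<inter> {i. i \<in> U} = U" "?I \<inter> - {i. i \<in> U} = ?I - U" by auto
      then show "(\<Prod>i\<in>?I. if i \<in> U then emeasure (difference_law M) (A i) else indicator (A i) 0)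
        = (\<Prod>i\<in>U. emeasure (difference_law M) (A i)) * (\<Prod>i\<in>?I - U. indicator (A i) 0)"
        by (simp add: prod.If_cases)
    qed
    also have "\<dots> = (\<Prod>i\<in>?I. emeasure (difference_law M) (A i) + indicator (A i) 0)"
      by (rule prod_add[symmetric]) simp
    also have "(\<Prod>i\<in>?I. emeasure (difference_law M) (A i) + indicator (A i) 0) / of_nat (card (Pow ?I))
       = (\<Prod>i\<in>?I. (emeasure (difference_law M) (A i) + indicator (A i) 0) * ennreal (1/2))"
    proof -
      have "1 / (of_nat (card (Pow ?I)) :: ennreal) = ennreal (1/2) ^ n"
      proof -
        have "1 / (of_nat (card (Pow ?I)) :: ennreal) = ennreal 1 / ennreal (2 ^ n)"
          by (simp add: card_Pow ennreal_power[symmetric])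
        also have "\<dots> = ennreal ((1/2) ^ n)" by (subst divide_ennreal) (auto simp: power_divide)
        also have "\<dots> = ennreal (1/2) ^ n" by (rule ennreal_power[symmetric]) simp
        finally show ?thesis .
      qed
      then have "inverse (of_nat (card (Pow ?I)) :: ennreal) = ennreal (1/2) ^ n" by (simp add: divide_ennreal_def)
      then show ?thesis unfolding divide_ennreal_def by (simp only: prod.distrib prod_constant card_atLeastAtMost) simp
    qed
    also have "\<dots> = (\<Prod>i\<in>?I. emeasure (lazy_difference M) (A i))"
      by (rule prod.cong[OF refl], rule emeasure_lazy_difference[symmetric]) (rule A)
    finally show "emeasure (distr (masked_space n) ?L (\<lambda>\<omega>. masked n (fst \<omega>) (snd \<omega>))) (Pi\<^sub>E ?I A)
      = (\<Prod>i\<in>?I. emeasure (lazy_difference M) (A i))" .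
  qed auto
  then show ?thesis unfolding iid_def .
qed

text \<open>The same subset expansion: an index of \<open>T\<close> contributes (1 + 1/4)/2 = 5/8,
  any other index contributes 1.\<close>

lemma masked_space_moment:
  assumes T: "T \<subseteq> {1..n}"
  shows "(\<integral>\<omega>. (\<Prod>i\<in>T. if i \<in> fst \<omega> then 1 else 1/4 :: real) \<partial>masked_space n) \<le> (5/8) ^ card T"
proof -
  let ?I = "{1..n}"
  let ?D = "Pi\<^sub>M ?I (\<lambda>_. difference_law M)" and ?u = "measure_pmf (pmf_of_set (Pow ?I))"
  interpret D: prob_space ?D by (rule prob_space_PiM_difference_law)
  define g where "g i = (if i \<in> T then 1/4 else 1 :: real)" for i
  have fT: "finite T" using T by (rule finite_subset) simp
  have "(\<integral>\<omega>. (\<Prod>i\<in>T. if i \<in> fst \<omega> then 1 else 1/4 :: real) \<partial>masked_space n)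
      = (\<integral>U. (\<Prod>i\<in>T. if i \<in> U then 1 else 1/4 :: real) \<partial>distr (masked_space n) ?u fst)"
    unfolding masked_space_def by (subst integral_distr) auto
  also have "distr (masked_space n) ?u fst = ?u" unfolding masked_space_def by (rule D.distr_pair_fst)
  also have "(\<integral>U. (\<Prod>i\<in>T. if i \<in> U then 1 else 1/4 :: real) \<partial>?u)
      = (\<Sum>U\<in>Pow ?I. (\<Prod>i\<in>T. if i \<in> U then 1 else 1/4)) / real (card (Pow ?I))"
    by (subst integral_pmf_of_set) auto
  also have "(\<Sum>U\<in>Pow ?I. (\<Prod>i\<in>T. if i \<in> U then 1 else 1/4 :: real)) = (\<Sum>U\<in>Pow ?I. (\<Prod>i\<in>U. 1) * (\<Prod>i\<in>?I - U. g i))"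
  proof (rule sum.cong[OF refl])
    fix U assume U: "U \<in> Pow ?I"
    have "(\<Prod>i\<in>T. if i \<in> U then 1 else 1/4 :: real) = (\<Prod>i\<in>T - U. g i)"
      using fT by (intro prod.mono_neutral_cong_right) (auto simp: g_def)
    also have "\<dots> = (\<Prod>i\<in>?I - U. g i)"
      using T by (intro prod.mono_neutral_left) (auto simp: g_def)
    finally show "(\<Prod>i\<in>T. if i \<in> U then 1 else 1/4 :: real) = (\<Prod>i\<in>U. 1) * (\<Prod>i\<in>?I - U. g i)" by simp
  qed
  also have "\<dots> = (\<Prod>i\<in>?I. 1 + g i)" by (rule prod_add[symmetric]) simp
  also have "\<dots> = (\<Prod>i\<in>?I. 2 * (if i \<in> T then 5/8 else 1))" by (rule prod.cong) (auto simp: g_def)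
  also have "\<dots> = 2 ^ n * (\<Prod>i\<in>?I. if i \<in> T then 5/8 else 1)" by (simp add: prod.distrib)
  also have "(\<Prod>i\<in>?I. if i \<in> T then 5/8 else 1 :: real) = (5/8) ^ card T"
  proof -
    have "?I \<inter> {i. i \<in> T} = T" using T by blast
    then show ?thesis by (simp add: prod.If_cases)
  qed
  finally show ?thesis by (simp add: card_Pow)
qed

end

section \<open>The inverse theorem for fixed n, with explicit bounds\<close>

lemma card_bounded_int: "card {l::int. \<bar>real_of_int l\<bar> \<le> 8 ^ a} = 2 * 8 ^ a + 1"
proof -
  have "{l::int. \<bar>real_of_int l\<bar> \<le> 8 ^ a} = {- (8 ^ a)..8 ^ a}"
  proof (intro set_eqI iffI)
    fix l :: int assume "l \<in> {l. \<bar>real_of_int l\<bar> \<le> 8 ^ a}"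
    then have "real_of_int \<bar>l\<bar> \<le> real_of_int (8 ^ a)" by simp
    then have "\<bar>l\<bar> \<le> 8 ^ a" by (simp only: of_int_le_iff)
    then show "l \<in> {- (8 ^ a)..8 ^ a}" by auto
  next
    fix l :: int assume "l \<in> {- (8 ^ a)..8 ^ a}"
    then have "\<bar>l\<bar> \<le> 8 ^ a" by auto
    then have "real_of_int \<bar>l\<bar> \<le> real_of_int (8 ^ a)" by (simp only: of_int_le_iff)
    then show "l \<in> {l. \<bar>real_of_int l\<bar> \<le> 8 ^ a}" by simp
  qed
  then have "int (card {l::int. \<bar>real_of_int l\<bar> \<le> 8 ^ a}) = int (2 * 8 ^ a + 1)" by simp
  then show ?thesis by (simp only: of_nat_eq_iff)
qed

lemma row_form_combination:
  fixes A :: "nat \<Rightarrow> nat \<Rightarrow> 'a::real_vector"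
  shows "(\<Sum>j=1..n. z j *\<^sub>R (c *\<^sub>R A i j + (\<Sum>l\<in>W. d l *\<^sub>R A l j))) =
    c *\<^sub>R row_form n A z i + (\<Sum>l\<in>W. d l *\<^sub>R row_form n A z l)"
proof -
  have "(\<Sum>j=1..n. z j *\<^sub>R (\<Sum>l\<in>W. d l *\<^sub>R A l j)) = (\<Sum>l\<in>W. d l *\<^sub>R row_form n A z l)"
    unfolding row_form_def scaleR_sum_right by (subst sum.swap) (simp add: mult.commute)
  moreover have "(\<Sum>j=1..n. z j *\<^sub>R c *\<^sub>R A i j) = c *\<^sub>R row_form n A z i"
    by (simp add: row_form_def scaleR_sum_right mult.commute)
  ultimately show ?thesis by (simp add: scaleR_add_right sum.distrib)
qed

text \<open>The estimate for a fixed mask holds for every \<open>U\<close>, hence for a random one.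
  The pair (k, W) is chosen before the index \<open>i\<close>, the coefficients after it: they come
  from a second pigeonhole, made separately for each \<open>i\<close> over (2 * 8^a0 + 1)^|W|
  vectors.\<close>

lemma finite_inverse_quadratic:
  fixes A :: "nat \<Rightarrow> nat \<Rightarrow> 'a::euclidean_space" and b :: "nat \<Rightarrow> 'a"
  assumes xi: "real_distribution \<xi>" and beta: "0 < \<beta>"
    and sym: "\<And>i j. i \<in> {1..n} \<Longrightarrow> j \<in> {1..n} \<Longrightarrow> A i j = A j i"
    and c: "0 < c1" "0 < c3" and band: "c3 \<le> measure (difference_law \<xi>) {w. c1 \<le> \<bar>w\<bar> \<and> \<bar>w\<bar> \<le> c2}"
    and m: "0 < m" and J: "0 < J" "4 ^ J \<le> 6 * (c3/2 * real m)"
    and R: "0 < R" "exp (- R\<^sup>2 / 2) < \<rho> / 2"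
    and a0: "\<And>a. \<rho> \<le> (7/8) ^ a \<Longrightarrow> a \<le> a0"
    and large: "exp 1 * (2 * \<rho>) \<le> (measure (iid n \<xi>) {x \<in> space (iid n \<xi>).
      (\<Sum>i=1..n. \<Sum>j=1..n. (x i * x j) *\<^sub>R A i j) + (\<Sum>i=1..n. x i *\<^sub>R b i) \<in> cball a \<beta>})\<^sup>2"
  shows "\<exists>k W T0 T1. (k, W) \<in> candidates n a0 J \<and> T0 \<subseteq> {1..n} \<and> T1 \<subseteq> {1..n} \<and>
    \<rho> / real (card (candidates n a0 J)) \<le> (9/10) ^ card T0 \<and> card T1 \<le> 8 * ((a0 + 1) * m) \<and>
    (\<forall>i\<in>{1..n} - T0 - T1. \<exists>\<kappa>::nat \<Rightarrow> int. (\<forall>l\<in>W. \<bar>real_of_int (\<kappa> l)\<bar> \<le> 8 ^ a0) \<and>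
      \<rho> / real (card (candidates n a0 J)) / 8 / (2 * 8 ^ a0 + 1) ^ card W \<le>
      measure (iid n (lazy_difference \<xi>)) {z \<in> space (iid n (lazy_difference \<xi>)).
        norm (\<Sum>j=1..n. z j *\<^sub>R (real k *\<^sub>R A i j + (\<Sum>l\<in>W. real_of_int (\<kappa> l) *\<^sub>R A l j)))
          \<le> \<beta> * 8 ^ a0 * R / c1})"
proof -
  interpret X: real_distribution \<xi> by fact
  obtain \<mu> :: "'a measure" where "gaussian_frequency \<mu>" using gaussian_frequency_exists by blast
  then interpret G: gaussian_frequency \<mu> .
  let ?I = "{1..n}" and ?\<Theta> = "candidates n a0 J" and ?r = "\<beta> * 8 ^ a0 * R / c1"
  let ?D = "Pi\<^sub>M ?I (\<lambda>_. difference_law \<xi>)" and ?u = "measure_pmf (pmf_of_set (Pow ?I))"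
  let ?N = "X.masked_space n" and ?L = "iid n (lazy_difference \<xi>)"
  interpret D: prob_space ?D by (rule X.prob_space_PiM_difference_law)
  interpret N: prob_space ?N by (rule X.prob_space_masked_space)
  interpret L1: prob_space "lazy_difference \<xi>"
    by (rule real_distribution.axioms(1)[OF real_distribution_lazy_difference[OF xi]])
  interpret L: prob_space ?L unfolding iid_def by (rule prob_space_PiM) (rule L1.prob_space_axioms)
  have rho: "0 < \<rho>" using R(2) exp_gt_zero[of "- R\<^sup>2 / 2"] by linarith
  define E where "E \<theta> \<omega> = exceptional_le n A (8 ^ a0) ?r ((a0 + 1) * m) \<theta> (fst \<omega>) (snd \<omega>)" for \<theta> \<omega>
  define S where "S \<theta> i \<omega> = structured n A (8 ^ a0) ?r \<theta> i (masked n (fst \<omega>) (snd \<omega>))" for \<theta> i \<omega>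
  have finW: "finite (snd \<theta>)" if "\<theta> \<in> ?\<Theta>" for \<theta>
  proof -
    have "snd \<theta> \<subseteq> {1..n}" using that by (auto simp: candidates_def)
    then show ?thesis by (rule finite_subset) simp
  qed
  have row[measurable]: "(\<lambda>z. row_form n A z i) \<in> borel_measurable ?L" for i
  proof -
    have [measurable]: "(\<lambda>z. z j) \<in> borel_measurable ?L" if "j \<in> ?I" for j
    proof -
      have "(\<lambda>z. z j) \<in> ?L \<rightarrow>\<^sub>M lazy_difference \<xi>" unfolding iid_def using that by (rule measurable_component_singleton)
      then show ?thesis unfolding measurable_cong_sets[OF refl X.sets_lazy_difference] .
    qed
    show ?thesis unfolding row_form_def by measurable
  qed
  have strm: "Measurable.pred ?L (structured n A (8 ^ a0) ?r \<theta> i)" if "\<theta> \<in> ?\<Theta>" for \<theta> i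
    unfolding structured_def[abs_def] by (rule pred_near_span[OF finW[OF that] row])
  have Sm: "Measurable.pred ?N (S \<theta> i)" if "\<theta> \<in> ?\<Theta>" for \<theta> i
    unfolding S_def[abs_def] by (rule measurable_compose[OF X.measurable_masked strm[OF that]])
  have Em: "Measurable.pred ?N (E \<theta>)" if "\<theta> \<in> ?\<Theta>" for \<theta>
  proof -
    note Sm[OF that, unfolded S_def, measurable]
    show ?thesis unfolding E_def[abs_def] exceptional_le_def by (rule pred_card_le) measurable
  qed
  have EmU: "Measurable.pred ?N (\<lambda>\<omega>. \<exists>\<theta>\<in>?\<Theta>. E \<theta> \<omega>)"
    using finite_candidates Em by (intro pred_intros_finite) auto
  define Z where "Z = {\<omega> \<in> space ?N. \<exists>\<theta>\<in>?\<Theta>. E \<theta> \<omega>}"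
  have Zm: "Z \<in> sets ?N" unfolding Z_def using EmU by (simp add: pred_def)
  have spaceN: "space ?N = UNIV \<times> space ?D" unfolding X.masked_space_def by (simp add: space_pair_measure)
  \<comment> \<open>The 2 in \<open>large\<close> pays for the term \<rho> lost in the decoupled
    estimate and leaves at least \<rho> for the event.\<close>
  have slice: "\<rho> \<le> measure ?D (Pair U -` Z)" if "U \<in> Pow ?I" for U
  proof -
    have "Pair U -` Z = {v \<in> space ?D. \<exists>\<theta>\<in>?\<Theta>. exceptional_le n A (8 ^ a0) ?r ((a0 + 1) * m) \<theta> U v}"
      unfolding Z_def spaceN E_def by auto
    then have "exp 1 * (2 * \<rho>) \<le> exp 1 * (\<rho> + measure ?D (Pair U -` Z))"
      using order_trans[OF large G.structure_of_decoupled_form[OF xi _ beta sym c band m J R a0]] that by simp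
    then show ?thesis by simp
  qed
  have probZ: "\<rho> \<le> N.prob Z"
  proof -
    have Zm': "Z \<in> sets (?u \<Otimes>\<^sub>M ?D)" using Zm unfolding X.masked_space_def .
    have "ennreal \<rho> = (\<integral>\<^sup>+U. ennreal \<rho> \<partial>?u)" by (simp add: measure_pmf.emeasure_space_1)
    also have "\<dots> \<le> (\<integral>\<^sup>+U. emeasure ?D (Pair U -` Z) \<partial>?u)"
    proof (rule nn_integral_mono_AE)
      have "set_pmf (pmf_of_set (Pow ?I)) = Pow ?I" by (rule set_pmf_of_set) auto
      then show "AE U in ?u. ennreal \<rho> \<le> emeasure ?D (Pair U -` Z)"
        unfolding AE_measure_pmf_iff D.emeasure_eq_measure using slice by (simp add: ennreal_leI)
    qed
    also have "\<dots> = emeasure ?N Z"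
      unfolding X.masked_space_def by (rule D.emeasure_pair_measure_alt[OF Zm', symmetric])
    finally have "ennreal \<rho> \<le> ennreal (N.prob Z)" by (simp add: N.emeasure_eq_measure)
    then show ?thesis by (simp add: ennreal_le_iff)
  qed
  have "\<exists>\<theta>\<in>?\<Theta>. \<exists>T0 T1. T0 \<subseteq> ?I \<and> T1 \<subseteq> ?I \<and> \<rho> / real (card ?\<Theta>) \<le> (9/10) ^ card T0 \<and>
      card T1 \<le> 8 * ((a0 + 1) * m) \<and> (\<forall>i\<in>?I - T0 - T1. \<rho> / real (card ?\<Theta>) / 8 \<le> N.prob {\<omega> \<in> space ?N. S \<theta> i \<omega>})"
  proof (rule N.popular_structure[where U = fst and E = E])
    show "card {i \<in> ?I. i \<notin> fst \<omega> \<and> \<not> S \<theta> i \<omega>} \<le> (a0 + 1) * m" if "E \<theta> \<omega>" for \<theta> \<omega>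
      using that unfolding E_def S_def exceptional_le_def .
    show "\<rho> \<le> N.prob {\<omega> \<in> space ?N. \<exists>\<theta>\<in>?\<Theta>. E \<theta> \<omega>}" using probZ unfolding Z_def .
  qed (use rho finite_candidates Sm Em X.masked_space_moment in auto)
  then obtain \<theta> T0 T1 where "\<theta> \<in> ?\<Theta>" "T0 \<subseteq> ?I" "T1 \<subseteq> ?I"
      "\<rho> / real (card ?\<Theta>) \<le> (9/10) ^ card T0" "card T1 \<le> 8 * ((a0 + 1) * m)"
      "\<forall>i\<in>?I - T0 - T1. \<rho> / real (card ?\<Theta>) / 8 \<le> N.prob {\<omega> \<in> space ?N. S \<theta> i \<omega>}"
    by blast
  then obtain k W where cand: "(k, W) \<in> ?\<Theta>" and T: "T0 \<subseteq> ?I" "T1 \<subseteq> ?I"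
      "\<rho> / real (card ?\<Theta>) \<le> (9/10) ^ card T0" "card T1 \<le> 8 * ((a0 + 1) * m)"
    and S: "\<And>i. i \<in> ?I - T0 - T1 \<Longrightarrow> \<rho> / real (card ?\<Theta>) / 8 \<le> N.prob {\<omega> \<in> space ?N. S (k, W) i \<omega>}"
    by (cases \<theta>) blast
  define p where "p = \<rho> / real (card ?\<Theta>) / 8"
  have "0 < real (card ?\<Theta>)" using cand finite_candidates[of n a0 J] by (auto simp: card_gt_0_iff)
  then have p: "0 < p" using rho by (simp add: p_def)
  have W: "finite W" using finW[OF cand] by simp
  define B where "B = {l::int. \<bar>real_of_int l\<bar> \<le> 8 ^ a0}"
  have "\<exists>\<kappa>::nat \<Rightarrow> int. (\<forall>l\<in>W. \<bar>real_of_int (\<kappa> l)\<bar> \<le> 8 ^ a0) \<and>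
      p / (2 * 8 ^ a0 + 1) ^ card W \<le> L.prob {z \<in> space ?L.
        norm (\<Sum>j=1..n. z j *\<^sub>R (real k *\<^sub>R A i j + (\<Sum>l\<in>W. real_of_int (\<kappa> l) *\<^sub>R A l j))) \<le> ?r}"
    if i: "i \<in> ?I - T0 - T1" for i
  proof -
    \<comment> \<open>Transport to the lazy law: \<open>S\<close> sees the pair of mask and
      differences only through the masked vector.\<close>
    have "N.prob {\<omega> \<in> space ?N. S (k, W) i \<omega>} =
        measure (distr ?N ?L (\<lambda>\<omega>. masked n (fst \<omega>) (snd \<omega>))) {z \<in> space ?L. structured n A (8 ^ a0) ?r (k, W) i z}"
    proof (subst measure_distr[OF X.measurable_masked])
      show "{z \<in> space ?L. structured n A (8 ^ a0) ?r (k, W) i z} \<in> sets ?L"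
        using strm[OF cand] by (simp add: pred_def)
      have "(\<lambda>\<omega>. masked n (fst \<omega>) (snd \<omega>)) -` {z \<in> space ?L. structured n A (8 ^ a0) ?r (k, W) i z} \<inter> space ?N
          = {\<omega> \<in> space ?N. S (k, W) i \<omega>}"
        using measurable_space[OF X.measurable_masked[of n]] by (auto simp: S_def)
      then show "N.prob {\<omega> \<in> space ?N. S (k, W) i \<omega>} = N.prob ((\<lambda>\<omega>. masked n (fst \<omega>) (snd \<omega>)) -`
          {z \<in> space ?L. structured n A (8 ^ a0) ?r (k, W) i z} \<inter> space ?N)" by simp
    qed
    also have "\<dots> = L.prob {z \<in> space ?L. structured n A (8 ^ a0) ?r (k, W) i z}"
      unfolding X.distr_masked ..
    also have "\<dots> = L.prob {z \<in> space ?L. \<exists>\<kappa>\<in>Pi\<^sub>E W (\<lambda>_. B).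
        norm (real k *\<^sub>R row_form n A z i - (\<Sum>l\<in>W. real_of_int (\<kappa> l) *\<^sub>R row_form n A z l)) \<le> ?r}"
      unfolding structured_def near_span_iff_bounded_coefficients B_def by simp
    finally have "p \<le> L.prob {z \<in> space ?L. \<exists>\<kappa>\<in>Pi\<^sub>E W (\<lambda>_. B).
        norm (real k *\<^sub>R row_form n A z i - (\<Sum>l\<in>W. real_of_int (\<kappa> l) *\<^sub>R row_form n A z l)) \<le> ?r}"
      using S[OF i] unfolding p_def by simp
    then have "\<exists>\<kappa>\<in>Pi\<^sub>E W (\<lambda>_. B). p / real (card (Pi\<^sub>E W (\<lambda>_. B))) \<le> L.prob {z \<in> space ?L.
        norm (real k *\<^sub>R row_form n A z i - (\<Sum>l\<in>W. real_of_int (\<kappa> l) *\<^sub>R row_form n A z l)) \<le> ?r}"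
      using W finite_bounded_int[of "8 ^ a0"] p by (intro L.pigeonhole finite_PiE) (auto simp: B_def)
    then obtain \<kappa> where k: "\<kappa> \<in> Pi\<^sub>E W (\<lambda>_. B)" and
      pk: "p / real (card (Pi\<^sub>E W (\<lambda>_. B))) \<le> L.prob {z \<in> space ?L.
        norm (real k *\<^sub>R row_form n A z i - (\<Sum>l\<in>W. real_of_int (\<kappa> l) *\<^sub>R row_form n A z l)) \<le> ?r}" by blast
    have "real (card (Pi\<^sub>E W (\<lambda>_. B))) = (2 * 8 ^ a0 + 1) ^ card W"
      using W by (simp add: card_PiE B_def card_bounded_int add.commute)
    \<comment> \<open>The sign changes because the conclusion adds the combination that
      \<open>near_span\<close> subtracts.\<close>
    moreover have "(\<Sum>j=1..n. z j *\<^sub>R (real k *\<^sub>R A i j + (\<Sum>l\<in>W. real_of_int (- \<kappa> l) *\<^sub>R A l j)))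
       = real k *\<^sub>R row_form n A z i - (\<Sum>l\<in>W. real_of_int (\<kappa> l) *\<^sub>R row_form n A z l)" for z
      unfolding row_form_combination[where A = A and i = i] by (simp add: sum_negf)
    ultimately have "p / (2 * 8 ^ a0 + 1) ^ card W \<le> L.prob {z \<in> space ?L.
        norm (\<Sum>j=1..n. z j *\<^sub>R (real k *\<^sub>R A i j + (\<Sum>l\<in>W. real_of_int (- \<kappa> l) *\<^sub>R A l j))) \<le> ?r}"
      using pk by simp
    moreover have "\<forall>l\<in>W. \<bar>real_of_int (- \<kappa> l)\<bar> \<le> 8 ^ a0" using k by (auto simp: B_def PiE_iff)
    ultimately show ?thesis by (intro exI[of _ "\<lambda>l. - \<kappa> l"]) blast
  qed
  then show ?thesis using cand T unfolding p_def by blast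
qed

lemma card_candidates_le: "real (card (candidates n a J)) \<le> 8 ^ a * (real n + 1) ^ (a div J)" if "0 < J"
proof -
  let ?r = "a div J"
  let ?W = "{W. W \<subseteq> {1..n} \<and> J * card W \<le> a}"
  have "?W \<subseteq> (\<lambda>f. f ` {..<?r} \<inter> {1..n}) ` (Pi\<^sub>E {..<?r} (\<lambda>_. {0..n}))"
  proof
    fix W assume "W \<in> ?W"
    then have W: "W \<subseteq> {1..n}" "J * card W \<le> a" by auto
    have fin: "finite W" using W(1) by (rule finite_subset) simp
    have "card W \<le> ?r" using W(2) \<open>0 < J\<close> by (simp add: less_eq_div_iff_mult_less_eq mult.commute)
    obtain h where h: "bij_betw h {0..<card W} W" using ex_bij_betw_nat_finite[OF fin] by blast
    define f where "f = (\<lambda>i\<in>{..<?r}. if i < card W then h i else 0)"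
    have hW: "h i \<in> W" if "i < card W" for i using h that by (auto simp: bij_betw_def)
    have "f \<in> Pi\<^sub>E {..<?r} (\<lambda>_. {0..n})" using hW W(1) by (force simp: f_def)
    moreover have "f ` {..<?r} \<inter> {1..n} = W"
    proof (intro equalityI subsetI)
      fix x assume "x \<in> f ` {..<?r} \<inter> {1..n}"
      then show "x \<in> W" using hW by (auto simp: f_def split: if_splits)
    next
      fix x assume x: "x \<in> W"
      then obtain i where "i < card W" "x = h i" using h unfolding bij_betw_def by (metis atLeastLessThan_iff imageE)
      then have "x = f i" "i < ?r" using \<open>card W \<le> ?r\<close> by (auto simp: f_def)
      then show "x \<in> f ` {..<?r} \<inter> {1..n}" using x W(1) by auto
    qed
    ultimately show "W \<in> (\<lambda>f. f ` {..<?r} \<inter> {1..n}) ` (Pi\<^sub>E {..<?r} (\<lambda>_. {0..n}))" by blast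
  qed
  then have "card ?W \<le> card (Pi\<^sub>E {..<?r} (\<lambda>_. {0..n}))"
    by (rule surj_card_le[rotated]) (auto intro: finite_PiE)
  also have "\<dots> = (n + 1) ^ ?r" by (simp add: card_PiE)
  finally have "card (candidates n a J) \<le> 8 ^ a * (n + 1) ^ ?r"
    unfolding candidates_def by (simp add: card_cartesian_product)
  then have "real (card (candidates n a J)) \<le> real (8 ^ a * (n + 1) ^ ?r)" by (simp only: of_nat_le_iff)
  then show ?thesis by (simp add: add.commute)
qed

section \<open>The inverse theorem\<close>
lemma (in real_distribution) measure_band_difference_law:
  "measure (difference_law M) {w. c1 \<le> \<bar>w\<bar> \<and> \<bar>w\<bar> \<le> c2} =
    measure (M \<Otimes>\<^sub>M M) {(x, x') \<in> space (M \<Otimes>\<^sub>M M). c1 \<le> \<bar>x - x'\<bar> \<and> \<bar>x - x'\<bar> \<le> c2}"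
proof -
  have "closed {w::real. c1 \<le> \<bar>w\<bar> \<and> \<bar>w\<bar> \<le> c2}"
    by (intro closed_Collect_conj closed_Collect_le continuous_intros)
  then have S: "{w::real. c1 \<le> \<bar>w\<bar> \<and> \<bar>w\<bar> \<le> c2} \<in> sets borel" by (rule borel_closed)
  have "(\<lambda>(x, x'). x - x') -` {w. c1 \<le> \<bar>w\<bar> \<and> \<bar>w\<bar> \<le> c2} \<inter> space (M \<Otimes>\<^sub>M M) =
      {(x, x') \<in> space (M \<Otimes>\<^sub>M M). c1 \<le> \<bar>x - x'\<bar> \<and> \<bar>x - x'\<bar> \<le> c2}" by auto
  then show ?thesis unfolding difference_law_def by (simp add: measure_distr[OF measurable_difference S])
qed

text \<open>The supremum need not be attained, so a witness is claimed only for levels strictly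
  below it.\<close>

lemma quadratic_small_ball_witness:
  assumes "c < quadratic_small_ball n \<beta> \<xi> A"
  obtains a b where "c < measure (iid n \<xi>) {x \<in> space (iid n \<xi>).
      (\<Sum>i=1..n. \<Sum>j=1..n. (x i * x j) *\<^sub>R A i j) + (\<Sum>i=1..n. x i *\<^sub>R b i) \<in> cball a \<beta>}"
proof -
  from assms obtain p where "p \<in> range (\<lambda>(a, b). measure (iid n \<xi>) {x \<in> space (iid n \<xi>).
      (\<Sum>i=1..n. \<Sum>j=1..n. (x i * x j) *\<^sub>R A i j) + (\<Sum>i=1..n. x i *\<^sub>R b i) \<in> cball a \<beta>})" "c < p"
    unfolding quadratic_small_ball_def by (rule less_cSupE) auto
  then show ?thesis using that by auto
qed

lemma power_le_powr:
  fixes s :: real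
  assumes "1 \<le> n" "real a \<le> s * ln n"
  shows "8 ^ a \<le> n powr (s * ln 8)"
proof -
  have "(8::real) ^ a = exp (real a * ln 8)" by (simp add: exp_of_nat_mult)
  also have "\<dots> \<le> exp (s * ln n * ln 8)" using assms(2) by (simp add: mult_right_mono)
  also have "\<dots> = n powr (s * ln 8)" using assms(1) by (simp add: powr_def mult_ac)
  finally show ?thesis .
qed

theorem theorem1p7:
  fixes B \<epsilon> c1 c2 c3 :: real
  assumes "0 < \<epsilon>" and "\<epsilon> < 1" and "B > 0"
    and "0 < c1" and "c1 < c2" and "c3 > 0"
  shows "\<exists>(C::real) (n0::nat). C > 0 \<and> n0 > 0 \<and>
    (\<forall>(\<xi> :: real measure) (n::nat) (\<beta>::real) (A :: nat \<Rightarrow> nat \<Rightarrow> real ^ 'd).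
      real_distribution \<xi> \<longrightarrow> anti_concentrated c1 c2 c3 \<xi> \<longrightarrow>
      n \<ge> n0 \<longrightarrow> \<beta> > 0 \<longrightarrow>
      (\<forall>i\<in>{1..n}. \<forall>j\<in>{1..n}. A i j = A j i) \<longrightarrow>
      quadratic_small_ball n \<beta> \<xi> A \<ge> real n powr (- B) \<longrightarrow>
      (\<exists>(k::int) (J :: nat set) (I :: nat set).
        k \<noteq> 0 \<and> \<bar>real_of_int k\<bar> \<le> real n powr C \<and>
        J \<subseteq> {1..n} \<and> real (card J) \<le> C \<and>
        I \<subseteq> {1..n} \<and> real (card I) \<ge> real n - 2 * real n powr \<epsilon> \<and>
        (\<forall>i\<in>I. \<exists>\<kappa> :: nat \<Rightarrow> int.
          (\<forall>l\<in>J. \<bar>real_of_int (\<kappa> l)\<bar> \<le> real n powr C) \<and>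
          measure (iid n (lazy_difference \<xi>))
            {z \<in> space (iid n (lazy_difference \<xi>)).
               norm (\<Sum>j=1..n. z j *\<^sub>R
                 (real_of_int k *\<^sub>R A i j + (\<Sum>l\<in>J. real_of_int (\<kappa> l) *\<^sub>R A l j)))
               \<le> \<beta> * real n powr C}
            \<ge> real n powr (- C))))"
proof -
  \<comment> \<open>The constants are exponents or factors of ln n. In \<rho> = n^(-D), the part 2 B
    accounts for the square in the decoupled estimate and 1 for numerical factors. From (7/8)^a
    \<ge> \<rho> the energy is at most \<sigma> ln n, so n^E bounds 8^a0; r0 is \<sigma> ln n
    divided by the cost of a generator, at least (\<epsilon>/8) ln n; \<tau> ln n bounds the rarely
    omitted indices; \<open>C\<close> collects all losses.\<close>
  define D where "D = 2 * B + 1"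
  define \<sigma> where "\<sigma> = D / ln (8/7)"
  define E where "E = \<sigma> * ln 8"
  define r0 where "r0 = 8 * \<sigma> / \<epsilon>"
  define \<tau> where "\<tau> = (D + E + 2 * r0) / ln (10/9)"
  define C where "C = D + 2 * E + 3 + 3 * r0 + (E + 2) * r0"
  \<comment> \<open>The slack between the exponents of m = n^(\<epsilon>/2) and of 4^J: positive
    since ln 4 < 2, so that n^\<delta> absorbs the constant 3 * c3.\<close>
  define \<delta> where "\<delta> = \<epsilon>/2 - \<epsilon>/4 * ln 4"
  have D: "1 < D" using assms(3) by (simp add: D_def)
  have s: "0 < \<sigma>" using D by (simp add: \<sigma>_def)
  have E: "0 < E" using s by (simp add: E_def)
  have r0: "0 < r0" using s assms(1) by (simp add: r0_def)
  have t: "0 < \<tau>" using D E r0 by (simp add: \<tau>_def)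
  have Er: "0 < (E + 2) * r0" using E r0 by simp
  have C: "0 < C" "E \<le> C" "E + 2 \<le> C" "r0 \<le> C" using D E r0 Er unfolding C_def by linarith+
  have "ln 4 = 2 * ln (2::real)" using ln_realpow[of 2 2] by simp
  also have "\<dots> < 2" using ln_2_less_1 by simp
  finally have d: "0 < \<delta>" using assms(1) by (simp add: \<delta>_def field_simps)
  have "eventually (\<lambda>n::nat. 24 \<le> n \<and> exp (- (real n)\<^sup>2 / 2) < real n powr (- D) / 2 \<and>
      1 / (3 * c3) \<le> real n powr \<delta> \<and> 8 \<le> \<epsilon> * ln (real n) \<and> 1 / c1 \<le> real n \<and>
      8 * ((\<sigma> * ln (real n) + 1) * (real n powr (\<epsilon>/2) + 1)) + \<tau> * ln (real n) \<le> 2 * real n powr \<epsilon>) sequentially"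
  proof (intro eventually_conj)
    show "eventually (\<lambda>n::nat. 24 \<le> n) sequentially" by (rule eventually_ge_at_top)
    show "eventually (\<lambda>n::nat. exp (- (real n)\<^sup>2 / 2) < real n powr (- D) / 2) sequentially"
      using D by real_asymp
    show "eventually (\<lambda>n::nat. 1 / (3 * c3) \<le> real n powr \<delta>) sequentially"
      using d assms(6) by real_asymp
    show "eventually (\<lambda>n::nat. 8 \<le> \<epsilon> * ln (real n)) sequentially" using assms(1) by real_asymp
    show "eventually (\<lambda>n::nat. 1 / c1 \<le> real n) sequentially" by real_asymp
    show "eventually (\<lambda>n::nat. 8 * ((\<sigma> * ln (real n) + 1) * (real n powr (\<epsilon>/2) + 1)) + \<tau> * ln (real n)
        \<le> 2 * real n powr \<epsilon>) sequentially" using assms(1) s t by real_asymp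
  qed
  then obtain n0 where n0: "\<And>n. n \<ge> n0 \<Longrightarrow> 24 \<le> n \<and> exp (- (real n)\<^sup>2 / 2) < real n powr (- D) / 2 \<and>
      1 / (3 * c3) \<le> real n powr \<delta> \<and> 8 \<le> \<epsilon> * ln (real n) \<and> 1 / c1 \<le> real n \<and>
      8 * ((\<sigma> * ln (real n) + 1) * (real n powr (\<epsilon>/2) + 1)) + \<tau> * ln (real n) \<le> 2 * real n powr \<epsilon>"
    unfolding eventually_sequentially by blast
  show ?thesis
  proof (intro exI[of _ C] exI[of _ "Suc n0"] conjI allI impI)
    fix \<xi> :: "real measure" and n :: nat and \<beta> :: real and A :: "nat \<Rightarrow> nat \<Rightarrow> real ^ 'd"
    assume xi: "real_distribution \<xi>" and ac: "anti_concentrated c1 c2 c3 \<xi>" and n: "Suc n0 \<le> n"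
      and beta: "0 < \<beta>" and sym: "\<forall>i\<in>{1..n}. \<forall>j\<in>{1..n}. A i j = A j i"
      and sb: "real n powr (- B) \<le> quadratic_small_ball n \<beta> \<xi> A"
    interpret X: real_distribution \<xi> by fact
    define x where "x = real n"
    have n24: "24 \<le> x" and en: "exp (- x\<^sup>2 / 2) < x powr (- D) / 2" and cn: "1 / (3 * c3) \<le> x powr \<delta>"
      and ln8: "8 \<le> \<epsilon> * ln x" and c1n: "1 / c1 \<le> x"
      and big: "8 * ((\<sigma> * ln x + 1) * (x powr (\<epsilon>/2) + 1)) + \<tau> * ln x \<le> 2 * x powr \<epsilon>"
      using n0[of n] n by (auto simp: x_def)
    have x1: "1 \<le> x" and x0: "0 < x" and lnx: "0 < ln x" using n24 by auto
    define \<rho> where "\<rho> = x powr (- D)"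
    define a0 where "a0 = nat \<lfloor>\<sigma> * ln x\<rfloor>"
    define m where "m = nat \<lceil>x powr (\<epsilon>/2)\<rceil>"
    define J where "J = nat \<lfloor>\<epsilon>/4 * ln x\<rfloor>"
    have a0: "real a0 \<le> \<sigma> * ln x" using s lnx by (simp add: a0_def)
    have mge: "x powr (\<epsilon>/2) \<le> real m" and mle: "real m \<le> x powr (\<epsilon>/2) + 1"
      unfolding m_def by (auto simp: of_nat_nat ceiling_correct)
    have Jle: "real J \<le> \<epsilon>/4 * ln x" unfolding J_def by (rule of_nat_floor) (use ln8 in simp)
    \<comment> \<open>Rounding down loses at most 1, and \<epsilon> ln x \<ge> 8 leaves at least
      half of (\<epsilon>/4) ln x.\<close>
    have Jge: "\<epsilon>/8 * ln x \<le> real J"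
    proof -
      have "\<epsilon>/4 * ln x - 1 \<le> real_of_int \<lfloor>\<epsilon>/4 * ln x\<rfloor>" by linarith
      also have "\<dots> \<le> real J" unfolding J_def by simp
      finally show ?thesis using ln8 by simp
    qed
    have J0: "0 < J" using Jge ln8 by (cases J) auto
    have m0: "0 < m" using mge x0 by (smt (verit) of_nat_0_less_iff powr_gt_zero)
    have a8: "8 ^ a0 \<le> x powr E" unfolding E_def by (rule power_le_powr[OF x1 a0])
    have J4: "4 ^ J \<le> 6 * (c3/2 * real m)"
    proof -
      have "(4::real) ^ J = exp (real J * ln 4)" by (simp add: exp_of_nat_mult)
      also have "\<dots> \<le> exp (\<epsilon>/4 * ln x * ln 4)" using Jle by (simp add: mult_right_mono)
      also have "\<dots> = x powr (\<epsilon>/4 * ln 4)" using x0 by (simp add: powr_def mult_ac)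
      also have "\<dots> \<le> x powr (\<epsilon>/4 * ln 4) * (3 * c3 * x powr \<delta>)"
      proof -
        have "1 \<le> 3 * c3 * x powr \<delta>" using cn assms(6) by (simp add: field_simps)
        then show ?thesis using mult_left_mono[of 1 "3 * c3 * x powr \<delta>" "x powr (\<epsilon>/4 * ln 4)"] by simp
      qed
      also have "\<dots> = 3 * c3 * x powr (\<epsilon>/2)" by (simp add: \<delta>_def flip: powr_add)
      also have "\<dots> \<le> 3 * c3 * real m" using mge assms(6) by simp
      finally show ?thesis by simp
    qed
    have abound: "a \<le> a0" if "\<rho> \<le> (7/8) ^ a" for a
    proof -
      have "ln \<rho> \<le> ln ((7/8) ^ a)" using that x0 by (subst ln_le_cancel_iff) (auto simp: \<rho>_def)
      then have "- D * ln x \<le> real a * ln (7/8)" using x0 by (simp add: \<rho>_def ln_powr ln_realpow)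
      moreover have "ln (7/8::real) = - ln (8/7)" by (subst ln_inverse[symmetric]) auto
      ultimately have "real a * ln (8/7) \<le> D * ln x" by simp
      then have "real a \<le> \<sigma> * ln x" by (simp add: \<sigma>_def field_simps)
      then show ?thesis unfolding a0_def by (simp add: le_nat_floor)
    qed
    have band: "c3 \<le> measure (difference_law \<xi>) {w. c1 \<le> \<bar>w\<bar> \<and> \<bar>w\<bar> \<le> c2}"
      using ac unfolding anti_concentrated_def X.measure_band_difference_law .
    have half: "x powr (- B) / 2 < quadratic_small_ball n \<beta> \<xi> A"
      using sb powr_gt_zero[of x "- B"] x0 unfolding x_def[symmetric] by linarith
    obtain a b where ab: "x powr (- B) / 2 < measure (iid n \<xi>) {x \<in> space (iid n \<xi>).
        (\<Sum>i=1..n. \<Sum>j=1..n. (x i * x j) *\<^sub>R A i j) + (\<Sum>i=1..n. x i *\<^sub>R b i) \<in> cball a \<beta>}"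
      by (rule quadratic_small_ball_witness[OF half])
    have large: "exp 1 * (2 * \<rho>) \<le> (measure (iid n \<xi>) {x \<in> space (iid n \<xi>).
        (\<Sum>i=1..n. \<Sum>j=1..n. (x i * x j) *\<^sub>R A i j) + (\<Sum>i=1..n. x i *\<^sub>R b i) \<in> cball a \<beta>})\<^sup>2"
    proof -
      have "x * \<rho> = x powr (- 2 * B)" using x0 powr_add[of x 1 "- D"] by (simp add: \<rho>_def D_def)
      then have sq: "(x powr (- B) / 2)\<^sup>2 = x * \<rho> / 4"
        by (simp add: power_divide power2_eq_square flip: powr_add)
      \<comment> \<open>With exp 1 \<le> 3 the claim becomes 6 \<rho> \<le> x \<rho>/4, whence the
        threshold 24.\<close>
      have "exp 1 * (2 * \<rho>) \<le> 3 * (2 * \<rho>)" using e_less_272 by (intro mult_right_mono) (auto simp: \<rho>_def)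
      also have "\<dots> \<le> x * \<rho> / 4" using n24 mult_right_mono[of 24 x \<rho>] by (simp add: \<rho>_def)
      also have "\<dots> = (x powr (- B) / 2)\<^sup>2" using sq by simp
      also have "\<dots> \<le> (measure (iid n \<xi>) {x \<in> space (iid n \<xi>).
        (\<Sum>i=1..n. \<Sum>j=1..n. (x i * x j) *\<^sub>R A i j) + (\<Sum>i=1..n. x i *\<^sub>R b i) \<in> cball a \<beta>})\<^sup>2"
        using ab by (intro power_mono) auto
      finally show ?thesis .
    qed
    \<comment> \<open>\<open>R\<close> is taken to be n: exp(-n^2/2) is below every power of n,
      while the radius grows only by the factor n.\<close>
    from finite_inverse_quadratic[OF xi beta _ assms(4,6) band m0 J0 J4 x0 en[folded \<rho>_def] abound large] sym
    obtain k W T0 T1 where cand: "(k, W) \<in> candidates n a0 J" and T: "T0 \<subseteq> {1..n}" "T1 \<subseteq> {1..n}"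
      and T0: "\<rho> / real (card (candidates n a0 J)) \<le> (9/10) ^ card T0" and T1: "card T1 \<le> 8 * ((a0 + 1) * m)"
      and good: "\<And>i. i \<in> {1..n} - T0 - T1 \<Longrightarrow> \<exists>\<kappa>::nat \<Rightarrow> int. (\<forall>l\<in>W. \<bar>real_of_int (\<kappa> l)\<bar> \<le> 8 ^ a0) \<and>
        \<rho> / real (card (candidates n a0 J)) / 8 / (2 * 8 ^ a0 + 1) ^ card W \<le>
        measure (iid n (lazy_difference \<xi>)) {z \<in> space (iid n (lazy_difference \<xi>)).
          norm (\<Sum>j=1..n. z j *\<^sub>R (real k *\<^sub>R A i j + (\<Sum>l\<in>W. real_of_int (\<kappa> l) *\<^sub>R A l j)))
            \<le> \<beta> * 8 ^ a0 * x / c1}"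
      by blast
    have k: "1 \<le> k" "real k \<le> 8 ^ a0" and W: "W \<subseteq> {1..n}" "J * card W \<le> a0"
    proof -
      show "1 \<le> k" using cand by (simp add: candidates_def)
      have "k \<le> 8 ^ a0" using cand by (simp add: candidates_def)
      then have "real k \<le> real (8 ^ a0)" by (simp only: of_nat_le_iff)
      then show "real k \<le> 8 ^ a0" by simp
      show "W \<subseteq> {1..n}" "J * card W \<le> a0" using cand by (auto simp: candidates_def)
    qed
    have rank: "real q \<le> r0" if "J * q \<le> a0" for q
    proof -
      have "(\<epsilon>/8 * ln x) * real q \<le> real J * real q" using Jge by (rule mult_right_mono) simp
      also have "\<dots> \<le> real a0" unfolding of_nat_mult[symmetric] of_nat_le_iff by (rule that)
      also have "\<dots> \<le> \<sigma> * ln x" by (rule a0)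
      finally have "real q * (\<epsilon>/8) * ln x \<le> \<sigma> * ln x" by (simp add: mult_ac)
      then have "real q * (\<epsilon>/8) \<le> \<sigma>" using lnx by simp
      then show ?thesis using assms(1) by (simp add: r0_def field_simps)
    qed
    have cW: "real (card W) \<le> r0" by (rule rank[OF W(2)])
    have x2: "x + 1 \<le> x powr 2"
    proof -
      have "x + 1 \<le> 2 * x" using x1 by simp
      also have "\<dots> \<le> x * x" using n24 by (intro mult_right_mono) auto
      finally show ?thesis using x0 by (simp add: powr_numeral power2_eq_square)
    qed
    have pow_le: "y ^ q \<le> x powr (e * r0)" if "0 \<le> y" "y \<le> x powr e" "0 \<le> e" "real q \<le> r0" for y e and q :: nat
    proof -
      have "y ^ q \<le> (x powr e) ^ q" using that by (intro power_mono) auto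
      also have "\<dots> = x powr (e * real q)" using x0 by (simp add: powr_powr powr_realpow[symmetric])
      also have "\<dots> \<le> x powr (e * r0)" using that x1 by (intro powr_mono mult_left_mono) auto
      finally show ?thesis .
    qed
    have cardc: "real (card (candidates n a0 J)) \<le> x powr (E + 2 * r0)"
    proof -
      have "real (card (candidates n a0 J)) \<le> 8 ^ a0 * (x + 1) ^ (a0 div J)"
        unfolding x_def by (rule card_candidates_le[OF J0])
      also have "\<dots> \<le> x powr E * x powr (2 * r0)"
        using a8 x2 x1 by (intro mult_mono pow_le rank) auto
      finally show ?thesis by (simp add: powr_add)
    qed
    have cardpos: "0 < real (card (candidates n a0 J))"
      using cand finite_candidates[of n a0 J] by (auto simp: card_gt_0_iff)
    have q: "x powr (- (D + E + 2 * r0)) \<le> \<rho> / real (card (candidates n a0 J))"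
    proof -
      have "x powr (- (D + E + 2 * r0)) = \<rho> / x powr (E + 2 * r0)"
        unfolding \<rho>_def powr_diff[symmetric] by (simp add: algebra_simps)
      also have "\<dots> \<le> \<rho> / real (card (candidates n a0 J))"
        using cardc cardpos x0 by (intro divide_left_mono) (auto simp: \<rho>_def)
      finally show ?thesis .
    qed
    have cT0: "real (card T0) \<le> \<tau> * ln x"
    proof -
      have "ln (x powr (- (D + E + 2 * r0))) \<le> ln ((9/10) ^ card T0)"
        using order_trans[OF q T0] x0 by (subst ln_le_cancel_iff) auto
      then have "- (D + E + 2 * r0) * ln x \<le> real (card T0) * ln (9/10)" using x0 by (simp add: ln_powr ln_realpow)
      moreover have "ln (9/10::real) = - ln (10/9)" by (subst ln_inverse[symmetric]) auto
      ultimately have "real (card T0) * ln (10/9) \<le> (D + E + 2 * r0) * ln x" by (simp add: algebra_simps)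
      then show ?thesis by (simp add: \<tau>_def field_simps)
    qed
    define I where "I = {1..n} - T0 - T1"
    \<comment> \<open>T0 is of logarithmic size and T1 of order n^(\<epsilon>/2) ln n at most; for
      large n both together fit into 2 n^\<epsilon>.\<close>
    have cI: "x - 2 * x powr \<epsilon> \<le> real (card I)"
    proof -
      have fin: "finite T0" "finite T1" using T by (auto intro: finite_subset[OF _ finite_atLeastAtMost])
      have "n \<le> card I + (card T0 + card T1)"
      proof -
        have "card {1..n} \<le> card (I \<union> (T0 \<union> T1))" using fin by (intro card_mono) (auto simp: I_def)
        also have "\<dots> \<le> card I + (card T0 + card T1)" by (meson add_left_mono card_Un_le le_trans)
        finally show ?thesis by simp
      qed
      then have "x \<le> real (card I) + (real (card T0) + real (card T1))"
        unfolding x_def of_nat_add[symmetric] of_nat_le_iff .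
      moreover have "real (card T1) \<le> 8 * ((\<sigma> * ln x + 1) * (x powr (\<epsilon>/2) + 1))"
      proof -
        have "real (card T1) \<le> real (8 * ((a0 + 1) * m))" using T1 by (simp only: of_nat_le_iff)
        also have "\<dots> = 8 * ((real a0 + 1) * real m)" by (simp add: algebra_simps)
        also have "\<dots> \<le> 8 * ((\<sigma> * ln x + 1) * (x powr (\<epsilon>/2) + 1))"
          using a0 mle by (intro mult_left_mono mult_mono) auto
        finally show ?thesis .
      qed
      ultimately show ?thesis using cT0 big by linarith
    qed
    have EC: "x powr E \<le> x powr C" using C x1 by (intro powr_mono) auto
    have radius: "\<beta> * 8 ^ a0 * x / c1 \<le> \<beta> * x powr C"
    proof -
      have "8 ^ a0 * x / c1 = 8 ^ a0 * x * (1 / c1)" by simp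
      also have "\<dots> \<le> x powr E * x * x" using a8 c1n x0 assms(4) by (intro mult_mono) auto
      also have "\<dots> = x powr (E + 2)" using x0 by (simp add: powr_add powr_numeral power2_eq_square)
      also have "\<dots> \<le> x powr C" using C x1 by (intro powr_mono) auto
      finally have "\<beta> * (8 ^ a0 * x / c1) \<le> \<beta> * x powr C" using beta by (intro mult_left_mono) auto
      then show ?thesis by (simp add: mult.assoc)
    qed
    have prob: "x powr (- C) \<le> \<rho> / real (card (candidates n a0 J)) / 8 / (2 * 8 ^ a0 + 1) ^ card W"
    proof -
      have "1 \<le> (8::real) ^ a0" by simp
      then have "2 * 8 ^ a0 + 1 \<le> 3 * (8::real) ^ a0" by simp
      also have "\<dots> \<le> x powr 2 * x powr E" using a8 x2 n24 by (intro mult_mono) auto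
      finally have "2 * 8 ^ a0 + 1 \<le> x powr (E + 2)" by (simp add: powr_add mult.commute)
      then have p: "(2 * 8 ^ a0 + 1) ^ card W \<le> x powr ((E + 2) * r0)" using E cW by (intro pow_le) auto
      have "x powr (- C) \<le> x powr (- (D + E + 2 * r0) - 1 - (E + 2) * r0)"
        using x1 E r0 by (intro powr_mono) (auto simp: C_def)
      also have "\<dots> = x powr (- (D + E + 2 * r0)) / x / x powr ((E + 2) * r0)"
        using x0 by (simp add: powr_diff)
      also have "\<dots> \<le> \<rho> / real (card (candidates n a0 J)) / 8 / (2 * 8 ^ a0 + 1) ^ card W"
        using q p n24 by (intro frac_le) (auto simp: \<rho>_def add_pos_pos)
      finally show ?thesis .
    qed
    show "\<exists>(k::int) (J :: nat set) (I :: nat set).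
        k \<noteq> 0 \<and> \<bar>real_of_int k\<bar> \<le> real n powr C \<and>
        J \<subseteq> {1..n} \<and> real (card J) \<le> C \<and>
        I \<subseteq> {1..n} \<and> real (card I) \<ge> real n - 2 * real n powr \<epsilon> \<and>
        (\<forall>i\<in>I. \<exists>\<kappa> :: nat \<Rightarrow> int.
          (\<forall>l\<in>J. \<bar>real_of_int (\<kappa> l)\<bar> \<le> real n powr C) \<and>
          measure (iid n (lazy_difference \<xi>))
            {z \<in> space (iid n (lazy_difference \<xi>)).
               norm (\<Sum>j=1..n. z j *\<^sub>R
                 (real_of_int k *\<^sub>R A i j + (\<Sum>l\<in>J. real_of_int (\<kappa> l) *\<^sub>R A l j)))
               \<le> \<beta> * real n powr C}
            \<ge> real n powr (- C))"
      unfolding x_def[symmetric]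
    proof (rule exI[of _ "int k"], rule exI[of _ W], rule exI[of _ I], intro conjI ballI)
      show "int k \<noteq> 0" using k by simp
      have "real k \<le> x powr C" using k(2) a8 EC by linarith
      then show "\<bar>real_of_int (int k)\<bar> \<le> x powr C" by simp
      show "real (card W) \<le> C" using cW C(4) by simp
      fix i assume "i \<in> I"
      then obtain \<kappa> :: "nat \<Rightarrow> int" where kap: "\<forall>l\<in>W. \<bar>real_of_int (\<kappa> l)\<bar> \<le> 8 ^ a0"
        and pk: "\<rho> / real (card (candidates n a0 J)) / 8 / (2 * 8 ^ a0 + 1) ^ card W \<le>
        measure (iid n (lazy_difference \<xi>)) {z \<in> space (iid n (lazy_difference \<xi>)).
          norm (\<Sum>j=1..n. z j *\<^sub>R (real k *\<^sub>R A i j + (\<Sum>l\<in>W. real_of_int (\<kappa> l) *\<^sub>R A l j)))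
            \<le> \<beta> * 8 ^ a0 * x / c1}" using good unfolding I_def by blast
      interpret L1: real_distribution "lazy_difference \<xi>" by (rule real_distribution_lazy_difference[OF xi])
      interpret L: prob_space "iid n (lazy_difference \<xi>)"
        unfolding iid_def by (rule prob_space_PiM) (rule L1.prob_space_axioms)
      have meas: "(\<lambda>z. \<Sum>j=1..n. z j *\<^sub>R (real k *\<^sub>R A i j + (\<Sum>l\<in>W. real_of_int (\<kappa> l) *\<^sub>R A l j)))
          \<in> borel_measurable (iid n (lazy_difference \<xi>))"
        unfolding iid_def by measurable
      have "measure (iid n (lazy_difference \<xi>)) {z \<in> space (iid n (lazy_difference \<xi>)).
          norm (\<Sum>j=1..n. z j *\<^sub>R (real k *\<^sub>R A i j + (\<Sum>l\<in>W. real_of_int (\<kappa> l) *\<^sub>R A l j)))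
            \<le> \<beta> * 8 ^ a0 * x / c1} \<le> measure (iid n (lazy_difference \<xi>)) {z \<in> space (iid n (lazy_difference \<xi>)).
          norm (\<Sum>j=1..n. z j *\<^sub>R (real k *\<^sub>R A i j + (\<Sum>l\<in>W. real_of_int (\<kappa> l) *\<^sub>R A l j)))
            \<le> \<beta> * x powr C}"
        using radius meas by (intro L.finite_measure_mono) auto
      with prob pk have "x powr (- C) \<le> measure (iid n (lazy_difference \<xi>)) {z \<in> space (iid n (lazy_difference \<xi>)).
          norm (\<Sum>j=1..n. z j *\<^sub>R (real_of_int (int k) *\<^sub>R A i j + (\<Sum>l\<in>W. real_of_int (\<kappa> l) *\<^sub>R A l j)))
            \<le> \<beta> * x powr C}" by simp
      moreover have "\<forall>l\<in>W. \<bar>real_of_int (\<kappa> l)\<bar> \<le> x powr C" using kap a8 EC by fastforce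
      ultimately show "\<exists>\<kappa> :: nat \<Rightarrow> int. (\<forall>l\<in>W. \<bar>real_of_int (\<kappa> l)\<bar> \<le> x powr C) \<and>
          x powr (- C) \<le> measure (iid n (lazy_difference \<xi>)) {z \<in> space (iid n (lazy_difference \<xi>)).
          norm (\<Sum>j=1..n. z j *\<^sub>R (real_of_int (int k) *\<^sub>R A i j + (\<Sum>l\<in>W. real_of_int (\<kappa> l) *\<^sub>R A l j)))
            \<le> \<beta> * x powr C}" by (intro exI[of _ \<kappa>] conjI)
    qed (use W cI in \<open>auto simp: I_def\<close>)
  qed (use C in auto)
qed

end
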